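(* Let $n \ge 3$ and let $H=\langle a_1, a_2, \ldots, a_n\rangle$ be a numerical semigroup (with $a_1,\dots,a_n$ positive integers, $\gcd(a_1,\dots,a_n)=1$) which is minimally generated by the $n$ numbers $a_1,\dots,a_n$. Let $k$ be a field, let $S=k[x_1,\dots,x_n]$ be the polynomial ring graded by $\deg x_i=a_i$, and let $I=\ker\varphi$, where $\varphi:S\to k[t]$ is the $k$-algebra homomorphism with $\varphi(x_i)=t^{a_i}$ for $1\le i\le n$. Then the following conditions are equivalent. (1) $I=\mathrm{I}_2\begin{pmatrix} f_1 & f_2 & \cdots & f_n\\ x_1 & x_2 & \cdots & x_n\end{pmatrix}$ for some homogeneous elements $f_1, f_2, \ldots, f_n \in S_+=(x_i \mid 1\le i\le n)$. (2) After a suitable permutation of $a_1,\ldots,a_n$ (and correspondingly of $x_1,\dots,x_n$) if necessary, $$I=\mathrm{I}_2\begin{pmatrix} x_2^{\ell_2} & x_3^{\ell_3} & \cdots & x_n^{\ell_n} & x_1^{\ell_1}\\ x_1 & x_2 & \cdots & x_{n-1} & x_n\end{pmatrix}$$ for some positive integers $\ell_1,\ell_2,\ldots,\ell_n>0$. (3) There exists an element $\alpha\in\mathrm{PF}(H)$ such that $(n-1)\alpha\notin H$. When this is the case, the following assertions hold, where $f_1,\dots,f_n$ are as in (1), $\ell_1,\dots,\ell_n$ (and the ordering of the generators they refer to) are as in (2), and $\alpha$ is as in (3). (a) For each $1\le i\le n$, $\ell_i=\min\{\ell>0 \mid \ell a_i\in H_i\}-1$, where $H_i=\langle a_1,\ldots,a_{i-1},a_{i+1},\ldots,a_n\rangle$.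 (b) $\alpha=\deg f_i-a_i$ for all $1\le i\le n$. (c) $\mathrm{PF}(H)=\{\alpha,2\alpha,\ldots,(n-1)\alpha\}$. (d) The ring $R=k[H]$ is an almost Gorenstein graded ring, i.e., the numerical semigroup $H$ is almost symmetric.
   Context: For positive integers $b_1,\dots,b_m$, $\langle b_1,\dots,b_m\rangle=\{\sum_{i=1}^m c_ib_i \mid 0\le c_i\in\mathbb{Z}\}$ (no gcd condition is imposed for $H_i$). The semigroup ring is $R=k[H]=k[t^{a_1},\dots,t^{a_n}]\subseteq k[t]$, graded by $\deg t=1$; it is the image of $\varphi$, so $R\cong S/I$. For a $2\times n$ matrix $A$ with entries in $S$, $\mathrm{I}_2(A)$ is the ideal of $S$ generated by the $2\times 2$ minors of $A$. The Frobenius number is $\mathrm{f}(H)=\max(\mathbb{Z}\setminus H)$. The set of pseudo-Frobenius numbers is $\mathrm{PF}(H)=\{\alpha\in\mathbb{Z}\setminus H \mid \alpha+a_i\in H \text{ for all } 1\le i\le n\}$; it contains $\mathrm{f}(H)$. Almost Gorenstein graded ring: let $\mathrm{K}_R$ be the graded canonical module of $R$ (concretely $\mathrm{K}_R=\sum_{\alpha\in\mathrm{PF}(H)}R\,t^{-\alpha}$), let $\mathfrak{M}=(t^{a_1},\dots,t^{a_n})$ be the graded maximal ideal of $R$, and let $a=\mathrm{a}(R)$ be the $a$-invariant of $R$ (here $a=\mathrm{f}(H)$). Then $R$ is an almost Gorenstein graded ring if there is an exact sequence $0\to R\to\mathrm{K}_R(-a)\to C\to 0$ of graded $R$-modules with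 $\mathfrak{M}C=(0)$, where $[\mathrm{K}_R(-a)]_m=[\mathrm{K}_R]_{m-a}$ for all $m \in \mathbb{Z}$. Almost symmetric: writing $\mathrm{PF}(H)=\{\alpha_1<\alpha_2<\dots<\alpha_r=\mathrm{f}(H)\}$, $H$ is almost symmetric if $\alpha_i+\alpha_{r-i}=\mathrm{f}(H)$ for all $1\le i\le r-1$; for numerical semigroup rings this is equivalent to $k[H]$ being an almost Gorenstein graded ring. *)

theory Defs
  imports
    "HOL-Library.Poly_Mapping"
    "HOL-Computational_Algebra.Formal_Laurent_Series"
    "HOL-Combinatorics.Permutations"
    "HOL-Algebra.Ideal"
    "HOL-Algebra.Module"
begin

section \<open>Numerical semigroups\<close>

text \<open>A finite family of generators is given by an index set \<open>J\<close> and \<open>b :: nat \<Rightarrow> nat\<close>;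
  the semigroup lives in the integers, since (pseudo-)Frobenius numbers are taken in the
  complement with respect to all integers.\<close>

definition sgrp :: "nat set \<Rightarrow> (nat \<Rightarrow> nat) \<Rightarrow> int set" where
  "sgrp J b = {int (\<Sum>i\<in>J. c i * b i) | c. True}"

text \<open>No proper subfamily generates the same semigroup; in particular the generators
  are pairwise distinct.\<close>

definition minimally_generates :: "nat \<Rightarrow> (nat \<Rightarrow> nat) \<Rightarrow> bool" where
  "minimally_generates n a \<longleftrightarrow> (\<forall>J. J \<subset> {1..n} \<longrightarrow> sgrp J a \<noteq> sgrp {1..n} a)"

definition frobenius :: "int set \<Rightarrow> int" where
  "frobenius H = (GREATEST z. z \<notin> H)"

definition PF :: "nat \<Rightarrow> (nat \<Rightarrow> nat) \<Rightarrow> int set" where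
  "PF n a = {\<alpha>. \<alpha> \<notin> sgrp {1..n} a \<and> (\<forall>i\<in>{1..n}. \<alpha> + int (a i) \<in> sgrp {1..n} a)}"

definition almost_symmetric :: "nat \<Rightarrow> (nat \<Rightarrow> nat) \<Rightarrow> bool" where
  "almost_symmetric n a \<longleftrightarrow>
     (\<exists>r (\<beta> :: nat \<Rightarrow> int). 1 \<le> r \<and> strict_mono_on {1..r} \<beta> \<and> PF n a = \<beta> ` {1..r} \<and>
        \<beta> r = frobenius (sgrp {1..n} a) \<and>
        (\<forall>i\<in>{1..r - 1}. \<beta> i + \<beta> (r - i) = frobenius (sgrp {1..n} a)))"

section \<open>The polynomial ring\<close>

text \<open>Polynomials in countably many variables are the monoid algebra of the finitely
  supported exponent vectors; the ring \<open>k[x\<^sub>1, \<dots>, x\<^sub>n]\<close> consists of those in which only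
  the variables with index in \<open>{1..n}\<close> occur.\<close>

type_synonym 'k mpoly = "(nat \<Rightarrow>\<^sub>0 nat) \<Rightarrow>\<^sub>0 'k"

definition poly_ring :: "nat \<Rightarrow> ('k::field) mpoly ring" where
  "poly_ring n = \<lparr>carrier = {p. \<forall>m\<in>Poly_Mapping.keys p. Poly_Mapping.keys m \<subseteq> {1..n}},
     mult = (*), one = 1, zero = 0, add = (+)\<rparr>"

lemma cring_poly_ring: "cring (poly_ring n :: ('k::field) mpoly ring)"
proof -
  let ?R = "poly_ring n :: 'k mpoly ring"
  have ops: "x \<oplus>\<^bsub>?R\<^esub> y = x + y" "x \<otimes>\<^bsub>?R\<^esub> y = x * y" "\<zero>\<^bsub>?R\<^esub> = 0" "\<one>\<^bsub>?R\<^esub> = 1" for x y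
    by (simp_all add: poly_ring_def)
  have add: "p + q \<in> carrier ?R" if "p \<in> carrier ?R" "q \<in> carrier ?R" for p q
    using that Poly_Mapping.keys_add by (fastforce simp: poly_ring_def)
  have mult: "p * q \<in> carrier ?R" if *: "p \<in> carrier ?R" "q \<in> carrier ?R" for p q
    unfolding poly_ring_def partial_object.simps mem_Collect_eq
  proof
    fix m assume "m \<in> Poly_Mapping.keys (p * q)"
    then obtain u v where "u \<in> Poly_Mapping.keys p" "v \<in> Poly_Mapping.keys q" "m = u + v"
      using Poly_Mapping.keys_mult[of p q] by blast
    then show "Poly_Mapping.keys m \<subseteq> {1..n}"
      using * Poly_Mapping.keys_add[of u v] by (fastforce simp: poly_ring_def)
  qed
  have uminus: "- p \<in> carrier ?R" if "p \<in> carrier ?R" for p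
    using that by (simp add: poly_ring_def)
  have zero: "0 \<in> carrier ?R" and one: "1 \<in> carrier ?R"
    by (auto simp: poly_ring_def)
  have "abelian_group ?R"
  proof (rule abelian_groupI)
    show "\<exists>y\<in>carrier ?R. y \<oplus>\<^bsub>?R\<^esub> x = \<zero>\<^bsub>?R\<^esub>" if "x \<in> carrier ?R" for x
      using uminus[OF that] by (intro bexI[of _ "- x"]) (simp_all add: ops)
  qed (simp_all add: ops add zero add.assoc add.commute)
  moreover have "comm_monoid ?R"
    by (rule comm_monoidI) (simp_all add: ops mult one mult.assoc mult.commute)
  ultimately show ?thesis
    by (rule cringI) (simp add: ops distrib_right)
qed

definition Var :: "nat \<Rightarrow> ('k::field) mpoly" where
  "Var i = Poly_Mapping.single (Poly_Mapping.single i 1) 1"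

definition irrelevant_ideal :: "nat \<Rightarrow> ('k::field) mpoly set" where
  "irrelevant_ideal n = Idl\<^bsub>poly_ring n\<^esub> (Var ` {1..n})"

definition wdeg_mon :: "(nat \<Rightarrow> nat) \<Rightarrow> (nat \<Rightarrow>\<^sub>0 nat) \<Rightarrow> nat" where
  "wdeg_mon a m = (\<Sum>i\<in>Poly_Mapping.keys m. Poly_Mapping.lookup m i * a i)"

text \<open>As usual, the zero polynomial counts as homogeneous.\<close>

definition homogeneous :: "(nat \<Rightarrow> nat) \<Rightarrow> ('k::field) mpoly \<Rightarrow> bool" where
  "homogeneous a f \<longleftrightarrow> (\<exists>d. \<forall>m\<in>Poly_Mapping.keys f. wdeg_mon a m = d)"

text \<open>The degree is meaningful only for nonzero polynomials (\<open>Max {}\<close> is unspecified).\<close>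

definition wdegree :: "(nat \<Rightarrow> nat) \<Rightarrow> ('k::field) mpoly \<Rightarrow> nat" where
  "wdegree a f = Max (wdeg_mon a ` Poly_Mapping.keys f)"

text \<open>The matrix has first row \<open>u 1, \<dots>, u n\<close> and second row \<open>v 1, \<dots>, v n\<close>.\<close>

definition I2 :: "nat \<Rightarrow> (nat \<Rightarrow> ('k::field) mpoly) \<Rightarrow> (nat \<Rightarrow> 'k mpoly) \<Rightarrow> 'k mpoly set" where
  "I2 n u v = Idl\<^bsub>poly_ring n\<^esub> {u i * v j - u j * v i | i j. 1 \<le> i \<and> i < j \<and> j \<le> n}"

section \<open>The semigroup ring and its defining ideal\<close>

definition phi :: "(nat \<Rightarrow> nat) \<Rightarrow> ('k::field) mpoly \<Rightarrow> 'k poly" where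
  "phi a p = (\<Sum>m\<in>Poly_Mapping.keys p. [:Poly_Mapping.lookup p m:] *
      (\<Prod>i\<in>Poly_Mapping.keys m. monom 1 (a i) ^ Poly_Mapping.lookup m i))"

text \<open>The map is the homomorphism of \<open>k\<close>-algebras determined by \<open>x\<^sub>i \<mapsto> t ^ a i\<close>
  (\<open>phi_const\<close>, \<open>phi_Var\<close>, \<open>phi_add\<close>, \<open>phi_mult\<close> below).\<close>

lemma phi_Var: "phi a (Var i :: ('k::field) mpoly) = monom 1 (a i)"
  by (simp add: phi_def Var_def)

lemma phi_zero: "phi a 0 = 0"
  by (simp add: phi_def)

lemma phi_const: "phi a (Poly_Mapping.single 0 c :: ('k::field) mpoly) = [:c:]"
  by (simp add: phi_def)

lemma phi_superset:
  assumes "finite A" "Poly_Mapping.keys p \<subseteq> A"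
  shows "phi a p = (\<Sum>m\<in>A. [:Poly_Mapping.lookup p m:] *
      (\<Prod>i\<in>Poly_Mapping.keys m. monom 1 (a i) ^ Poly_Mapping.lookup m i))"
  unfolding phi_def using assms
  by (intro sum.mono_neutral_left) (auto simp: in_keys_iff)

lemma phi_add: "phi a (p + q) = phi a p + phi a (q :: ('k::field) mpoly)"
proof -
  let ?A = "Poly_Mapping.keys p \<union> Poly_Mapping.keys q"
  have "Poly_Mapping.keys (p + q) \<subseteq> ?A" by (rule Poly_Mapping.keys_add)
  then show ?thesis
    by (simp add: phi_superset[of ?A] Poly_Mapping.lookup_add smult_add_left sum.distrib)
qed

lemma phi_single: "phi a (Poly_Mapping.single m c :: ('k::field) mpoly) = [:c:] *
   (\<Prod>i\<in>Poly_Mapping.keys m. monom 1 (a i) ^ Poly_Mapping.lookup m i)"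
  by (simp add: phi_def)

lemma mon_superset:
  assumes "finite A" "Poly_Mapping.keys m \<subseteq> A"
  shows "(\<Prod>i\<in>Poly_Mapping.keys m. (monom 1 (a i) :: ('k::field) poly) ^ Poly_Mapping.lookup m i)
     = (\<Prod>i\<in>A. monom 1 (a i) ^ Poly_Mapping.lookup m i)"
  using assms by (intro prod.mono_neutral_left) (auto simp: in_keys_iff)

lemma phi_single_mult: "phi a (Poly_Mapping.single m c * Poly_Mapping.single m' c' :: ('k::field) mpoly)
  = phi a (Poly_Mapping.single m c) * phi a (Poly_Mapping.single m' c')"
proof -
  let ?A = "Poly_Mapping.keys m \<union> Poly_Mapping.keys m'"
  have k: "Poly_Mapping.keys (m + m') \<subseteq> ?A" by (rule Poly_Mapping.keys_add)
  let ?g = "\<lambda>m. \<Prod>i\<in>?A. (monom 1 (a i) :: 'k poly) ^ Poly_Mapping.lookup m i"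
  have e: "(\<Prod>i\<in>Poly_Mapping.keys u. (monom 1 (a i) :: 'k poly) ^ Poly_Mapping.lookup u i) = ?g u"
    if "u \<in> {m, m', m + m'}" for u
    using that k by (intro mon_superset) auto
  have "?g (m + m') = ?g m * ?g m'"
    by (simp add: Poly_Mapping.lookup_add power_add prod.distrib)
  then show ?thesis
    unfolding Poly_Mapping.mult_single phi_single by (simp add: e mult.commute)
qed

lemma poly_mapping_single_induct [case_names zero add]:
  fixes p :: "'x \<Rightarrow>\<^sub>0 'b::comm_monoid_add"
  assumes z: "P 0" and st: "\<And>m c q. P q \<Longrightarrow> P (Poly_Mapping.single m c + q)"
  shows "P p"
proof -
  have "P (\<Sum>m\<in>A. Poly_Mapping.single m (Poly_Mapping.lookup p m))" if "finite A" for A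
    using that by (induction A rule: finite_induct) (auto intro: z st)
  moreover have "(\<Sum>m\<in>Poly_Mapping.keys p. Poly_Mapping.single m (Poly_Mapping.lookup p m)) = p"
    by (rule poly_mapping_eqI)
       (simp add: lookup_sum lookup_single when_def in_keys_iff sum.delta if_distrib cong: if_cong)
  ultimately show ?thesis
    by (metis finite_keys)
qed

lemma phi_mult: "phi a (p * q) = phi a p * phi a (q :: ('k::field) mpoly)"
proof -
  have 1: "phi a (Poly_Mapping.single m c * q) = phi a (Poly_Mapping.single m c) * phi a q" for m c
    by (induction q rule: poly_mapping_single_induct)
       (auto simp: phi_single_mult distrib_left phi_add phi_zero)
  show ?thesis
    by (induction p rule: poly_mapping_single_induct)
       (auto simp: 1 distrib_right phi_add phi_zero)
qed

definition defining_ideal :: "nat \<Rightarrow> (nat \<Rightarrow> nat) \<Rightarrow> ('k::field) mpoly set" where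
  "defining_ideal n a = {p \<in> carrier (poly_ring n). phi a p = 0}"

definition semigroup_ring :: "nat \<Rightarrow> (nat \<Rightarrow> nat) \<Rightarrow> ('k::field) poly ring" where
  "semigroup_ring n a = \<lparr>carrier = phi a ` carrier (poly_ring n),
     mult = (*), one = 1, zero = 0, add = (+)\<rparr>"

definition semigroup_ring_grading :: "nat \<Rightarrow> (nat \<Rightarrow> nat) \<Rightarrow> int \<Rightarrow> ('k::field) poly set" where
  "semigroup_ring_grading n a d =
     {p \<in> carrier (semigroup_ring n a). \<forall>i. coeff p i \<noteq> 0 \<longrightarrow> int i = d}"

definition max_ideal :: "nat \<Rightarrow> (nat \<Rightarrow> nat) \<Rightarrow> ('k::field) poly set" where
  "max_ideal n a = Idl\<^bsub>semigroup_ring n a\<^esub> ((\<lambda>i. monom 1 (a i)) ` {1..n})"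

section \<open>Graded modules\<close>

definition graded_module ::
  "('a, 'r) ring_scheme \<Rightarrow> (int \<Rightarrow> 'a set) \<Rightarrow> ('a, 'b, 'm) module_scheme \<Rightarrow> (int \<Rightarrow> 'b set) \<Rightarrow> bool" where
  "graded_module R Rg M Mg \<longleftrightarrow>
     module R M \<and>
     (\<forall>d. additive_subgroup (Mg d) M) \<and>
     (\<forall>d e. \<forall>r\<in>Rg d. \<forall>x\<in>Mg e. r \<odot>\<^bsub>M\<^esub> x \<in> Mg (d + e)) \<and>
     (\<forall>x\<in>carrier M. \<exists>!c. (\<forall>d. c d \<in> Mg d) \<and> finite {d. c d \<noteq> \<zero>\<^bsub>M\<^esub>} \<and>
        x = (\<Oplus>\<^bsub>M\<^esub>d\<in>{d. c d \<noteq> \<zero>\<^bsub>M\<^esub>}. c d))"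

text \<open>Graded homomorphisms are of degree 0.\<close>

definition graded_hom ::
  "('a, 'r) ring_scheme \<Rightarrow> ('a, 'b, 'm) module_scheme \<Rightarrow> (int \<Rightarrow> 'b set) \<Rightarrow>
   ('a, 'c, 'n) module_scheme \<Rightarrow> (int \<Rightarrow> 'c set) \<Rightarrow> ('b \<Rightarrow> 'c) \<Rightarrow> bool" where
  "graded_hom R M Mg N Ng h \<longleftrightarrow>
     (\<forall>x\<in>carrier M. h x \<in> carrier N) \<and>
     (\<forall>x\<in>carrier M. \<forall>y\<in>carrier M. h (x \<oplus>\<^bsub>M\<^esub> y) = h x \<oplus>\<^bsub>N\<^esub> h y) \<and>
     (\<forall>r\<in>carrier R. \<forall>x\<in>carrier M. h (r \<odot>\<^bsub>M\<^esub> x) = r \<odot>\<^bsub>N\<^esub> h x) \<and>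
     (\<forall>d. \<forall>x\<in>Mg d. h x \<in> Ng d)"

definition graded_short_exact ::
  "('a, 'r) ring_scheme \<Rightarrow> (int \<Rightarrow> 'a set) \<Rightarrow> ('a, 'b, 'm) module_scheme \<Rightarrow> (int \<Rightarrow> 'b set) \<Rightarrow>
   ('a, 'c, 'n) module_scheme \<Rightarrow> (int \<Rightarrow> 'c set) \<Rightarrow> ('a, 'd, 'o) module_scheme \<Rightarrow> (int \<Rightarrow> 'd set) \<Rightarrow>
   ('b \<Rightarrow> 'c) \<Rightarrow> ('c \<Rightarrow> 'd) \<Rightarrow> bool" where
  "graded_short_exact R Rg M Mg N Ng C Cg g h \<longleftrightarrow>
     graded_module R Rg M Mg \<and> graded_module R Rg N Ng \<and> graded_module R Rg C Cg \<and>
     graded_hom R M Mg N Ng g \<and> graded_hom R N Ng C Cg h \<and>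
     inj_on g (carrier M) \<and>
     g ` carrier M = {y \<in> carrier N. h y = \<zero>\<^bsub>C\<^esub>} \<and>
     h ` carrier N = carrier C"

section \<open>Almost Gorenstein graded rings\<close>

definition ring_as_module :: "nat \<Rightarrow> (nat \<Rightarrow> nat) \<Rightarrow> (('k::field) poly, 'k poly) module" where
  "ring_as_module n a = \<lparr>carrier = carrier (semigroup_ring n a),
     mult = (*), one = 1, zero = 0, add = (+), smult = (*)\<rparr>"

text \<open>Laurent polynomials are viewed inside the field of formal Laurent series.\<close>

abbreviation poly_to_fls :: "('k::field) poly \<Rightarrow> 'k fls" where
  "poly_to_fls p \<equiv> fps_to_fls (fps_of_poly p)"

text \<open>The module \<open>\<Sum>\<^bsub>\<alpha> \<in> PF(H)\<^esub> R t\<^sup>-\<^sup>\<alpha>\<close>; recall that \<open>PF(H)\<close> is finite.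
  The fields \<open>mult\<close> and \<open>one\<close> of the record play no role for modules.\<close>

definition canonical_module :: "nat \<Rightarrow> (nat \<Rightarrow> nat) \<Rightarrow> (('k::field) poly, 'k fls) module" where
  "canonical_module n a =
     \<lparr>carrier = {\<Sum>\<alpha>\<in>PF n a. poly_to_fls (r \<alpha>) * fls_X_intpow (- \<alpha>) | r.
                   \<forall>\<alpha>\<in>PF n a. r \<alpha> \<in> carrier (semigroup_ring n a)},
      mult = (*), one = 1, zero = 0, add = (+), smult = (\<lambda>p x. poly_to_fls p * x)\<rparr>"

definition canonical_grading :: "nat \<Rightarrow> (nat \<Rightarrow> nat) \<Rightarrow> int \<Rightarrow> ('k::field) fls set" where
  "canonical_grading n a d =
     {x \<in> carrier (canonical_module n a). \<forall>i. fls_nth x i \<noteq> 0 \<longrightarrow> i = d}"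

definition a_invariant :: "nat \<Rightarrow> (nat \<Rightarrow> nat) \<Rightarrow> int" where
  "a_invariant n a = frobenius (sgrp {1..n} a)"

text \<open>The third module of the exact sequence is determined up to isomorphism as a quotient
  of the canonical module. Letting its elements be sets of Laurent series (cosets)
  therefore loses no generality. The \<open>itself\<close> argument fixes the coefficient field.\<close>

definition almost_Gorenstein_graded :: "('k::field) itself \<Rightarrow> nat \<Rightarrow> (nat \<Rightarrow> nat) \<Rightarrow> bool" where
  "almost_Gorenstein_graded _ n a \<longleftrightarrow>
     (\<exists>(C :: ('k poly, 'k fls set) module) Cg g h.
        graded_short_exact (semigroup_ring n a) (semigroup_ring_grading n a)
          (ring_as_module n a) (semigroup_ring_grading n a)
          (canonical_module n a) (\<lambda>m. canonical_grading n a (m - a_invariant n a))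
          C Cg g h \<and>
        (\<forall>r\<in>max_ideal n a. \<forall>c\<in>carrier C. r \<odot>\<^bsub>C\<^esub> c = \<zero>\<^bsub>C\<^esub>))"

section \<open>Determinantal presentations\<close>

definition generic_presentation ::
  "nat \<Rightarrow> (nat \<Rightarrow> nat) \<Rightarrow> ('k::field) mpoly set \<Rightarrow> (nat \<Rightarrow> 'k mpoly) \<Rightarrow> bool" where
  "generic_presentation n a I f \<longleftrightarrow>
     (\<forall>i\<in>{1..n}. homogeneous a (f i) \<and> f i \<in> irrelevant_ideal n) \<and> I = I2 n f Var"

definition cyclic_next :: "nat \<Rightarrow> nat \<Rightarrow> nat" where
  "cyclic_next n j = (if j < n then j + 1 else 1)"

text \<open>After the permutation \<open>\<sigma>\<close> the \<open>j\<close>-th generator is \<open>a (\<sigma> j)\<close> and the \<open>j\<close>-th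
  variable is \<open>Var (\<sigma> j)\<close>; the exponent \<open>l j\<close> belongs to this renumbered variable.\<close>

definition cyclic_presentation ::
  "nat \<Rightarrow> ('k::field) mpoly set \<Rightarrow> (nat \<Rightarrow> nat) \<Rightarrow> (nat \<Rightarrow> nat) \<Rightarrow> bool" where
  "cyclic_presentation n I \<sigma> l \<longleftrightarrow>
     \<sigma> permutes {1..n} \<and> (\<forall>i\<in>{1..n}. 0 < l i) \<and>
     I = I2 n (\<lambda>j. Var (\<sigma> (cyclic_next n j)) ^ l (cyclic_next n j)) (\<lambda>j. Var (\<sigma> j))"

end

theory Submission
  imports Defs
begin

text \<open>
  Everything is read off from exponent vectors. The defining ideal \<open>I\<close> is spanned by the binomials
  whose two monomials have the same degree. Hence, if the first row of the matrix consists of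
  monomials \<open>m\<^sub>1, \<dots>, m\<^sub>n\<close> with \<open>deg m\<^sub>i = \<delta> + a\<^sub>i\<close>, then the minors generate \<open>I\<close> exactly if any two
  monomials of the same degree are connected by exchange steps, which replace a factor \<open>m\<^sub>i x\<^sub>j\<close> by
  \<open>m\<^sub>j x\<^sub>i\<close>.

  From a pseudo-Frobenius number \<open>\<alpha>\<close> with \<open>(n - 1) \<alpha> \<notin> H\<close> to cyclic minors: draw an arrow from \<open>i\<close>
  to \<open>q\<close> if \<open>\<alpha> + a\<^sub>i - a\<^sub>q \<in> H\<close>. A closed walk of length \<open>k\<close> gives \<open>k \<alpha> \<in> H\<close>, so there are none of
  length less than \<open>n\<close>, and the arrows form one cycle \<open>\<tau>\<close> through all indices
  (\<open>one_cycle_exists\<close>, \<open>arrow_unique\<close>). Therefore \<open>\<alpha> + a\<^sub>i = L\<^bsub>\<tau> i\<^esub> a\<^bsub>\<tau> i\<^esub>\<close>, and summation over \<open>i\<close> gives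
  \<open>n \<alpha> = \<Sum> (L\<^sub>i - 1) a\<^sub>i\<close>. This forces a monomial all of whose exponents are smaller than the \<open>L\<^sub>i\<close> to be
  the only one of its degree (\<open>small_unique\<close>). Any other monomial has the factor \<open>x\<^bsub>\<tau> i\<^esub>\<close> to the power
  \<open>L\<^bsub>\<tau> i\<^esub>\<close> for some \<open>i\<close>, and replacing this factor by \<open>x\<^sub>i\<close> lowers the degree by \<open>\<alpha>\<close>; by induction on
  the degree, monomials of the same degree are connected (\<open>same_degree_exchange\<close>).

  From an arbitrary determinantal presentation to \<open>\<alpha>\<close>: the entries of the first row are mapped to
  \<open>\<epsilon> t\<^bsup>\<delta> + a\<^sub>i\<^esup>\<close> with common \<open>\<epsilon> \<noteq> 0\<close> and \<open>\<delta>\<close>. By a graded Nakayama argument they may be changed modulo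
  \<open>I\<close> (\<open>replace_first_row\<close>). It follows that \<open>\<delta>\<close> is a pseudo-Frobenius number, and that the
  entries may be taken to be monomials. After that, every property of monomials that is invariant
  under exchange steps depends on the degree only (\<open>exchange_invariant\<close>). Three suitable properties
  show, one after the other, that each \<open>m\<^sub>i\<close> is a power of a variable \<open>x\<^bsub>\<tau> i\<^esub>\<close> (\<open>pure_power_exists\<close>),
  that \<open>\<tau>\<close> is a single cycle (\<open>permutation_is_one_cycle\<close>), and that \<open>(n - 1) \<delta> \<notin> H\<close>
  (\<open>top_multiple_notin\<close>).

  Finally every integer has the form \<open>k \<alpha> + s\<close>, where \<open>s\<close> is the degree of a monomial with exponents
  smaller than the \<open>L\<^sub>i\<close>. This determines \<open>H\<close> so explicitly that \<open>(n - 1) \<alpha>\<close> is seen to be the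
  Frobenius number and the pseudo-Frobenius numbers to be the multiples \<open>\<alpha>, \<dots>, (n - 1) \<alpha>\<close>
  (\<open>gap_dichotomy\<close>, \<open>PF_eq_multiples\<close>); almost symmetry is then immediate, and the cokernel of
  \<open>R \<rightarrow> K\<^sub>R(-a)\<close> is spanned by the classes of \<open>t\<^bsup>-j \<alpha>\<^esup>\<close> with \<open>1 \<le> j \<le> n - 2\<close>, which the maximal ideal
  annihilates.
\<close>

section \<open>Exponent vectors and monomials\<close>

abbreviation "lookup \<equiv> Poly_Mapping.lookup"
abbreviation "single \<equiv> Poly_Mapping.single"
abbreviation "keys \<equiv> Poly_Mapping.keys"

definition expo :: "nat \<Rightarrow> (nat \<Rightarrow>\<^sub>0 nat) set" where
  "expo n = {m. keys m \<subseteq> {1..n}}"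

abbreviation unit_exp :: "nat \<Rightarrow> (nat \<Rightarrow>\<^sub>0 nat)" where
  "unit_exp i \<equiv> single i 1"

lemma expo_zero [simp]: "0 \<in> expo n"
  by (simp add: expo_def)

lemma expo_add: "u + v \<in> expo n \<longleftrightarrow> u \<in> expo n \<and> v \<in> expo n"
  by (auto simp: expo_def subset_iff in_keys_iff Poly_Mapping.lookup_add)

lemma expo_single: "i \<in> {1..n} \<Longrightarrow> single i c \<in> expo n"
  by (auto simp: expo_def)

lemma expo_lookup_outside: "u \<in> expo n \<Longrightarrow> i \<notin> {1..n} \<Longrightarrow> lookup u i = 0"
  unfolding expo_def by (metis (lifting) in_keys_iff mem_Collect_eq subsetD)

lemma expo_eqI:
  assumes "u \<in> expo n" "v \<in> expo n"
    and "\<And>i. i \<in> {1..n} \<Longrightarrow> lookup u i = lookup v i"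
  shows "u = v"
  by (rule poly_mapping_eqI) (metis assms expo_lookup_outside)

lemma exponent_vector_exists:
  obtains u where "u \<in> expo n" "\<And>i. i \<in> {1..n} \<Longrightarrow> lookup u i = c i"
proof
  have fin: "finite {i. (if i \<in> {1..n} then c i else 0) \<noteq> 0}"
    by (rule finite_subset[of _ "{1..n}"]) (auto split: if_splits)
  let ?u = "Poly_Mapping.Abs_poly_mapping (\<lambda>i. if i \<in> {1..n} then c i else 0)"
  have l: "lookup ?u = (\<lambda>i. if i \<in> {1..n} then c i else 0)"
    using fin by simp
  show "?u \<in> expo n"
    unfolding expo_def by (auto simp only: in_keys_iff l mem_Collect_eq split: if_splits)
  show "lookup ?u i = c i" if "i \<in> {1..n}" for i
    using that by (simp only: l if_True)
qed

lemma split_off_single: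
  assumes "u \<in> expo n" "c \<le> lookup u i"
  obtains w where "u = w + single i c" "w \<in> expo n"
proof
  let ?w = "u - single i c"
  show eq: "u = ?w + single i c"
    using assms by (intro poly_mapping_eqI)
      (auto simp: Poly_Mapping.lookup_add Poly_Mapping.lookup_minus lookup_single when_def)
  show "?w \<in> expo n"
    using assms(1) eq expo_add by metis
qed

lemma wdeg_mon_superset:
  assumes "finite A" "keys m \<subseteq> A"
  shows "wdeg_mon a m = (\<Sum>i\<in>A. lookup m i * a i)"
  unfolding wdeg_mon_def using assms
  by (intro sum.mono_neutral_left) (auto simp: in_keys_iff)

lemma wdeg_mon_expo:
  "u \<in> expo n \<Longrightarrow> wdeg_mon a u = (\<Sum>i\<in>{1..n}. lookup u i * a i)"
  by (rule wdeg_mon_superset) (auto simp: expo_def)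

lemma wdeg_mon_zero [simp]: "wdeg_mon a 0 = 0"
  by (simp add: wdeg_mon_def)

lemma wdeg_mon_single [simp]: "wdeg_mon a (single i c) = c * a i"
  by (simp add: wdeg_mon_def)

lemma wdeg_mon_add [simp]: "wdeg_mon a (u + v) = wdeg_mon a u + wdeg_mon a v"
proof -
  let ?A = "keys u \<union> keys v"
  have "keys (u + v) \<subseteq> ?A" by (rule Poly_Mapping.keys_add)
  then show ?thesis
    by (simp add: wdeg_mon_superset[of ?A] Poly_Mapping.lookup_add sum.distrib distrib_right)
qed

lemma sgrp_eq_degrees: "sgrp {1..n} a = (\<lambda>u. int (wdeg_mon a u)) ` expo n"
proof (intro subset_antisym subsetI)
  fix z assume "z \<in> sgrp {1..n} a"
  then obtain c where z: "z = int (\<Sum>i\<in>{1..n}. c i * a i)" by (auto simp: sgrp_def)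
  obtain u where "u \<in> expo n" "\<And>i. i \<in> {1..n} \<Longrightarrow> lookup u i = c i"
    using exponent_vector_exists by blast
  then show "z \<in> (\<lambda>u. int (wdeg_mon a u)) ` expo n"
    using z by (auto simp: wdeg_mon_expo intro!: image_eqI[of _ _ u])
next
  fix z assume "z \<in> (\<lambda>u. int (wdeg_mon a u)) ` expo n"
  then show "z \<in> sgrp {1..n} a"
    by (auto simp: sgrp_def wdeg_mon_expo)
qed

lemma sgrp_reindex:
  assumes "bij_betw \<sigma> A B"
  shows "sgrp A (a \<circ> \<sigma>) = sgrp B a"
proof (intro subset_antisym subsetI)
  fix z assume "z \<in> sgrp A (a \<circ> \<sigma>)"
  then obtain c where z: "z = int (\<Sum>i\<in>A. c i * a (\<sigma> i))" by (auto simp: sgrp_def)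
  have "(\<Sum>i\<in>A. c i * a (\<sigma> i)) = (\<Sum>i\<in>A. c (inv_into A \<sigma> (\<sigma> i)) * a (\<sigma> i))"
    using assms by (intro sum.cong refl) (simp add: bij_betw_def)
  also have "\<dots> = (\<Sum>j\<in>B. c (inv_into A \<sigma> j) * a j)"
    by (rule sum.reindex_bij_betw[OF assms])
  finally show "z \<in> sgrp B a"
    unfolding sgrp_def z by (intro CollectI exI conjI TrueI) (simp only: of_nat_eq_iff)
next
  fix z assume "z \<in> sgrp B a"
  then obtain c where z: "z = int (\<Sum>j\<in>B. c j * a j)" by (auto simp: sgrp_def)
  have "(\<Sum>j\<in>B. c j * a j) = (\<Sum>i\<in>A. c (\<sigma> i) * (a \<circ> \<sigma>) i)"
    by (simp add: sum.reindex_bij_betw[OF assms, symmetric])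
  then show "z \<in> sgrp A (a \<circ> \<sigma>)"
    unfolding sgrp_def z by (intro CollectI exI conjI TrueI) (simp only: of_nat_eq_iff)
qed

section \<open>The ideal of relations and ideals of minors\<close>

lemma prod_monom_exponents:
  "(\<Prod>i\<in>keys u. (monom 1 (a i) :: ('k::field) poly) ^ lookup u i) =
     monom 1 (wdeg_mon a u)"
proof -
  have "(\<Prod>i\<in>A. monom 1 (a i) ^ lookup u i :: 'k poly)
      = monom 1 (\<Sum>i\<in>A. lookup u i * a i)" if "finite A" for A
    using that by (induction A rule: finite_induct) (auto simp: monom_power mult_monom mult.commute)
  then show ?thesis
    by (simp add: wdeg_mon_def)
qed

lemma phi_monomial: "phi a (single u c :: ('k::field) mpoly) = monom c (wdeg_mon a u)"
  by (simp add: phi_single prod_monom_exponents smult_monom)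

lemma phi_eq_sum_monom:
  "phi a (p :: ('k::field) mpoly) =
     (\<Sum>u\<in>keys p. monom (lookup p u) (wdeg_mon a u))"
  by (simp add: phi_def prod_monom_exponents smult_monom)

lemma coeff_phi:
  "coeff (phi a (p :: ('k::field) mpoly)) h =
     (\<Sum>u\<in>keys p. if wdeg_mon a u = h then lookup p u else 0)"
  by (simp add: phi_eq_sum_monom coeff_sum coeff_monom)

lemma phi_uminus: "phi a (- p :: ('k::field) mpoly) = - phi a p"
  using phi_add[of a p "- p"] by (simp add: phi_zero eq_neg_iff_add_eq_0 add.commute)

lemma phi_minus: "phi a (p - q :: ('k::field) mpoly) = phi a p - phi a q"
  using phi_add[of a p "- q"] by (simp add: phi_uminus)

lemma poly_ring_simps:
  "p \<oplus>\<^bsub>poly_ring n\<^esub> q = p + q" "p \<otimes>\<^bsub>poly_ring n\<^esub> q = p * q"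
  "\<zero>\<^bsub>poly_ring n\<^esub> = 0" "\<one>\<^bsub>poly_ring n\<^esub> = 1"
  by (simp_all add: poly_ring_def)

lemma poly_ring_carrier: "p \<in> carrier (poly_ring n) \<longleftrightarrow> keys p \<subseteq> expo n"
  by (auto simp: poly_ring_def expo_def)

lemma single_in_poly_ring: "u \<in> expo n \<Longrightarrow> single u c \<in> carrier (poly_ring n)"
  by (auto simp: poly_ring_carrier)

lemma Var_in_poly_ring: "i \<in> {1..n} \<Longrightarrow> Var i \<in> carrier (poly_ring n)"
  unfolding Var_def by (rule single_in_poly_ring) (rule expo_single)

lemma poly_ring_closed:
  assumes "p \<in> carrier (poly_ring n)" "q \<in> carrier (poly_ring n)"
  shows "p + q \<in> carrier (poly_ring n)" "p * q \<in> carrier (poly_ring n)"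
    "- p \<in> carrier (poly_ring n)" "p - q \<in> carrier (poly_ring n)"
proof -
  interpret R: cring "poly_ring n" by (rule cring_poly_ring)
  show sum: "p + q \<in> carrier (poly_ring n)" using R.add.m_closed[OF assms] by (simp add: poly_ring_simps)
  show "p * q \<in> carrier (poly_ring n)" using R.m_closed[OF assms] by (simp add: poly_ring_simps)
  show neg: "- p \<in> carrier (poly_ring n)" using assms by (simp add: poly_ring_carrier)
  have "- q \<in> carrier (poly_ring n)" using assms by (simp add: poly_ring_carrier)
  then show "p - q \<in> carrier (poly_ring n)"
    using R.add.m_closed[OF assms(1), of "- q"] by (simp only: poly_ring_simps) simp
qed

lemma Var_power: "Var i ^ l = (single (single i l) 1 :: ('k::field) mpoly)"
  by (induction l)
    (simp_all add: Var_def Poly_Mapping.mult_single Poly_Mapping.single_add[symmetric] add.commute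
      flip: Poly_Mapping.single_one)

text \<open>Every element of a generated ideal is a sum of monomial multiples of generators. Instead of
  writing down such sums, the elements \<open>p\<close> all of whose multiples preserve \<open>P\<close> under addition are
  seen to form an ideal.\<close>

lemma genideal_induct [consumes 2, case_names zero add]:
  fixes G :: "('k::field) mpoly set"
  assumes p: "p \<in> Idl\<^bsub>poly_ring n\<^esub> G" and G: "G \<subseteq> carrier (poly_ring n)"
    and P: "P 0"
      "\<And>d c g q. d \<in> expo n \<Longrightarrow> g \<in> G \<Longrightarrow> P q \<Longrightarrow> P (single d c * g + q)"
  shows "P p"
proof -
  interpret R: cring "poly_ring n :: 'k mpoly ring" by (rule cring_poly_ring)
  define X where "X = {p \<in> carrier (poly_ring n). \<forall>q. P q \<longrightarrow> (\<forall>r\<in>carrier (poly_ring n). P (r * p + q))}"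
  have X_add: "p + q \<in> X" if "p \<in> X" "q \<in> X" for p q
  proof -
    have "P (r * (p + q) + s)" if "P s" "r \<in> carrier (poly_ring n)" for r s
    proof -
      have "P (r * p + (r * q + s))" using that \<open>p \<in> X\<close> \<open>q \<in> X\<close> by (auto simp: X_def)
      then show ?thesis by (simp add: algebra_simps)
    qed
    then show ?thesis using that by (auto simp: X_def poly_ring_closed)
  qed
  have X_mult: "r * p \<in> X" if "p \<in> X" "r \<in> carrier (poly_ring n)" for p r
  proof -
    have "P (s * (r * p) + q)" if "P q" "s \<in> carrier (poly_ring n)" for s q
      using that \<open>p \<in> X\<close> poly_ring_closed(2)[OF \<open>s \<in> _\<close> \<open>r \<in> _\<close>]
      by (auto simp: X_def mult.assoc[symmetric])
    then show ?thesis using that by (auto simp: X_def poly_ring_closed)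
  qed
  have X_zero: "0 \<in> X" using R.zero_closed by (auto simp: X_def poly_ring_simps)
  have X_neg: "- p \<in> X" if "p \<in> X" for p
    using X_mult[OF that, of "-1"] R.one_closed poly_ring_closed(3)[of "1 :: 'k mpoly" n 1]
    by (simp add: poly_ring_simps)
  have "ideal X (poly_ring n)"
  proof (rule idealI)
    show "ring (poly_ring n :: 'k mpoly ring)" by (rule R.ring_axioms)
    show "subgroup X (add_monoid (poly_ring n))"
    proof (rule R.add.subgroupI)
      show "X \<subseteq> carrier (poly_ring n)" by (auto simp: X_def)
      show "X \<noteq> {}" using X_zero by auto
      fix x assume x: "x \<in> X"
      then have "x \<in> carrier (poly_ring n)" by (simp add: X_def)
      then have "\<ominus>\<^bsub>poly_ring n\<^esub> x = - x"
        using poly_ring_closed(3)[of x n x]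
        by (intro R.minus_equality) (auto simp: poly_ring_simps)
      then show "\<ominus>\<^bsub>poly_ring n\<^esub> x \<in> X" using X_neg[OF x] by simp
    next
      fix x y assume "x \<in> X" "y \<in> X"
      then show "x \<oplus>\<^bsub>poly_ring n\<^esub> y \<in> X" using X_add by (simp add: poly_ring_simps)
    qed
  next
    fix x r :: "'k mpoly" assume "x \<in> X" "r \<in> carrier (poly_ring n)"
    then show "r \<otimes>\<^bsub>poly_ring n\<^esub> x \<in> X" "x \<otimes>\<^bsub>poly_ring n\<^esub> r \<in> X"
      using X_mult[of x r] by (simp_all add: poly_ring_simps mult.commute[of x r])
  qed
  moreover have "G \<subseteq> X"
  proof
    fix g assume g: "g \<in> G"
    have "P (r * g + q)" if "P q" "r \<in> carrier (poly_ring n)" for q r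
    proof -
      have "P ((\<Sum>m\<in>A. single m (lookup r m)) * g + q)"
        if "finite A" "A \<subseteq> expo n" for A
        using that
      proof (induction A rule: finite_induct)
        case empty
        then show ?case using \<open>P q\<close> by simp
      next
        case (insert m A)
        then have "P (single m (lookup r m) * g +
           ((\<Sum>m\<in>A. single m (lookup r m)) * g + q))"
          by (intro P(2) g) auto
        then show ?case using insert by (simp add: distrib_right add.assoc)
      qed
      moreover have "(\<Sum>m\<in>keys r. single m (lookup r m)) = r"
        by (rule poly_mapping_eqI)
          (simp add: lookup_sum lookup_single when_def in_keys_iff sum.delta if_distrib cong: if_cong)
      ultimately show ?thesis
        using that(2) by (metis finite_keys poly_ring_carrier)
    qed
    then show "g \<in> X" using g G by (auto simp: X_def)
  qed
  ultimately have "Idl\<^bsub>poly_ring n\<^esub> G \<subseteq> X" by (rule R.genideal_minimal)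
  then have "p \<in> X" using p by blast
  moreover have "1 \<in> carrier (poly_ring n :: 'k mpoly ring)"
    using R.one_closed by (simp add: poly_ring_simps)
  ultimately have "P (1 * p + 0)" using P(1) unfolding X_def by blast
  then show ?thesis by simp
qed

lemma minors_in_poly_ring:
  fixes u v :: "nat \<Rightarrow> ('k::field) mpoly"
  assumes "\<And>i. i \<in> {1..n} \<Longrightarrow> u i \<in> carrier (poly_ring n)"
    "\<And>i. i \<in> {1..n} \<Longrightarrow> v i \<in> carrier (poly_ring n)"
  shows "{u i * v j - u j * v i | i j. 1 \<le> i \<and> i < j \<and> j \<le> n} \<subseteq> carrier (poly_ring n)"
  using assms by (auto intro!: poly_ring_closed)

text \<open>Antisymmetry supplies the minors with \<open>i \<ge> j\<close>, which are not among the generators.\<close>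

lemma I2_ideal:
  fixes u v :: "nat \<Rightarrow> ('k::field) mpoly"
  assumes uv: "\<And>i. i \<in> {1..n} \<Longrightarrow> u i \<in> carrier (poly_ring n)"
    "\<And>i. i \<in> {1..n} \<Longrightarrow> v i \<in> carrier (poly_ring n)"
  shows I2_zero: "0 \<in> I2 n u v"
    and I2_add: "p \<in> I2 n u v \<Longrightarrow> q \<in> I2 n u v \<Longrightarrow> p + q \<in> I2 n u v"
    and I2_mult: "r \<in> carrier (poly_ring n) \<Longrightarrow> p \<in> I2 n u v \<Longrightarrow> r * p \<in> I2 n u v"
    and I2_uminus: "p \<in> I2 n u v \<Longrightarrow> - p \<in> I2 n u v"
    and I2_minor: "i \<in> {1..n} \<Longrightarrow> j \<in> {1..n} \<Longrightarrow> u i * v j - u j * v i \<in> I2 n u v"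
proof -
  interpret R: cring "poly_ring n :: 'k mpoly ring" by (rule cring_poly_ring)
  let ?G = "{u i * v j - u j * v i | i j. 1 \<le> i \<and> i < j \<and> j \<le> n}"
  have G: "?G \<subseteq> carrier (poly_ring n)" by (rule minors_in_poly_ring[OF uv])
  interpret J: ideal "I2 n u v" "poly_ring n :: 'k mpoly ring"
    unfolding I2_def by (rule R.genideal_ideal[OF G])
  show z: "0 \<in> I2 n u v" using J.zero_closed by (simp add: poly_ring_simps)
  show "p \<in> I2 n u v \<Longrightarrow> q \<in> I2 n u v \<Longrightarrow> p + q \<in> I2 n u v"
    using J.a_closed by (simp add: poly_ring_simps)
  show mult: "r \<in> carrier (poly_ring n) \<Longrightarrow> p \<in> I2 n u v \<Longrightarrow> r * p \<in> I2 n u v" for r p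
    using J.I_l_closed by (simp add: poly_ring_simps)
  have "-1 \<in> carrier (poly_ring n :: 'k mpoly ring)"
    using R.one_closed poly_ring_closed(3)[of 1 n 1] by (simp add: poly_ring_simps)
  then show neg: "p \<in> I2 n u v \<Longrightarrow> - p \<in> I2 n u v" for p
    using mult[of "-1" p] by simp
  have lt: "u i * v j - u j * v i \<in> I2 n u v" if "i \<in> {1..n}" "j \<in> {1..n}" "i < j" for i j
    unfolding I2_def by (rule subsetD[OF R.genideal_self[OF G]]) (use that in auto)
  show "u i * v j - u j * v i \<in> I2 n u v" if "i \<in> {1..n}" "j \<in> {1..n}"
    using lt[OF that] neg[OF lt[OF that(2,1)]] z by (cases i j rule: linorder_cases) auto
qed

lemma I2_induct [consumes 1, case_names zero add]:
  fixes u v :: "nat \<Rightarrow> ('k::field) mpoly"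
  assumes "p \<in> I2 n u v"
    and uv: "\<And>i. i \<in> {1..n} \<Longrightarrow> u i \<in> carrier (poly_ring n)"
    "\<And>i. i \<in> {1..n} \<Longrightarrow> v i \<in> carrier (poly_ring n)"
    and "P 0"
    and step: "\<And>d c i j q. d \<in> expo n \<Longrightarrow> i \<in> {1..n} \<Longrightarrow> j \<in> {1..n} \<Longrightarrow> P q \<Longrightarrow>
        P (single d c * (u i * v j - u j * v i) + q)"
  shows "P p"
  using assms(1)[unfolded I2_def]
proof (induction rule: genideal_induct[consumes 1, case_names carrier zero add])
  case carrier
  show ?case by (rule minors_in_poly_ring[OF uv])
next
  case (add d c g q)
  then obtain i j where "g = u i * v j - u j * v i" "1 \<le> i" "i < j" "j \<le> n" by auto
  then show ?case using step[of d i j q c] add by simp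
qed (fact \<open>P 0\<close>)

lemma I2_subset:
  fixes u v u' v' :: "nat \<Rightarrow> ('k::field) mpoly"
  assumes uv: "\<And>i. i \<in> {1..n} \<Longrightarrow> u i \<in> carrier (poly_ring n)"
    "\<And>i. i \<in> {1..n} \<Longrightarrow> v i \<in> carrier (poly_ring n)"
    and zero: "0 \<in> K"
    and add: "\<And>p q. p \<in> K \<Longrightarrow> q \<in> K \<Longrightarrow> p + q \<in> K"
    and mult: "\<And>r p. r \<in> carrier (poly_ring n) \<Longrightarrow> p \<in> K \<Longrightarrow> r * p \<in> K"
    and minors: "\<And>i j. i \<in> {1..n} \<Longrightarrow> j \<in> {1..n} \<Longrightarrow> u i * v j - u j * v i \<in> K"
  shows "I2 n u v \<subseteq> K"
proof
  fix p assume "p \<in> I2 n u v"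
  then show "p \<in> K"
  proof (rule I2_induct[OF _ uv])
    show "0 \<in> K" by (rule zero)
    show "single d c * (u i * v j - u j * v i) + q \<in> K"
      if "d \<in> expo n" "i \<in> {1..n}" "j \<in> {1..n}" "q \<in> K" for d c i j q
      using that by (intro add mult minors single_in_poly_ring)
  qed
qed

lemma I2_cong:
  assumes "\<And>i. i \<in> {1..n} \<Longrightarrow> u i = u' i" "\<And>i. i \<in> {1..n} \<Longrightarrow> v i = v' i"
  shows "I2 n u v = I2 n u' v'"
proof -
  have "(\<exists>i j. p = u i * v j - u j * v i \<and> 1 \<le> i \<and> i < j \<and> j \<le> n) \<longleftrightarrow>
      (\<exists>i j. p = u' i * v' j - u' j * v' i \<and> 1 \<le> i \<and> i < j \<and> j \<le> n)" for p
  proof (intro iff_exI)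
    fix i j
    show "(p = u i * v j - u j * v i \<and> 1 \<le> i \<and> i < j \<and> j \<le> n) \<longleftrightarrow>
      (p = u' i * v' j - u' j * v' i \<and> 1 \<le> i \<and> i < j \<and> j \<le> n)"
      using assms(1)[of i] assms(1)[of j] assms(2)[of i] assms(2)[of j] by auto
  qed
  then show ?thesis unfolding I2_def by simp
qed

lemma I2_permute:
  fixes u v :: "nat \<Rightarrow> ('k::field) mpoly"
  assumes \<sigma>: "\<sigma> permutes {1..n}"
    and u: "\<And>i. i \<in> {1..n} \<Longrightarrow> u i \<in> carrier (poly_ring n)"
    and v: "\<And>i. i \<in> {1..n} \<Longrightarrow> v i \<in> carrier (poly_ring n)"
  shows "I2 n (\<lambda>j. u (\<sigma> j)) (\<lambda>j. v (\<sigma> j)) = I2 n u v"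
proof -
  have im: "\<sigma> i \<in> {1..n}" if "i \<in> {1..n}" for i
    using permutes_in_image[OF \<sigma>] that by blast
  have u': "\<And>i. i \<in> {1..n} \<Longrightarrow> u (\<sigma> i) \<in> carrier (poly_ring n)"
    and v': "\<And>i. i \<in> {1..n} \<Longrightarrow> v (\<sigma> i) \<in> carrier (poly_ring n)"
    using u[OF im] v[OF im] by blast+
  show ?thesis
  proof
    show "I2 n (\<lambda>j. u (\<sigma> j)) (\<lambda>j. v (\<sigma> j)) \<subseteq> I2 n u v"
    proof (rule I2_subset)
      fix i j assume "i \<in> {1..n}" "j \<in> {1..n}"
      then show "u (\<sigma> i) * v (\<sigma> j) - u (\<sigma> j) * v (\<sigma> i) \<in> I2 n u v"
        using im by (intro I2_minor u v)
    qed (rule u' v' I2_zero[OF u v] I2_add[OF u v] I2_mult[OF u v]; assumption)+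
    show "I2 n u v \<subseteq> I2 n (\<lambda>j. u (\<sigma> j)) (\<lambda>j. v (\<sigma> j))"
    proof (rule I2_subset)
      fix i j assume "i \<in> {1..n}" "j \<in> {1..n}"
      then obtain p q where pq: "p \<in> {1..n}" "q \<in> {1..n}" "i = \<sigma> p" "j = \<sigma> q"
        using permutes_image[OF \<sigma>] by (metis imageE)
      show "u i * v j - u j * v i \<in> I2 n (\<lambda>j. u (\<sigma> j)) (\<lambda>j. v (\<sigma> j))"
        unfolding pq(3,4) by (rule I2_minor[OF u' v' pq(1,2)])
    qed (rule u v I2_zero[OF u' v'] I2_add[OF u' v'] I2_mult[OF u' v']; assumption)+
  qed
qed

lemma irrelevant_ideal_subset: "(irrelevant_ideal n :: ('k::field) mpoly set) \<subseteq> carrier (poly_ring n)"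
proof -
  interpret R: cring "poly_ring n :: 'k mpoly ring" by (rule cring_poly_ring)
  have "ideal (irrelevant_ideal n) (poly_ring n :: 'k mpoly ring)"
    unfolding irrelevant_ideal_def by (rule R.genideal_ideal) (auto intro: Var_in_poly_ring)
  then show ?thesis by (rule ideal.Icarr[THEN subsetI])
qed

lemma Var_power_irrelevant:
  assumes "i \<in> {1..n}" "0 < l"
  shows "(Var i ^ l :: ('k::field) mpoly) \<in> irrelevant_ideal n"
proof -
  interpret R: cring "poly_ring n :: 'k mpoly ring" by (rule cring_poly_ring)
  have sub: "(Var ` {1..n} :: 'k mpoly set) \<subseteq> carrier (poly_ring n)" by (auto intro: Var_in_poly_ring)
  interpret J: ideal "irrelevant_ideal n" "poly_ring n :: 'k mpoly ring"
    unfolding irrelevant_ideal_def by (rule R.genideal_ideal[OF sub])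
  have Vi: "(Var i :: 'k mpoly) \<in> irrelevant_ideal n"
    unfolding irrelevant_ideal_def using R.genideal_self[OF sub] assms(1) by blast
  obtain l' where l: "l = Suc l'" using assms(2) by (cases l) auto
  have "(Var i ^ l' :: 'k mpoly) \<in> carrier (poly_ring n)"
    unfolding Var_power by (intro single_in_poly_ring expo_single assms(1))
  from J.I_r_closed[OF Vi this] show ?thesis by (simp add: l poly_ring_simps)
qed

lemma defining_ideal_props:
  shows defining_ideal_zero: "0 \<in> defining_ideal n a"
    and defining_ideal_add:
      "p \<in> defining_ideal n a \<Longrightarrow> q \<in> defining_ideal n a \<Longrightarrow> p + q \<in> defining_ideal n a"
    and defining_ideal_mult:
      "r \<in> carrier (poly_ring n) \<Longrightarrow> p \<in> defining_ideal n a \<Longrightarrow> r * p \<in> defining_ideal n a"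
    and defining_ideal_uminus: "p \<in> defining_ideal n a \<Longrightarrow> - p \<in> defining_ideal n a"
  unfolding defining_ideal_def
  by (auto simp: phi_zero phi_add phi_mult phi_uminus poly_ring_closed poly_ring_carrier[of 0]
      intro: poly_ring_closed(3))

lemma binomial_in_defining_ideal:
  assumes "u \<in> expo n" "v \<in> expo n" "wdeg_mon a u = wdeg_mon a v"
  shows "single u c - single v c \<in> (defining_ideal n a :: ('k::field) mpoly set)"
  unfolding defining_ideal_def
  using assms by (auto simp: phi_minus phi_monomial intro!: poly_ring_closed single_in_poly_ring)

text \<open>The defining ideal is spanned by binomials: if a monomial occurs in a relation, then so does
  another monomial of the same degree, and subtracting a binomial removes the first one.\<close>

lemma defining_ideal_induct [consumes 1, case_names zero add]:
  fixes p :: "('k::field) mpoly"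
  assumes "p \<in> defining_ideal n a" and zero: "P 0"
    and add: "\<And>u v c q. u \<in> expo n \<Longrightarrow> v \<in> expo n \<Longrightarrow> wdeg_mon a u = wdeg_mon a v \<Longrightarrow> P q \<Longrightarrow>
        P ((single u c - single v c) + q)"
  shows "P p"
  using assms(1)
proof (induction "card (keys p)" arbitrary: p rule: less_induct)
  case less
  show ?case
  proof (cases "p = 0")
    case False
    then obtain u where u: "u \<in> keys p" by fastforce
    have "\<exists>v\<in>keys p. v \<noteq> u \<and> wdeg_mon a v = wdeg_mon a u"
    proof (rule ccontr)
      assume "\<not> ?thesis"
      then have "coeff (phi a p) (wdeg_mon a u) =
          (\<Sum>v\<in>keys p. if v = u then lookup p u else 0)"
        unfolding coeff_phi by (intro sum.cong) auto
      then have "coeff (phi a p) (wdeg_mon a u) = lookup p u"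
        using u by simp
      then show False using u less.prems by (simp add: defining_ideal_def in_keys_iff)
    qed
    then obtain v where v: "v \<in> keys p" "v \<noteq> u" "wdeg_mon a v = wdeg_mon a u" by blast
    have expo: "u \<in> expo n" "v \<in> expo n"
      using u v less.prems by (auto simp: defining_ideal_def poly_ring_carrier)
    let ?c = "lookup p u"
    let ?b = "single u ?c - single v ?c"
    have "p - ?b \<in> defining_ideal n a"
      using defining_ideal_add[OF less.prems
          defining_ideal_uminus[OF binomial_in_defining_ideal[OF expo v(3)[symmetric], of ?c]]]
      by (simp only: add_uminus_conv_diff)
    moreover have "keys (p - ?b) \<subset> keys p"
    proof
      show "keys (p - ?b) \<subseteq> keys p"
        using u v by (auto simp: in_keys_iff Poly_Mapping.lookup_minus lookup_single when_def split: if_splits)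
      have "u \<notin> keys (p - ?b)"
        using v by (simp add: in_keys_iff Poly_Mapping.lookup_minus lookup_single when_def)
      then show "keys (p - ?b) \<noteq> keys p" using u by blast
    qed
    then have "card (keys (p - ?b)) < card (keys p)"
      by (simp add: psubset_card_mono)
    ultimately have "P (p - ?b)" by (intro less.hyps) auto
    then have "P (?b + (p - ?b))" by (intro add expo) (use v in auto)
    then show ?thesis by simp
  qed (simp add: zero)
qed

text \<open>The index set \<open>{1..n}\<close> is kept in this form by the simplifier.\<close>

declare One_nat_def [simp del]

section \<open>Permutations consisting of a single cycle\<close>

definition one_cycle :: "nat \<Rightarrow> (nat \<Rightarrow> nat) \<Rightarrow> bool" where
  "one_cycle n \<tau> \<longleftrightarrow> bij_betw \<tau> {1..n} {1..n} \<and>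
     (\<forall>i\<in>{1..n}. \<forall>j\<in>{1..n}. \<exists>t<n. (\<tau> ^^ t) i = j)"

lemma funpow_in:
  assumes "bij_betw \<tau> A A" "i \<in> A"
  shows "(\<tau> ^^ t) i \<in> A"
  using assms by (induction t) (auto simp: bij_betw_def)

lemma one_cycle_in:
  assumes "one_cycle n \<tau>" "i \<in> {1..n}"
  shows "(\<tau> ^^ t) i \<in> {1..n}" "\<tau> i \<in> {1..n}"
  using assms funpow_in[of \<tau> "{1..n}" i t] funpow_in[of \<tau> "{1..n}" i "Suc 0"]
  by (simp_all add: one_cycle_def)

lemma one_cycle_reach:
  assumes "one_cycle n \<tau>" "i \<in> {1..n}" "j \<in> {1..n}"
  obtains t where "t < n" "(\<tau> ^^ t) i = j"
proof -
  have "\<exists>t<n. (\<tau> ^^ t) i = j"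
    using assms(1) unfolding one_cycle_def by (elim conjE) (drule bspec[OF _ assms(2)], drule bspec[OF _ assms(3)])
  then show thesis using that by blast
qed

lemma one_cycle_image:
  assumes "one_cycle n \<tau>" "i \<in> {1..n}"
  shows "(\<lambda>t. (\<tau> ^^ t) i) ` {..<n} = {1..n}"
proof
  show "(\<lambda>t. (\<tau> ^^ t) i) ` {..<n} \<subseteq> {1..n}" using one_cycle_in[OF assms] by blast
  show "{1..n} \<subseteq> (\<lambda>t. (\<tau> ^^ t) i) ` {..<n}"
  proof
    fix j assume "j \<in> {1..n}"
    then obtain t where "t < n" "(\<tau> ^^ t) i = j" using assms unfolding one_cycle_def by blast
    then show "j \<in> (\<lambda>t. (\<tau> ^^ t) i) ` {..<n}" by blast
  qed
qed

lemma one_cycle_inj: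
  assumes "one_cycle n \<tau>" "i \<in> {1..n}"
  shows "inj_on (\<lambda>t. (\<tau> ^^ t) i) {..<n}"
  by (rule eq_card_imp_inj_on) (simp_all add: one_cycle_image[OF assms])

lemma one_cycle_full:
  assumes "one_cycle n \<tau>" "i \<in> {1..n}"
  shows "(\<tau> ^^ n) i = i"
proof -
  have "(\<tau> ^^ n) i \<in> {1..n}" by (rule one_cycle_in[OF assms])
  then obtain t where t: "t < n" "(\<tau> ^^ t) i = (\<tau> ^^ n) i"
    using assms unfolding one_cycle_def by blast
  have inj: "inj_on \<tau> {1..n}" using assms by (simp add: one_cycle_def bij_betw_def)
  have cancel: "(\<tau> ^^ s) i = (\<tau> ^^ (s + d)) i \<Longrightarrow> i = (\<tau> ^^ d) i" for s d
  proof (induction s)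
    case (Suc s)
    have "(\<tau> ^^ s) i = (\<tau> ^^ (s + d)) i"
      by (rule inj_onD[OF inj]) (use Suc.prems one_cycle_in[OF assms] in auto)
    then show ?case by (rule Suc.IH)
  qed simp
  have ret: "(\<tau> ^^ (n - t)) i = i" using cancel[of t "n - t"] t by simp
  have "t = 0"
  proof (rule ccontr)
    assume "t \<noteq> 0"
    then have "n - t = 0"
      using inj_onD[OF one_cycle_inj[OF assms], of "n - t" 0] ret t by auto
    then show False using t by simp
  qed
  then show ?thesis using t by simp
qed

lemma one_cycle_pred:
  assumes "one_cycle n \<tau>" "i \<in> {1..n}"
  obtains j where "j \<in> {1..n}" "\<tau> j = i"
proof -
  have "i \<in> \<tau> ` {1..n}" using assms by (simp add: one_cycle_def bij_betw_def)
  then show thesis using that by blast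
qed

lemma one_cycle_no_fixed_point:
  assumes "one_cycle n \<tau>" "i \<in> {1..n}" "2 \<le> n"
  shows "\<tau> i \<noteq> i"
  using inj_onD[OF one_cycle_inj[OF assms(1,2)], of "Suc 0" 0] assms(3) by auto

lemma orbit_bound:
  assumes "bij_betw \<tau> {1..n} {1..n}" "i \<in> {1..n}" "(\<tau> ^^ s) i = j"
  shows "\<exists>t<n. (\<tau> ^^ t) i = j"
proof -
  define t where "t = (LEAST t. (\<tau> ^^ t) i = j)"
  have t: "(\<tau> ^^ t) i = j" and least: "\<And>t'. (\<tau> ^^ t') i = j \<Longrightarrow> t \<le> t'"
    using assms(3) unfolding t_def by (auto intro: LeastI Least_le)
  have "inj_on (\<lambda>s. (\<tau> ^^ s) i) {..t}"
  proof (rule linorder_inj_onI')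
    fix x y assume xy: "x \<in> {..t}" "y \<in> {..t}" "x < y"
    show "(\<tau> ^^ x) i \<noteq> (\<tau> ^^ y) i"
    proof
      assume "(\<tau> ^^ x) i = (\<tau> ^^ y) i"
      then have "(\<tau> ^^ (t - y + x)) i = (\<tau> ^^ (t - y + y)) i" by (simp only: funpow_add o_apply)
      then have "t \<le> t - y + x" using xy t by (intro least) simp
      then show False using xy by simp
    qed
  qed
  then have "card {..t} \<le> card {1..n}"
    by (rule card_inj_on_le) (use funpow_in[OF assms(1,2)] in auto)
  then show ?thesis using t by (intro exI[of _ t]) simp
qed

lemma one_cycle_enumeration:
  assumes "one_cycle n \<tau>" "1 \<le> n"
  obtains \<sigma> where "\<sigma> permutes {1..n}" "\<And>j. j \<in> {1..n} \<Longrightarrow> \<tau> (\<sigma> j) = \<sigma> (cyclic_next n j)"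
proof
  have 1: "1 \<in> {1..n}" using assms by simp
  define \<sigma> where "\<sigma> j = (if j \<in> {1..n} then (\<tau> ^^ (j - 1)) 1 else j)" for j
  have im: "\<sigma> ` {1..n} = {1..n}"
  proof -
    have "\<sigma> ` {1..n} = (\<lambda>t. (\<tau> ^^ t) 1) ` (\<lambda>j. j - 1) ` {1..n}"
      unfolding image_image by (intro image_cong) (auto simp: \<sigma>_def)
    also have "(\<lambda>j. j - 1) ` {1..n} = {..<n}"
    proof (intro subset_antisym subsetI)
      fix t assume "t \<in> {..<n}"
      then show "t \<in> (\<lambda>j. j - 1) ` {1..n}" by (intro image_eqI[of _ _ "Suc t"]) auto
    qed auto
    finally show ?thesis using one_cycle_image[OF assms(1) 1] by simp
  qed
  show "\<sigma> permutes {1..n}"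
  proof (rule bij_imp_permutes)
    show "bij_betw \<sigma> {1..n} {1..n}"
      unfolding bij_betw_def using im by (simp add: eq_card_imp_inj_on)
  qed (auto simp: \<sigma>_def)
  show "\<tau> (\<sigma> j) = \<sigma> (cyclic_next n j)" if "j \<in> {1..n}" for j
  proof (cases "j < n")
    case True
    then have "(\<tau> ^^ j) 1 = \<tau> ((\<tau> ^^ (j - 1)) 1)"
      using that by (cases j) auto
    then show ?thesis using True that by (auto simp: \<sigma>_def cyclic_next_def)
  next
    case False
    then have "j = n" using that by simp
    moreover have "(\<tau> ^^ n) 1 = \<tau> ((\<tau> ^^ (n - 1)) 1)" using assms(2) by (cases n) auto
    ultimately show ?thesis using one_cycle_full[OF assms(1) 1] assms(2)
      by (simp add: \<sigma>_def cyclic_next_def)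
  qed
qed

lemma cyclic_next_in: "j \<in> {1..n} \<Longrightarrow> cyclic_next n j \<in> {1..n}"
  by (auto simp: cyclic_next_def)

lemma one_cycle_conjugate:
  assumes "\<sigma> permutes {1..n}" "1 \<le> n"
  shows "one_cycle n (\<lambda>i. \<sigma> (cyclic_next n (inv_into UNIV \<sigma> i)))"
proof -
  let ?\<tau> = "\<lambda>i. \<sigma> (cyclic_next n (inv_into UNIV \<sigma> i))"
  have inv: "inv_into UNIV \<sigma> (\<sigma> i) = i" "\<sigma> (inv_into UNIV \<sigma> i) = i" for i
    using permutes_inverses[OF assms(1)] by auto
  have inn: "\<sigma> i \<in> {1..n} \<longleftrightarrow> i \<in> {1..n}" "inv_into UNIV \<sigma> i \<in> {1..n} \<longleftrightarrow> i \<in> {1..n}" for i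
    using permutes_in_image[OF assms(1)] permutes_in_image[OF permutes_inv[OF assms(1)]] by auto
  have pow: "(?\<tau> ^^ t) (\<sigma> j) = \<sigma> ((cyclic_next n ^^ t) j)" for t j
    by (induction t) (simp_all add: inv)
  have up: "(cyclic_next n ^^ t) j = j + t" if "j + t \<le> n" for t j
    using that by (induction t) (auto simp: cyclic_next_def)
  have wrap: "\<exists>t<n. (cyclic_next n ^^ t) j = k" if jk: "j \<in> {1..n}" "k \<in> {1..n}" for j k
  proof (cases "j \<le> k")
    case True
    then show ?thesis using up[of j "k - j"] jk by (intro exI[of _ "k - j"]) auto
  next
    case False
    have "(cyclic_next n ^^ ((k - 1) + Suc (n - j))) j = (cyclic_next n ^^ (k - 1)) (cyclic_next n ((cyclic_next n ^^ (n - j)) j))"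
      unfolding funpow_add by simp
    also have "\<dots> = (cyclic_next n ^^ (k - 1)) 1"
      using up[of j "n - j"] jk by (simp add: cyclic_next_def)
    also have "\<dots> = k" using up[of 1 "k - 1"] jk by simp
    finally show ?thesis using False jk by (intro exI[of _ "(k - 1) + Suc (n - j)"]) auto
  qed
  have trans: "\<exists>t<n. (?\<tau> ^^ t) i = j" if "i \<in> {1..n}" "j \<in> {1..n}" for i j
  proof -
    have "inv_into UNIV \<sigma> i \<in> {1..n}" "inv_into UNIV \<sigma> j \<in> {1..n}" using inn that by simp_all
    then obtain t where t: "t < n" "(cyclic_next n ^^ t) (inv_into UNIV \<sigma> i) = inv_into UNIV \<sigma> j"
      using wrap by blast
    have "(?\<tau> ^^ t) i = j" using pow[of t "inv_into UNIV \<sigma> i"] t(2) by (simp only: inv)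
    then show ?thesis using t(1) by blast
  qed
  have inj: "inj_on ?\<tau> {1..n}"
  proof (rule inj_onI)
    fix i j assume ij: "i \<in> {1..n}" "j \<in> {1..n}" "?\<tau> i = ?\<tau> j"
    then have "cyclic_next n (inv_into UNIV \<sigma> i) = cyclic_next n (inv_into UNIV \<sigma> j)" using inv by metis
    moreover have "inv_into UNIV \<sigma> i \<in> {1..n}" "inv_into UNIV \<sigma> j \<in> {1..n}" using ij inn by auto
    ultimately have "inv_into UNIV \<sigma> i = inv_into UNIV \<sigma> j" by (auto simp: cyclic_next_def split: if_splits)
    then show "i = j" using inv by metis
  qed
  moreover have "?\<tau> ` {1..n} \<subseteq> {1..n}"
    using inn cyclic_next_in by blast
  ultimately have "bij_betw ?\<tau> {1..n} {1..n}"
    unfolding bij_betw_def using endo_inj_surj[of "{1..n}" ?\<tau>] by auto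
  then show ?thesis unfolding one_cycle_def using trans by blast
qed

section \<open>Numerical semigroups and pseudo-Frobenius numbers\<close>

locale minimal_generators =
  fixes n :: nat and a :: "nat \<Rightarrow> nat"
  assumes n3: "3 \<le> n"
    and pos: "\<forall>i\<in>{1..n}. 0 < a i"
    and gcd1: "Gcd (a ` {1..n}) = 1"
    and min_gen: "minimally_generates n a"
begin

abbreviation H :: "int set" where "H \<equiv> sgrp {1..n} a"

lemma H_iff: "z \<in> H \<longleftrightarrow> (\<exists>u\<in>expo n. z = int (wdeg_mon a u))"
  by (auto simp: sgrp_eq_degrees)

lemma H_zero [simp]: "0 \<in> H"
  unfolding H_iff by (intro bexI[of _ 0]) auto

lemma H_nonneg: "z \<in> H \<Longrightarrow> 0 \<le> z"
  by (auto simp: H_iff)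

lemma H_add: "x \<in> H \<Longrightarrow> y \<in> H \<Longrightarrow> x + y \<in> H"
  unfolding H_iff by (metis expo_add of_nat_add wdeg_mon_add)

lemma H_gen: "i \<in> {1..n} \<Longrightarrow> int (a i) \<in> H"
  unfolding H_iff by (intro bexI[of _ "unit_exp i"]) (auto intro: expo_single)

lemma H_mult: "x \<in> H \<Longrightarrow> int k * x \<in> H"
  by (induction k) (auto simp: distrib_right intro: H_add)

lemma H_minus_gen:
  assumes "u \<in> expo n" "0 < lookup u i"
  shows "int (wdeg_mon a u) - int (a i) \<in> H"
proof -
  obtain w where "u = w + unit_exp i" "w \<in> expo n"
    using split_off_single[OF assms(1), of 1 i] assms(2) by auto
  then show ?thesis by (auto simp: H_iff)
qed

lemma H_nonzeroE:
  assumes "z \<in> H" "z \<noteq> 0"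
  obtains i where "i \<in> {1..n}" "z - int (a i) \<in> H"
proof -
  obtain u where u: "u \<in> expo n" "z = int (wdeg_mon a u)" using assms(1) H_iff by blast
  then have "u \<noteq> 0" using assms(2) by auto
  then obtain i where i: "i \<in> keys u" by fastforce
  then have "i \<in> {1..n}" using u by (auto simp: expo_def)
  with i u that show thesis using H_minus_gen[of u i] by (auto simp: in_keys_iff)
qed

lemma generator_not_redundant:
  assumes "i \<in> {1..n}"
  shows "int (a i) \<notin> sgrp ({1..n} - {i}) a"
proof
  assume "int (a i) \<in> sgrp ({1..n} - {i}) a"
  then obtain d where "int (a i) = int (\<Sum>j\<in>{1..n} - {i}. d j * a j)"
    unfolding sgrp_def by blast
  then have d: "a i = (\<Sum>j\<in>{1..n} - {i}. d j * a j)" by (simp only: of_nat_eq_iff)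
  have "sgrp ({1..n} - {i}) a = H"
  proof (intro subset_antisym subsetI)
    fix z assume "z \<in> H"
    then obtain c where z: "z = int (\<Sum>j\<in>{1..n}. c j * a j)" by (auto simp: sgrp_def)
    also have "(\<Sum>j\<in>{1..n}. c j * a j) = c i * a i + (\<Sum>j\<in>{1..n} - {i}. c j * a j)"
      using assms by (simp add: sum.remove)
    also have "\<dots> = c i * (\<Sum>j\<in>{1..n} - {i}. d j * a j) + (\<Sum>j\<in>{1..n} - {i}. c j * a j)"
      using d by simp
    also have "\<dots> = (\<Sum>j\<in>{1..n} - {i}. (c i * d j + c j) * a j)"
      by (simp add: sum_distrib_left sum.distrib distrib_right mult.assoc)
    finally show "z \<in> sgrp ({1..n} - {i}) a" unfolding sgrp_def by (intro CollectI exI conjI TrueI)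
  next
    fix z assume "z \<in> sgrp ({1..n} - {i}) a"
    then obtain c where z: "z = int (\<Sum>j\<in>{1..n} - {i}. c j * a j)" by (auto simp: sgrp_def)
    also have "(\<Sum>j\<in>{1..n} - {i}. c j * a j) = (\<Sum>j\<in>{1..n}. (if j = i then 0 else c j) * a j)"
      by (intro sum.mono_neutral_cong_left) auto
    finally show "z \<in> H" unfolding sgrp_def by (intro CollectI exI conjI TrueI)
  qed
  then show False using min_gen assms unfolding minimally_generates_def by blast
qed

lemma PF_iff: "\<alpha> \<in> PF n a \<longleftrightarrow> \<alpha> \<notin> H \<and> (\<forall>i\<in>{1..n}. \<alpha> + int (a i) \<in> H)"
  by (simp add: PF_def)

text \<open>A negative pseudo-Frobenius number could only be minus the smallest generator; then the
  difference of any other generator and the smallest one would lie in \<open>H\<close>, against minimality.\<close>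

lemma PF_pos:
  assumes "\<alpha> \<in> PF n a"
  shows "0 < \<alpha>"
proof (rule ccontr)
  assume "\<not> 0 < \<alpha>"
  then have neg: "\<alpha> < 0" using assms H_zero by (cases "\<alpha> = 0") (auto simp: PF_iff)
  have "finite (a ` {1..n})" "a ` {1..n} \<noteq> {}" using n3 by auto
  then obtain i0 where i0: "i0 \<in> {1..n}" "a i0 = Min (a ` {1..n})" by (metis Min_in imageE)
  then have le: "a i0 \<le> a j" if "j \<in> {1..n}" for j using that by simp
  have zero: "\<alpha> + int (a i0) = 0"
  proof (rule ccontr)
    assume "\<alpha> + int (a i0) \<noteq> 0"
    moreover have "\<alpha> + int (a i0) \<in> H" using assms i0(1) unfolding PF_iff by blast
    ultimately obtain j where "j \<in> {1..n}" "\<alpha> + int (a i0) - int (a j) \<in> H"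
      by (metis H_nonzeroE)
    then show False using H_nonneg le[of j] neg by force
  qed
  obtain i1 where i1: "i1 \<in> {1..n}" "i1 \<noteq> i0"
    using n3 that[of 1] that[of 2] by fastforce
  have "\<alpha> + int (a i1) \<in> H" using assms i1(1) unfolding PF_iff by blast
  moreover have "int (a i1) - int (a i0) = \<alpha> + int (a i1)"
    using zero by linarith
  ultimately have "int (a i1) - int (a i0) \<in> H" by (simp only:)
  then obtain u where u: "u \<in> expo n" "int (a i1) - int (a i0) = int (wdeg_mon a u)"
    by (auto simp: H_iff)
  have u0: "lookup u i1 = 0"
  proof (rule ccontr)
    assume "\<not> ?thesis"
    then have "0 \<le> int (wdeg_mon a u) - int (a i1)"
      using H_minus_gen[OF u(1), of i1] H_nonneg by blast
    then show False using u(2) pos i0(1) by force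
  qed
  have "a i1 = wdeg_mon a (u + unit_exp i0)" using u(2) by simp
  also have "\<dots> = (\<Sum>j\<in>{1..n}. lookup (u + unit_exp i0) j * a j)"
    using u i0 by (intro wdeg_mon_expo) (simp add: expo_add expo_single)
  also have "\<dots> = (\<Sum>j\<in>{1..n} - {i1}. lookup (u + unit_exp i0) j * a j)"
    using u0 i1 by (intro sum.mono_neutral_right) (auto simp: Poly_Mapping.lookup_add lookup_single)
  finally have "int (a i1) = int (\<Sum>j\<in>{1..n} - {i1}. lookup (u + unit_exp i0) j * a j)"
    by (simp only: of_nat_eq_iff)
  then have "int (a i1) \<in> sgrp ({1..n} - {i1}) a"
    unfolding sgrp_def by (intro CollectI exI conjI TrueI)
  then show False using generator_not_redundant i1 by blast
qed

lemma PF_shift: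
  assumes "\<alpha> \<in> PF n a" "h \<in> H" "h \<noteq> 0"
  shows "\<alpha> + h \<in> H"
proof -
  obtain i where i: "i \<in> {1..n}" "h - int (a i) \<in> H" using H_nonzeroE[OF assms(2,3)] .
  then have "(\<alpha> + int (a i)) + (h - int (a i)) \<in> H" using assms(1) unfolding PF_iff by (blast intro: H_add)
  then show ?thesis by simp
qed

lemma PF_shift_multiple:
  assumes "\<alpha> \<in> PF n a" "h \<in> H" "h \<noteq> 0"
  shows "int k * \<alpha> + h \<in> H"
proof (induction k)
  case (Suc k)
  have "int k * \<alpha> + h \<noteq> 0" using PF_pos[OF assms(1)] H_nonneg[OF assms(2)] assms(3)
    by (metis add.commute add_nonneg_eq_0_iff mult_nonneg_nonneg of_nat_0_le_iff order_less_imp_le)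
  then have "\<alpha> + (int k * \<alpha> + h) \<in> H" using PF_shift[OF assms(1) Suc] by simp
  then show ?case by (simp add: algebra_simps)
qed (use assms in simp)

lemma PF_multiple_notin:
  assumes "\<alpha> \<in> PF n a" "int (n - 1) * \<alpha> \<notin> H" "1 \<le> k" "k < n"
  shows "int k * \<alpha> \<notin> H"
proof
  assume k: "int k * \<alpha> \<in> H"
  have "int k * \<alpha> \<noteq> 0" using PF_pos[OF assms(1)] assms(3) by simp
  then have "int (n - 1 - k) * \<alpha> + int k * \<alpha> \<in> H" by (rule PF_shift_multiple[OF assms(1) k])
  moreover have "int (n - 1 - k) * \<alpha> + int k * \<alpha> = int (n - 1) * \<alpha>"
    using assms(4) by (simp add: of_nat_diff algebra_simps)
  ultimately show False using assms(2) by simp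
qed

lemma walk:
  assumes "\<And>t. int (a (x t)) + \<alpha> - int (a (x (Suc t))) \<in> H"
  shows "int (a (x s)) + int d * \<alpha> - int (a (x (s + d))) \<in> H"
proof (induction d)
  case (Suc d)
  then have "(int (a (x s)) + int d * \<alpha> - int (a (x (s + d)))) +
     (int (a (x (s + d))) + \<alpha> - int (a (x (Suc (s + d))))) \<in> H"
    by (intro H_add assms)
  then show ?case by (simp add: algebra_simps)
qed simp

text \<open>Draw an arrow from \<open>i\<close> to \<open>q\<close> if \<open>a q\<close> can be subtracted from \<open>\<alpha> + a i\<close> within the
  semigroup. Adding up along a closed walk of length \<open>k\<close> gives \<open>k \<alpha> \<in> H\<close>. Hence, if
  \<open>(n - 1) \<alpha> \<notin> H\<close>, closed walks have length at least \<open>n\<close>, and following arrows one runs through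
  all indices before the first repetition.\<close>

lemma one_cycle_exists:
  assumes \<alpha>: "\<alpha> \<in> PF n a" "int (n - 1) * \<alpha> \<notin> H"
  obtains \<tau> where "one_cycle n \<tau>" "\<And>i. i \<in> {1..n} \<Longrightarrow> int (a i) + \<alpha> - int (a (\<tau> i)) \<in> H"
proof -
  have "\<exists>q\<in>{1..n}. int (a i) + \<alpha> - int (a q) \<in> H" if "i \<in> {1..n}" for i
  proof -
    have "int (a i) + \<alpha> \<in> H" using \<alpha> that by (auto simp: PF_iff add.commute)
    moreover have "int (a i) + \<alpha> \<noteq> 0" using PF_pos[OF \<alpha>(1)] by simp
    ultimately show ?thesis by (metis H_nonzeroE)
  qed
  then obtain \<tau> where \<tau>: "\<And>i. i \<in> {1..n} \<Longrightarrow> \<tau> i \<in> {1..n} \<and> int (a i) + \<alpha> - int (a (\<tau> i)) \<in> H"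
    by metis
  have pow_in: "(\<tau> ^^ t) i \<in> {1..n}" if "i \<in> {1..n}" for t i
    using that \<tau> by (induction t) auto
  have no_return: "(\<tau> ^^ s) i \<noteq> (\<tau> ^^ (s + d)) i" if "i \<in> {1..n}" "1 \<le> d" "d < n" for i s d
  proof
    assume eq: "(\<tau> ^^ s) i = (\<tau> ^^ (s + d)) i"
    have "int (a ((\<tau> ^^ s) i)) + int d * \<alpha> - int (a ((\<tau> ^^ (s + d)) i)) \<in> H"
      by (rule walk[where x = "\<lambda>t. (\<tau> ^^ t) i"]) (use \<tau> pow_in[OF that(1)] in simp)
    then show False using eq PF_multiple_notin[OF \<alpha> that(2,3)] by simp
  qed
  have inj: "inj_on (\<lambda>t. (\<tau> ^^ (s + t)) i) {..<n}" if "i \<in> {1..n}" for i s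
  proof (rule linorder_inj_onI')
    fix t t' assume "t \<in> {..<n}" "t' \<in> {..<n}" "t < t'"
    then show "(\<tau> ^^ (s + t)) i \<noteq> (\<tau> ^^ (s + t')) i"
      using no_return[OF that, of "t' - t" "s + t"] by simp
  qed
  have image: "(\<lambda>t. (\<tau> ^^ (s + t)) i) ` {..<n} = {1..n}" if "i \<in> {1..n}" for i s
  proof (rule card_seteq)
    show "card {1..n} \<le> card ((\<lambda>t. (\<tau> ^^ (s + t)) i) ` {..<n})"
      by (simp add: card_image[OF inj[OF that]])
  qed (use pow_in[OF that] in auto)
  have trans: "\<exists>t<n. (\<tau> ^^ t) i = j" if "i \<in> {1..n}" "j \<in> {1..n}" for i j
  proof -
    have "j \<in> (\<lambda>t. (\<tau> ^^ (0 + t)) i) ` {..<n}" using image[OF that(1), of 0] that(2) by blast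
    then show ?thesis by auto
  qed
  have "{1..n} \<subseteq> \<tau> ` {1..n}"
  proof
    fix j assume "j \<in> {1..n}"
    moreover have "1 \<in> {1..n}" using n3 by simp
    ultimately obtain t where "j = (\<tau> ^^ (Suc 0 + t)) 1" using image[of 1 "Suc 0"] by blast
    then have "j = \<tau> ((\<tau> ^^ t) 1)" by simp
    then show "j \<in> \<tau> ` {1..n}" using pow_in[OF \<open>1 \<in> {1..n}\<close>] by blast
  qed
  then have "\<tau> ` {1..n} = {1..n}" using \<tau> by blast
  then have "bij_betw \<tau> {1..n} {1..n}"
    by (simp add: bij_betw_def eq_card_imp_inj_on)
  then have "one_cycle n \<tau>" unfolding one_cycle_def using trans by blast
  then show thesis using \<tau> that by blast
qed

text \<open>An arrow from \<open>p\<close> to \<open>q\<close>, followed by the part of the cycle that leads from \<open>q\<close> back to \<open>p\<close>, is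
  a closed walk. So this part has length \<open>n - 1\<close>, that is, \<open>q\<close> comes next after \<open>p\<close>.\<close>

lemma arrow_unique:
  assumes \<alpha>: "\<alpha> \<in> PF n a" "int (n - 1) * \<alpha> \<notin> H"
    and \<tau>: "one_cycle n \<tau>" "\<And>i. i \<in> {1..n} \<Longrightarrow> int (a i) + \<alpha> - int (a (\<tau> i)) \<in> H"
    and pq: "p \<in> {1..n}" "q \<in> {1..n}" "int (a p) + \<alpha> - int (a q) \<in> H"
  shows "q = \<tau> p"
proof -
  obtain k where k: "k < n" "(\<tau> ^^ k) q = p" using \<tau>(1) pq unfolding one_cycle_def by blast
  have "int (a ((\<tau> ^^ 0) q)) + int k * \<alpha> - int (a ((\<tau> ^^ (0 + k)) q)) \<in> H"
    by (rule walk[where x = "\<lambda>t. (\<tau> ^^ t) q"]) (use \<tau> one_cycle_in[OF \<tau>(1) pq(2)] in simp)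
  from H_add[OF this pq(3)] have "int (Suc k) * \<alpha> \<in> H" using k by (simp add: algebra_simps)
  then have "n = Suc k" using PF_multiple_notin[OF \<alpha>, of "Suc k"] k by linarith
  then show ?thesis using one_cycle_full[OF \<tau>(1) pq(2)] k by simp
qed

end

text \<open>The equations between degrees behind a cyclic presentation. Columns are indexed by the variable in
  the second row, so that \<open>\<tau> i\<close> is the variable above \<open>x i\<close>, and \<open>L (\<tau> i)\<close> is its exponent.\<close>

locale cyclic_relations = minimal_generators +
  fixes \<alpha> :: int and \<tau> :: "nat \<Rightarrow> nat" and L :: "nat \<Rightarrow> nat"
  assumes \<alpha>_PF: "\<alpha> \<in> PF n a"
    and \<alpha>_notin: "int (n - 1) * \<alpha> \<notin> H"
    and cycle: "one_cycle n \<tau>"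
    and L_pos: "\<And>i. i \<in> {1..n} \<Longrightarrow> 0 < L i"
    and relation: "\<And>i. i \<in> {1..n} \<Longrightarrow> \<alpha> + int (a i) = int (L (\<tau> i) * a (\<tau> i))"

context minimal_generators
begin

text \<open>Every generator that occurs in a factorization of \<open>\<alpha> + a i\<close> is the target of an arrow from \<open>i\<close>,
  so only \<open>a (\<tau> i)\<close> can occur.\<close>

lemma cyclic_relations_exist:
  assumes \<alpha>: "\<alpha> \<in> PF n a" "int (n - 1) * \<alpha> \<notin> H"
  obtains \<tau> L where "cyclic_relations n a \<alpha> \<tau> L"
proof -
  obtain \<tau> where \<tau>: "one_cycle n \<tau>" "\<And>i. i \<in> {1..n} \<Longrightarrow> int (a i) + \<alpha> - int (a (\<tau> i)) \<in> H"
    using one_cycle_exists[OF \<alpha>] by blast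
  have "\<exists>l>0. \<alpha> + int (a i) = int (l * a (\<tau> i))" if i: "i \<in> {1..n}" for i
  proof -
    obtain u where u: "u \<in> expo n" "\<alpha> + int (a i) = int (wdeg_mon a u)"
      using \<alpha>(1) i unfolding PF_iff by (metis H_iff)
    have "lookup u q = 0" if q: "q \<in> {1..n}" "q \<noteq> \<tau> i" for q
    proof (rule ccontr)
      assume "lookup u q \<noteq> 0"
      then have "int (a i) + \<alpha> - int (a q) \<in> H"
        using H_minus_gen[OF u(1), of q] u(2) by (simp add: add.commute)
      then show False using arrow_unique[OF \<alpha> \<tau> i q(1)] q(2) by blast
    qed
    then have "u = single (\<tau> i) (lookup u (\<tau> i))"
      using one_cycle_in[OF \<tau>(1) i]
      by (intro expo_eqI[OF u(1) expo_single]) (auto simp: lookup_single when_def)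
    then have "wdeg_mon a u = lookup u (\<tau> i) * a (\<tau> i)"
      by (metis wdeg_mon_single)
    moreover from this have "lookup u (\<tau> i) > 0"
      using u(2) PF_pos[OF \<alpha>(1)] by (cases "lookup u (\<tau> i) = 0") auto
    ultimately show ?thesis using u(2) by auto
  qed
  then obtain l where l: "\<And>i. i \<in> {1..n} \<Longrightarrow> 0 < l i \<and> \<alpha> + int (a i) = int (l i * a (\<tau> i))"
    by metis
  define L where "L = l \<circ> inv_into {1..n} \<tau>"
  have inj: "inj_on \<tau> {1..n}" and im: "\<tau> ` {1..n} = {1..n}"
    using \<tau>(1) by (auto simp: one_cycle_def bij_betw_def)
  have L: "L (\<tau> i) = l i" if "i \<in> {1..n}" for i using inj that by (simp add: L_def)
  have "cyclic_relations n a \<alpha> \<tau> L"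
  proof unfold_locales
    fix i assume i: "i \<in> {1..n}"
    show "0 < L i" using i l im inv_into_into[of i \<tau> "{1..n}"] by (simp add: L_def)
    show "\<alpha> + int (a i) = int (L (\<tau> i) * a (\<tau> i))" using i l L by simp
  qed (fact \<alpha> \<tau>)+
  then show thesis by (rule that)
qed

end

section \<open>Monomials modulo the cyclic minors\<close>

text \<open>The congruence of monomials modulo the minors, when the first row consists of the monomials
  \<open>m i\<close>. Symmetry is not built in, because interchanging \<open>i\<close> and \<open>j\<close> reverses a step.\<close>

inductive exchange :: "nat \<Rightarrow> (nat \<Rightarrow> nat \<Rightarrow>\<^sub>0 nat) \<Rightarrow> (nat \<Rightarrow>\<^sub>0 nat) \<Rightarrow> (nat \<Rightarrow>\<^sub>0 nat) \<Rightarrow> bool"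
  for n m where
  start: "exchange n m u u"
| swap: "exchange n m u (d + m i + unit_exp j) \<Longrightarrow> i \<in> {1..n} \<Longrightarrow> j \<in> {1..n} \<Longrightarrow>
    exchange n m u (d + m j + unit_exp i)"

lemma exchange_trans:
  assumes "exchange n m u v" "exchange n m v w"
  shows "exchange n m u w"
  using assms(2,1) by (induction rule: exchange.induct) (auto intro: exchange.swap)

lemma exchange_in_I2:
  fixes c :: "'k::field"
  assumes m: "\<And>i. i \<in> {1..n} \<Longrightarrow> m i \<in> expo n"
    and uv: "exchange n m u v" and u: "u \<in> expo n"
  shows "v \<in> expo n \<and>
    single u c - single v c \<in> I2 n (\<lambda>i. single (m i) 1) Var"
  using uv u
proof (induction rule: exchange.induct)
  let ?J = "I2 n (\<lambda>i. single (m i) (1 :: 'k)) Var"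
  have carr: "\<And>i. i \<in> {1..n} \<Longrightarrow> single (m i) (1 :: 'k) \<in> carrier (poly_ring n)"
    "\<And>i. i \<in> {1..n} \<Longrightarrow> (Var i :: 'k mpoly) \<in> carrier (poly_ring n)"
    by (rule single_in_poly_ring[OF m] Var_in_poly_ring; assumption)+
  {
    case (start u)
    then show ?case using I2_zero[OF carr] by simp
  next
    case (swap u d i j)
    let ?v = "d + m i + unit_exp j" and ?w = "d + m j + unit_exp i"
    have v: "?v \<in> expo n" and uv: "single u c - single ?v c \<in> ?J"
      using swap.IH swap.prems by auto
    then have d: "d \<in> expo n" by (simp add: expo_add)
    have "single d c * (single (m i) 1 * Var j - single (m j) 1 * Var i) \<in> ?J"
      using d swap.hyps by (intro I2_mult[OF carr] I2_minor[OF carr] single_in_poly_ring)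
    moreover have "single d c * (single (m i) 1 * Var j - single (m j) 1 * Var i) =
      single ?v c - (single ?w c :: 'k mpoly)"
      by (simp add: Var_def right_diff_distrib Poly_Mapping.mult_single add.assoc)
    ultimately have "(single u c - single ?v c) +
      (single ?v c - single ?w c) \<in> ?J"
      using uv by (intro I2_add[OF carr]) simp_all
    then have "single u c - single ?w c \<in> ?J"
      by (simp only: diff_add_cancel diff_add_eq add_diff_eq)
    then show ?case using d m swap.hyps by (simp add: expo_add expo_single)
  }
qed

text \<open>Modulo exchange steps, the result of replacing a variable \<open>x p\<close> in a monomial by \<open>m p\<close> does not
  depend on the choice of \<open>p\<close>; it is multiplication by a virtual element \<open>m p / x p\<close>.\<close>

lemma exchange_lift_refl:
  assumes "w + unit_exp p = w' + unit_exp q" "p \<in> {1..n}" "q \<in> {1..n}"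
  shows "exchange n m (w + m p) (w' + m q)"
proof (cases "p = q")
  case True
  then show ?thesis using assms by (simp add: exchange.start)
next
  case False
  define d where "d = w - unit_exp q"
  have "lookup (w + unit_exp p) q = lookup (w' + unit_exp q) q"
    using assms(1) by simp
  then have "lookup w q \<ge> 1"
    using False by (simp add: Poly_Mapping.lookup_add lookup_single)
  then have w: "w = d + unit_exp q"
    unfolding d_def by (intro poly_mapping_eqI)
      (auto simp: Poly_Mapping.lookup_add Poly_Mapping.lookup_minus lookup_single when_def)
  with assms(1) have "w' + unit_exp q = (d + unit_exp p) + unit_exp q" by (simp add: ac_simps)
  then have w': "w' = d + unit_exp p" by simp
  have "exchange n m (d + m p + unit_exp q) (d + m q + unit_exp p)"
    by (rule exchange.swap[OF exchange.start assms(2,3)])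
  then show ?thesis by (simp add: w w' ac_simps)
qed

text \<open>The virtual multiplication is compatible with the step from \<open>d * m i * x j\<close> to \<open>d * m j * x i\<close>:
  multiplying the former through \<open>x j\<close> and the latter through \<open>x i\<close> gives \<open>d * m i * m j\<close> in both
  cases.\<close>

lemma exchange_lift:
  assumes "exchange n m z z'" "z = w + unit_exp p" "z' = w' + unit_exp q" "p \<in> {1..n}" "q \<in> {1..n}"
  shows "exchange n m (w + m p) (w' + m q)"
  using assms
proof (induction arbitrary: w w' q rule: exchange.induct)
  case (start u)
  then show ?case using exchange_lift_refl by metis
next
  case (swap u d i j)
  have "exchange n m (w + m p) ((d + m i) + m j)"
    using swap by (intro swap.IH) auto
  moreover have "exchange n m ((d + m j) + m i) (w' + m q)"
    using swap by (intro exchange_lift_refl) auto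
  ultimately show ?case by (metis exchange_trans add.assoc add.commute)
qed

context cyclic_relations
begin

abbreviation cyclic_exp :: "nat \<Rightarrow> (nat \<Rightarrow>\<^sub>0 nat)" where
  "cyclic_exp i \<equiv> single (\<tau> i) (L (\<tau> i))"

lemma n2: "2 \<le> n" using n3 by simp

lemma \<alpha>_pos: "0 < \<alpha>" by (rule PF_pos[OF \<alpha>_PF])

lemma \<tau>_in: "i \<in> {1..n} \<Longrightarrow> \<tau> i \<in> {1..n}"
  by (rule one_cycle_in(2)[OF cycle])

lemma cyclic_exp_expo: "i \<in> {1..n} \<Longrightarrow> cyclic_exp i \<in> expo n"
  by (intro expo_single \<tau>_in)

lemma arrow: "i \<in> {1..n} \<Longrightarrow> int (a i) + \<alpha> - int (a (\<tau> i)) \<in> H"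
proof -
  assume i: "i \<in> {1..n}"
  have "int (L (\<tau> i)) * int (a (\<tau> i)) - int (a (\<tau> i)) = int (L (\<tau> i) - 1) * int (a (\<tau> i))"
    using L_pos[OF \<tau>_in[OF i]] by (simp add: of_nat_diff left_diff_distrib)
  moreover have "int (L (\<tau> i) - 1) * int (a (\<tau> i)) \<in> H"
    by (intro H_mult H_gen \<tau>_in i)
  ultimately show ?thesis using relation[OF i] by (simp add: add.commute)
qed

lemmas arrow_only = arrow_unique[OF \<alpha>_PF \<alpha>_notin cycle arrow]

lemma n_times_\<alpha>: "int n * \<alpha> = (\<Sum>i\<in>{1..n}. (int (L i) - 1) * int (a i))"
proof -
  have "(\<Sum>i\<in>{1..n}. \<alpha> + int (a i)) = (\<Sum>i\<in>{1..n}. int (L (\<tau> i) * a (\<tau> i)))"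
    by (rule sum.cong) (simp_all only: relation)
  also have "\<dots> = (\<Sum>i\<in>{1..n}. int (L i * a i))"
    using cycle by (intro sum.reindex_bij_betw) (simp add: one_cycle_def)
  finally show ?thesis by (simp add: sum.distrib left_diff_distrib sum_subtractf)
qed

text \<open>These are the monomials to which none of the relations \<open>L (\<tau> i) * a (\<tau> i) = \<alpha> + a i\<close> applies.\<close>

definition small :: "(nat \<Rightarrow>\<^sub>0 nat) \<Rightarrow> bool" where
  "small u \<longleftrightarrow> u \<in> expo n \<and> (\<forall>i\<in>{1..n}. lookup u i < L i)"

lemma smallD: "small u \<Longrightarrow> u \<in> expo n"
  by (simp add: small_def)

text \<open>Another factorization \<open>v\<close> of the degree of \<open>u\<close> would turn the factorization
  \<open>L - 1 = (L - 1 - u) + u\<close> of \<open>n \<alpha>\<close> into one that involves \<open>L i * a i = \<alpha> + \<dots>\<close> for some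
  \<open>i\<close>, and then \<open>(n - 1) \<alpha> \<in> H\<close>.\<close>

lemma small_unique:
  assumes u: "small u" and v: "v \<in> expo n" and deg: "wdeg_mon a u = wdeg_mon a v"
  shows "v = u"
proof -
  have le: "lookup v i \<le> lookup u i" if i: "i \<in> {1..n}" for i
  proof (rule ccontr)
    assume gt: "\<not> ?thesis"
    obtain w where w: "w \<in> expo n"
      "\<And>j. j \<in> {1..n} \<Longrightarrow> lookup w j = L j - 1 - lookup u j + lookup v j"
      using exponent_vector_exists[of n "\<lambda>j. L j - 1 - lookup u j + lookup v j"] by blast
    have "int (wdeg_mon a w) = (\<Sum>j\<in>{1..n}. int (lookup w j) * int (a j))"
      using w(1) by (simp add: wdeg_mon_expo)
    also have "\<dots> = (\<Sum>j\<in>{1..n}. (int (L j) - 1) * int (a j) +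
       (int (lookup v j * a j) - int (lookup u j * a j)))"
    proof (intro sum.cong refl)
      fix j assume j: "j \<in> {1..n}"
      then have "lookup u j < L j" using u by (simp add: small_def)
      then have "int (lookup w j) =
          (int (L j) - 1) + (int (lookup v j) - int (lookup u j))"
        using w(2)[OF j] by linarith
      then show "int (lookup w j) * int (a j) = (int (L j) - 1) * int (a j) +
       (int (lookup v j * a j) - int (lookup u j * a j))"
        by (simp only:) (simp add: algebra_simps)
    qed
    also have "\<dots> = int n * \<alpha> + (int (wdeg_mon a v) - int (wdeg_mon a u))"
      using v smallD[OF u] by (simp add: sum.distrib sum_subtractf n_times_\<alpha> wdeg_mon_expo)
    finally have deg_w: "int (wdeg_mon a w) = int n * \<alpha>" using deg by simp
    have "L i \<le> lookup w i" using w(2)[OF i] gt u i by (auto simp: small_def)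
    then obtain w' where w': "w = w' + single i (L i)" "w' \<in> expo n"
      using split_off_single[OF w(1)] by blast
    obtain p where p: "p \<in> {1..n}" "\<tau> p = i" using one_cycle_pred[OF cycle i] .
    have "int (wdeg_mon a w) = int (wdeg_mon a (w' + unit_exp p)) + \<alpha>"
      using w'(1) relation[OF p(1)] p(2) by (simp add: algebra_simps)
    then have "int (wdeg_mon a (w' + unit_exp p)) = int (n - 1) * \<alpha>"
      using deg_w n2 by (simp add: of_nat_diff left_diff_distrib)
    then show False using \<alpha>_notin w'(2) p(1) H_iff by (metis expo_add expo_single)
  qed
  have eq: "lookup v i = lookup u i" if i: "i \<in> {1..n}" for i
  proof (rule ccontr)
    assume "\<not> ?thesis"
    then have "lookup v i < lookup u i" using le[OF i] by simp
    then have "lookup v i * a i < lookup u i * a i" using pos i by simp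
    then have "(\<Sum>j\<in>{1..n}. lookup v j * a j) < (\<Sum>j\<in>{1..n}. lookup u j * a j)"
      using le i by (intro sum_strict_mono_ex1) auto
    then show False using deg v smallD[OF u] by (simp add: wdeg_mon_expo)
  qed
  then show ?thesis using expo_eqI[OF v smallD[OF u]] by blast
qed

lemma not_smallE:
  assumes "u \<in> expo n" "\<not> small u"
  obtains w p where "p \<in> {1..n}" "w \<in> expo n" "u = w + cyclic_exp p"
    "int (wdeg_mon a u) = \<alpha> + int (wdeg_mon a (w + unit_exp p))"
proof -
  obtain i where i: "i \<in> {1..n}" "L i \<le> lookup u i"
    using assms by (auto simp: small_def not_less)
  obtain p where p: "p \<in> {1..n}" "\<tau> p = i" using one_cycle_pred[OF cycle i(1)] .
  obtain w where w: "u = w + single i (L i)" "w \<in> expo n"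
    using split_off_single[OF assms(1) i(2)] .
  have "int (wdeg_mon a u) = \<alpha> + int (wdeg_mon a (w + unit_exp p))"
    using w relation[OF p(1)] p(2) by (simp add: algebra_simps)
  then show thesis using that p w by blast
qed

text \<open>Two monomials of the same degree that are not small can both be divided by the virtual element
  of degree \<open>\<alpha>\<close>, which leads to monomials of smaller degree.\<close>

lemma same_degree_exchange:
  assumes "u \<in> expo n" "v \<in> expo n" "wdeg_mon a u = wdeg_mon a v"
  shows "exchange n cyclic_exp u v"
  using assms
proof (induction "wdeg_mon a u" arbitrary: u v rule: less_induct)
  case less
  show ?case
  proof (cases "small u \<or> small v")
    case True
    then have "u = v" using small_unique less.prems by metis
    then show ?thesis by (simp add: exchange.start)
  next
    case False
    obtain w p where w: "p \<in> {1..n}" "w \<in> expo n" "u = w + cyclic_exp p"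
      "int (wdeg_mon a u) = \<alpha> + int (wdeg_mon a (w + unit_exp p))"
      using not_smallE[OF less.prems(1)] False by blast
    obtain w' q where w': "q \<in> {1..n}" "w' \<in> expo n" "v = w' + cyclic_exp q"
      "int (wdeg_mon a v) = \<alpha> + int (wdeg_mon a (w' + unit_exp q))"
      using not_smallE[OF less.prems(2)] False by blast
    have "exchange n cyclic_exp (w + unit_exp p) (w' + unit_exp q)"
    proof (rule less.hyps)
      show "wdeg_mon a (w + unit_exp p) < wdeg_mon a u" using w(4) \<alpha>_pos by linarith
      show "wdeg_mon a (w + unit_exp p) = wdeg_mon a (w' + unit_exp q)"
        using w(4) w'(4) less.prems(3) by linarith
      show "w + unit_exp p \<in> expo n" "w' + unit_exp q \<in> expo n"
        using w w' by (simp_all add: expo_add expo_single)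
    qed
    then show ?thesis
      unfolding w(3) w'(3) by (rule exchange_lift) (use w(1) w'(1) in auto)
  qed
qed

lemma defining_ideal_eq_cyclic_minors:
  "(defining_ideal n a :: ('k::field) mpoly set) =
     I2 n (\<lambda>i. single (cyclic_exp i) 1) Var"
proof
  let ?J = "I2 n (\<lambda>i. single (cyclic_exp i) (1 :: 'k)) Var"
  have carr: "\<And>i. i \<in> {1..n} \<Longrightarrow> single (cyclic_exp i) (1 :: 'k) \<in> carrier (poly_ring n)"
    "\<And>i. i \<in> {1..n} \<Longrightarrow> (Var i :: 'k mpoly) \<in> carrier (poly_ring n)"
    by (rule single_in_poly_ring[OF cyclic_exp_expo] Var_in_poly_ring; assumption)+
  show "?J \<subseteq> defining_ideal n a"
  proof (rule I2_subset[OF carr])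
    fix i j assume ij: "i \<in> {1..n}" "j \<in> {1..n}"
    have "single (cyclic_exp i + unit_exp j) 1 - single (cyclic_exp j + unit_exp i) 1
        \<in> (defining_ideal n a :: 'k mpoly set)"
    proof (rule binomial_in_defining_ideal)
      show "wdeg_mon a (cyclic_exp i + unit_exp j) = wdeg_mon a (cyclic_exp j + unit_exp i)"
      proof -
        have "int (wdeg_mon a (cyclic_exp i + unit_exp j)) = int (wdeg_mon a (cyclic_exp j + unit_exp i))"
          using relation[OF ij(1)] relation[OF ij(2)] by simp
        then show ?thesis by (simp only: of_nat_eq_iff)
      qed
    qed (use ij in \<open>auto simp: expo_add expo_single cyclic_exp_expo\<close>)
    then show "single (cyclic_exp i) 1 * Var j - single (cyclic_exp j) 1 * Var i
        \<in> (defining_ideal n a :: 'k mpoly set)"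
      by (simp add: Var_def Poly_Mapping.mult_single)
  qed (auto intro: defining_ideal_zero defining_ideal_add defining_ideal_mult)
  show "defining_ideal n a \<subseteq> ?J"
  proof
    fix p :: "'k mpoly" assume "p \<in> defining_ideal n a"
    then show "p \<in> ?J"
    proof (induction rule: defining_ideal_induct)
      case zero
      show ?case by (rule I2_zero[OF carr])
    next
      case (add u v c q)
      then show ?case
        using exchange_in_I2[OF cyclic_exp_expo same_degree_exchange[OF add(1-3)] add(1), of c]
        by (intro I2_add[OF carr]) auto
    qed
  qed
qed

text \<open>\<open>(L i + 1) * a i = a p + L (\<tau> i) * a (\<tau> i)\<close> for the predecessor \<open>p\<close> of \<open>i\<close>. On the other hand a
  factorization of \<open>l * a i\<close>, \<open>l \<le> L i\<close>, without \<open>a i\<close> would give one of \<open>L i * a i = \<alpha> + a p\<close> that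
  involves another generator, contrary to the uniqueness of arrows.\<close>

lemma least_multiple:
  assumes i: "i \<in> {1..n}"
  shows "(LEAST l. 0 < l \<and> int (l * a i) \<in> sgrp ({1..n} - {i}) a) = L i + 1"
proof (rule Least_equality)
  obtain p where p: "p \<in> {1..n}" "\<tau> p = i" using one_cycle_pred[OF cycle i] .
  have ne: "p \<noteq> i" "\<tau> i \<noteq> i" using one_cycle_no_fixed_point[OF cycle _ n2, of p] one_cycle_no_fixed_point[OF cycle _ n2, of i] p i by auto
  let ?u = "unit_exp p + cyclic_exp i"
  have u: "?u \<in> expo n" using p i by (simp add: expo_add expo_single cyclic_exp_expo)
  have "int ((L i + 1) * a i) = int (wdeg_mon a ?u)"
    using relation[OF p(1)] relation[OF i] p(2) by (simp add: algebra_simps)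
  then have "(L i + 1) * a i = wdeg_mon a ?u" by (simp only: of_nat_eq_iff)
  also have "\<dots> = (\<Sum>j\<in>{1..n}. lookup ?u j * a j)" by (rule wdeg_mon_expo[OF u])
  also have "\<dots> = (\<Sum>j\<in>{1..n} - {i}. lookup ?u j * a j)"
    using ne by (intro sum.mono_neutral_right) (auto simp: Poly_Mapping.lookup_add lookup_single)
  finally have "int ((L i + 1) * a i) = int (\<Sum>j\<in>{1..n} - {i}. lookup ?u j * a j)"
    by (simp only: of_nat_eq_iff)
  then have "int ((L i + 1) * a i) \<in> sgrp ({1..n} - {i}) a"
    unfolding sgrp_def by (intro CollectI exI conjI TrueI)
  then show "0 < L i + 1 \<and> int ((L i + 1) * a i) \<in> sgrp ({1..n} - {i}) a" by simp
  fix l assume l: "0 < l \<and> int (l * a i) \<in> sgrp ({1..n} - {i}) a"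
  then obtain c where "int (l * a i) = int (\<Sum>j\<in>{1..n} - {i}. c j * a j)"
    unfolding sgrp_def by blast
  then have c: "l * a i = (\<Sum>j\<in>{1..n} - {i}. c j * a j)" by (simp only: of_nat_eq_iff)
  show "L i + 1 \<le> l"
  proof (rule ccontr)
    assume "\<not> ?thesis"
    then have "l \<le> L i" by simp
    have "0 < l * a i" using l pos i by simp
    then have "(\<Sum>j\<in>{1..n} - {i}. c j * a j) \<noteq> 0" by (simp only: c)
    then obtain q where q: "q \<in> {1..n} - {i}" "c q * a q \<noteq> 0" by (rule sum.not_neutral_contains_not_neutral)
    obtain w where w: "w \<in> expo n" "\<And>j. j \<in> {1..n} \<Longrightarrow> lookup w j = (if j = i then L i - l else c j)"
      using exponent_vector_exists[of n "\<lambda>j. if j = i then L i - l else c j"] by blast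
    have "wdeg_mon a w = (\<Sum>j\<in>{1..n}. (if j = i then L i - l else c j) * a j)"
      unfolding wdeg_mon_expo[OF w(1)] by (intro sum.cong refl) (simp add: w(2))
    also have "\<dots> = (L i - l) * a i + (\<Sum>j\<in>{1..n} - {i}. c j * a j)"
      using i by (simp add: sum.remove[of "{1..n}" i])
    also have "\<dots> = L i * a i" unfolding c[symmetric] using \<open>l \<le> L i\<close> by (simp add: diff_mult_distrib)
    finally have "int (wdeg_mon a w) = int (a p) + \<alpha>" using relation[OF p(1)] p(2) by simp
    moreover have "0 < lookup w q" using w(2)[of q] q by auto
    ultimately have "int (a p) + \<alpha> - int (a q) \<in> H" using H_minus_gen[OF w(1), of q] by simp
    then have "q = \<tau> p" using arrow_only[OF _ p(1), of q] q(1) by blast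
    then show False using p(2) q(1) by simp
  qed
qed

end

section \<open>Replacing the first row modulo the defining ideal\<close>

definition homog_comp :: "(nat \<Rightarrow> nat) \<Rightarrow> nat \<Rightarrow> ('k::field) mpoly \<Rightarrow> 'k mpoly" where
  "homog_comp a e p = (\<Sum>u\<in>keys p.
     if wdeg_mon a u = e then single u (lookup p u) else 0)"

lemma lookup_homog_comp:
  "lookup (homog_comp a e p) u = (if wdeg_mon a u = e then lookup p u else 0)"
proof -
  have "lookup (homog_comp a e p) u =
    (\<Sum>v\<in>keys p. if v = u then (if wdeg_mon a u = e then lookup p u else 0) else 0)"
    unfolding homog_comp_def lookup_sum by (intro sum.cong) (auto simp: lookup_single when_def)
  then show ?thesis by (auto simp: in_keys_iff)
qed

lemma homog_comp_zero [simp]: "homog_comp a e 0 = 0"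
  by (simp add: homog_comp_def)

lemma homog_comp_add: "homog_comp a e (p + q) = homog_comp a e p + homog_comp a e q"
  by (rule poly_mapping_eqI) (simp add: lookup_homog_comp Poly_Mapping.lookup_add)

lemma homog_comp_minus: "homog_comp a e (p - q) = homog_comp a e p - homog_comp a e q"
  by (rule poly_mapping_eqI) (simp add: lookup_homog_comp Poly_Mapping.lookup_minus)

lemma homog_comp_single:
  "homog_comp a e (single u c) = (if wdeg_mon a u = e then single u c else 0)"
  by (rule poly_mapping_eqI) (auto simp: lookup_homog_comp lookup_single when_def)

lemma homog_comp_single_mult:
  "homog_comp a e (single d c * p) =
     (if wdeg_mon a d \<le> e then single d c * homog_comp a (e - wdeg_mon a d) p else 0)"
proof (induction p rule: poly_mapping_single_induct)
  case (add u c' q)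
  show ?case
    unfolding distrib_left homog_comp_add add.IH
    by (auto simp: Poly_Mapping.mult_single homog_comp_single distrib_left)
qed simp

lemma sum_homog_comp: "(\<Sum>e\<in>wdeg_mon a ` keys p. homog_comp a e p) = p"
proof (rule poly_mapping_eqI)
  fix u
  show "lookup (\<Sum>e\<in>wdeg_mon a ` keys p. homog_comp a e p) u = lookup p u"
    by (auto simp: lookup_sum lookup_homog_comp in_keys_iff image_iff)
qed

context minimal_generators
begin

text \<open>A graded Nakayama argument: changing the entries of the first row by elements of the defining
  ideal \<open>I\<close> changes the minors by elements of \<open>(x\<^sub>1, \<dots>, x\<^sub>n) I\<close>, so that the new minors still
  generate \<open>I\<close>; the proof is by induction on the degree.\<close>

lemma replace_first_row:
  fixes f :: "nat \<Rightarrow> ('k::field) mpoly"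
  assumes f: "\<And>i. i \<in> {1..n} \<Longrightarrow> f i \<in> carrier (poly_ring n)"
    and I: "defining_ideal n a \<subseteq> I2 n f Var"
    and m: "\<And>i. i \<in> {1..n} \<Longrightarrow> m i \<in> expo n"
    and deg: "\<And>i j. i \<in> {1..n} \<Longrightarrow> j \<in> {1..n} \<Longrightarrow>
      wdeg_mon a (m i) + a j = wdeg_mon a (m j) + a i"
    and diff: "\<And>i. i \<in> {1..n} \<Longrightarrow> f i - single (m i) \<epsilon> \<in> defining_ideal n a"
  shows "defining_ideal n a \<subseteq> I2 n (\<lambda>i. single (m i) \<epsilon>) Var"
proof -
  let ?J = "I2 n (\<lambda>i. single (m i) \<epsilon>) Var"
  have V: "\<And>i. i \<in> {1..n} \<Longrightarrow> (Var i :: 'k mpoly) \<in> carrier (poly_ring n)"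
    by (rule Var_in_poly_ring)
  have M: "\<And>i. i \<in> {1..n} \<Longrightarrow> single (m i) \<epsilon> \<in> carrier (poly_ring n)"
    by (rule single_in_poly_ring[OF m])
  have J: "0 \<in> ?J" "\<And>p q. p \<in> ?J \<Longrightarrow> q \<in> ?J \<Longrightarrow> p + q \<in> ?J"
    "\<And>r p. r \<in> carrier (poly_ring n) \<Longrightarrow> p \<in> ?J \<Longrightarrow> r * p \<in> ?J" "\<And>p. p \<in> ?J \<Longrightarrow> - p \<in> ?J"
    "\<And>i j. i \<in> {1..n} \<Longrightarrow> j \<in> {1..n} \<Longrightarrow>
      single (m i) \<epsilon> * Var j - single (m j) \<epsilon> * Var i \<in> ?J"
    by (rule I2_ideal[OF M V]; assumption)+
  have minor_comp: "homog_comp a e (single (m i) \<epsilon> * Var j - single (m j) \<epsilon> * Var i) \<in> ?J"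
    if ij: "i \<in> {1..n}" "j \<in> {1..n}" for e i j
  proof -
    have "homog_comp a e (single (m i) \<epsilon> * Var j - single (m j) \<epsilon> * Var i) =
      (if wdeg_mon a (m i) + a j = e
       then single (m i) \<epsilon> * Var j - single (m j) \<epsilon> * Var i else 0)"
      using deg[OF ij] by (simp add: Var_def Poly_Mapping.mult_single homog_comp_minus homog_comp_single)
    then show ?thesis using J(1) J(5)[OF ij] by simp
  qed
  have comp_in: "homog_comp a e p \<in> ?J" if "p \<in> defining_ideal n a" for e p
    using that
  proof (induction e arbitrary: p rule: less_induct)
    case (less e)
    have var_mult: "homog_comp a e' (q * Var j) \<in> ?J"
      if "q \<in> defining_ideal n a" "j \<in> {1..n}" "e' \<le> e" for e' j q
    proof (cases "a j \<le> e'")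
      case True
      have "homog_comp a e' (q * Var j) = Var j * homog_comp a (e' - a j) q"
        using True by (simp add: mult.commute[of q] Var_def homog_comp_single_mult)
      moreover have "e' - a j < e" using True pos that by force
      ultimately show ?thesis using J(3)[OF V[OF that(2)]] less.IH that(1) by simp
    next
      case False
      then show ?thesis using J(1) by (simp add: mult.commute[of q] Var_def homog_comp_single_mult)
    qed
    have "p \<in> I2 n f Var" using less.prems I by blast
    then show ?case
    proof (rule I2_induct[OF _ f V])
      show "homog_comp a e 0 \<in> ?J" using J(1) by simp
      fix d c i j q
      assume d: "d \<in> expo n" and ij: "i \<in> {1..n}" "j \<in> {1..n}" and q: "homog_comp a e q \<in> ?J"
      let ?g = "\<lambda>i. f i - single (m i) \<epsilon>"
      let ?e = "e - wdeg_mon a d"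
      have split: "f i * Var j - f j * Var i =
        (single (m i) \<epsilon> * Var j - single (m j) \<epsilon> * Var i) + (?g i * Var j - ?g j * Var i)"
        by (simp add: algebra_simps)
      have "homog_comp a ?e (?g i * Var j) - homog_comp a ?e (?g j * Var i) \<in> ?J"
        using J(2)[OF var_mult[OF diff[OF ij(1)] ij(2), of ?e] J(4)[OF var_mult[OF diff[OF ij(2)] ij(1), of ?e]]]
        by (simp only: add_uminus_conv_diff diff_le_self)
      then have "homog_comp a ?e (f i * Var j - f j * Var i) \<in> ?J"
        unfolding split homog_comp_add by (intro J(2) minor_comp ij) (simp only: homog_comp_minus)
      then have "homog_comp a e (single d c * (f i * Var j - f j * Var i)) \<in> ?J"
        unfolding homog_comp_single_mult using J(1) J(3)[OF single_in_poly_ring[OF d]] by simp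
      then show "homog_comp a e (single d c * (f i * Var j - f j * Var i) + q) \<in> ?J"
        unfolding homog_comp_add by (rule J(2)) (rule q)
    qed
  qed
  show ?thesis
  proof
    fix p :: "'k mpoly" assume p: "p \<in> defining_ideal n a"
    have "(\<Sum>e\<in>A. homog_comp a e p) \<in> ?J" if "finite A" for A
      using that by (induction A rule: finite_induct) (auto intro: J(1) J(2) comp_in p)
    then have "(\<Sum>e\<in>wdeg_mon a ` keys p. homog_comp a e p) \<in> ?J" by simp
    then show "p \<in> ?J" by (simp only: sum_homog_comp)
  qed
qed

text \<open>The sum of the coefficients over all exponents with property \<open>P\<close> is a linear functional; under
  the hypothesis on \<open>P\<close> it vanishes on all monomial multiples of the minors, hence on the
  defining ideal.\<close>

lemma exchange_invariant:
  assumes m: "\<And>i. i \<in> {1..n} \<Longrightarrow> m i \<in> expo n"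
    and I: "defining_ideal n a \<subseteq> I2 n (\<lambda>i. single (m i) (\<epsilon> :: 'k::field)) Var"
    and inv: "\<And>d i j. d \<in> expo n \<Longrightarrow> i \<in> {1..n} \<Longrightarrow> j \<in> {1..n} \<Longrightarrow>
      P (d + m i + unit_exp j) \<Longrightarrow> P (d + m j + unit_exp i)"
    and uv: "u \<in> expo n" "v \<in> expo n" "wdeg_mon a u = wdeg_mon a v" "P u"
  shows "P v"
proof -
  define \<Lambda> where "\<Lambda> p = (\<Sum>w\<in>keys p. if P w then lookup p w else 0)" for p :: "'k mpoly"
  have \<Lambda>_superset: "\<Lambda> p = (\<Sum>w\<in>A. if P w then lookup p w else 0)"
    if "finite A" "keys p \<subseteq> A" for p A
    unfolding \<Lambda>_def using that by (intro sum.mono_neutral_left) (auto simp: in_keys_iff)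
  have \<Lambda>_add: "\<Lambda> (p + q) = \<Lambda> p + \<Lambda> q" for p q
  proof -
    let ?A = "keys p \<union> keys q"
    have "keys (p + q) \<subseteq> ?A" by (rule Poly_Mapping.keys_add)
    then show ?thesis
      by (simp add: \<Lambda>_superset[of ?A] flip: sum.distrib)
        (intro sum.cong, auto simp: Poly_Mapping.lookup_add)
  qed
  have \<Lambda>_single: "\<Lambda> (single w c) = (if P w then c else 0)" for w c
    by (simp add: \<Lambda>_def)
  have \<Lambda>_binomial: "\<Lambda> (single w c - single w' c) =
      (if P w then c else 0) - (if P w' then c else 0)" for w w' c
    using \<Lambda>_add[of "single w c - single w' c" "single w' c"]
    by (simp add: \<Lambda>_single algebra_simps)
  have "\<Lambda> p = 0" if "p \<in> I2 n (\<lambda>i. single (m i) \<epsilon>) Var" for p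
    using that
  proof (rule I2_induct)
    show "\<Lambda> 0 = 0" by (simp add: \<Lambda>_def)
    fix d c i j q
    assume d: "d \<in> expo n" and ij: "i \<in> {1..n}" "j \<in> {1..n}" and q: "\<Lambda> q = 0"
    have "single d c * (single (m i) \<epsilon> * Var j - single (m j) \<epsilon> * Var i) =
      single (d + m i + unit_exp j) (c * \<epsilon>) - single (d + m j + unit_exp i) (c * \<epsilon>)"
      by (simp add: Var_def right_diff_distrib Poly_Mapping.mult_single add.assoc)
    moreover have "P (d + m i + unit_exp j) \<longleftrightarrow> P (d + m j + unit_exp i)"
      using inv d ij by blast
    ultimately show "\<Lambda> (single d c *
      (single (m i) \<epsilon> * Var j - single (m j) \<epsilon> * Var i) + q) = 0"
      by (simp add: \<Lambda>_add \<Lambda>_binomial q)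
  qed (rule single_in_poly_ring[OF m] Var_in_poly_ring; assumption)+
  then have "\<Lambda> (single u 1 - single v 1) = 0"
    using binomial_in_defining_ideal[OF uv(1-3), of "1 :: 'k"] I by blast
  then show "P v" using uv(4) by (simp add: \<Lambda>_binomial split: if_splits)
qed

text \<open>If the first row is \<open>\<epsilon> g\<close> times the second, then exchange steps change nothing, although
  distinct monomials of the same degree exist. The case \<open>\<epsilon> = 0\<close> says that the defining ideal is
  not zero.\<close>

lemma first_row_not_multiple:
  assumes "g \<in> expo n"
  shows "\<not> defining_ideal n a \<subseteq> I2 n (\<lambda>i. single (g + unit_exp i) (\<epsilon> :: 'k::field)) Var"
proof
  assume I: "defining_ideal n a \<subseteq> I2 n (\<lambda>i. single (g + unit_exp i) \<epsilon>) Var"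
  have in_n: "1 \<in> {1..n}" "2 \<in> {1..n}" using n3 by auto
  let ?u = "single 1 (a 2) :: nat \<Rightarrow>\<^sub>0 nat" and ?v = "single 2 (a 1) :: nat \<Rightarrow>\<^sub>0 nat"
  have "?v = ?u"
    by (rule exchange_invariant[OF _ I, where P = "\<lambda>w. w = ?u" and u = ?u])
      (use assms in_n in \<open>auto simp: expo_add expo_single ac_simps\<close>)
  then have "lookup ?v 2 = lookup ?u 2" by simp
  then show False using bspec[OF pos in_n(1)] by (simp add: lookup_single)
qed

end

section \<open>Monomial first rows are cyclic\<close>

context minimal_generators
begin

text \<open>Suppose that \<open>m i\<close> never is a power of the variable \<open>x j\<close>. Then no exchange step can lead to
  or away from a power of \<open>x j\<close>, although a power of \<open>x j\<close> has the same degree as a power of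
  another variable.\<close>

lemma pure_power_exists:
  assumes m: "\<And>i. i \<in> {1..n} \<Longrightarrow> m i \<in> expo n" "\<And>i. i \<in> {1..n} \<Longrightarrow> m i \<noteq> 0"
    and I: "defining_ideal n a \<subseteq> I2 n (\<lambda>i. single (m i) (\<epsilon> :: 'k::field)) Var"
    and j: "j \<in> {1..n}"
  shows "\<exists>i\<in>{1..n}. \<exists>l>0. m i = single j l"
proof (rule ccontr)
  assume none: "\<not> ?thesis"
  obtain j' where j': "j' \<in> {1..n}" "j' \<noteq> j" using n3 that[of 1] that[of 2] by fastforce
  let ?u = "single j (a j')" and ?v = "single j' (a j)"
  have "?v = ?u"
  proof (rule exchange_invariant[OF m(1) I, where P = "\<lambda>w. w = ?u" and u = ?u])
    fix d i k assume i: "i \<in> {1..n}" and eq: "d + m i + unit_exp k = ?u"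
    have "lookup (m i) q = 0" if "q \<noteq> j" for q
    proof -
      have "lookup (d + m i + unit_exp k) q = 0" using eq that by (simp add: lookup_single)
      then show ?thesis by (simp add: Poly_Mapping.lookup_add)
    qed
    then have mi: "m i = single j (lookup (m i) j)"
      by (intro poly_mapping_eqI) (auto simp: lookup_single when_def)
    moreover have "lookup (m i) j > 0"
      using m(2)[OF i] mi by (cases "lookup (m i) j = 0") auto
    ultimately have False using none i by blast
    then show "d + m k + unit_exp i = ?u" ..
  qed (use j j' in \<open>auto simp: expo_single\<close>)
  then have "lookup ?v j' = lookup ?u j'" by simp
  then show False using bspec[OF pos j] j' by (simp add: lookup_single)
qed

text \<open>If the permutation \<open>\<tau>\<close> had an invariant proper subset \<open>W\<close>, then exchange steps would preserve the
  property of being free of the variables in \<open>W\<close>, which does not only depend on the degree.\<close>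

lemma permutation_is_one_cycle:
  assumes \<tau>: "bij_betw \<tau> {1..n} {1..n}"
    and L: "\<And>i. i \<in> {1..n} \<Longrightarrow> 0 < L i"
    and I: "defining_ideal n a \<subseteq>
      I2 n (\<lambda>i. single (single (\<tau> i) (L (\<tau> i))) (\<epsilon> :: 'k::field)) Var"
  shows "one_cycle n \<tau>"
  unfolding one_cycle_def
proof (intro conjI \<tau> ballI)
  fix i j assume i: "i \<in> {1..n}" and j: "j \<in> {1..n}"
  define W where "W = range (\<lambda>t. (\<tau> ^^ t) i)"
  have W: "W \<subseteq> {1..n}" using funpow_in[OF \<tau> i] by (auto simp: W_def)
  have inj: "inj_on \<tau> {1..n}" and \<tau>_in: "\<And>i. i \<in> {1..n} \<Longrightarrow> \<tau> i \<in> {1..n}"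
    using \<tau> by (auto simp: bij_betw_def)
  have "\<tau> ` W \<subseteq> W"
  proof
    fix x assume "x \<in> \<tau> ` W"
    then obtain t where "x = \<tau> ((\<tau> ^^ t) i)" by (auto simp: W_def)
    then have "x = (\<tau> ^^ Suc t) i" by simp
    then show "x \<in> W" unfolding W_def by blast
  qed
  then have image: "\<tau> ` W = W"
    using endo_inj_surj[of W \<tau>] inj_on_subset[OF inj W] finite_subset[OF W] by blast
  have \<tau>W: "\<tau> p \<in> W \<longleftrightarrow> p \<in> W" if p: "p \<in> {1..n}" for p
  proof
    assume "\<tau> p \<in> W"
    then have "\<tau> p \<in> \<tau> ` W" by (simp only: image)
    then obtain w where "w \<in> W" "\<tau> p = \<tau> w" by blast
    then show "p \<in> W" using inj_onD[OF inj, of p w] W p by blast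
  next
    assume "p \<in> W"
    then have "\<tau> p \<in> \<tau> ` W" by blast
    then show "\<tau> p \<in> W" by (simp only: image)
  qed
  have "j \<in> W"
  proof (rule ccontr)
    assume jW: "j \<notin> W"
    let ?P = "\<lambda>w. \<exists>x\<in>W. lookup w x \<noteq> 0"
    have iW: "i \<in> W" unfolding W_def by (intro range_eqI[of _ _ 0]) simp
    have "?P (single j (a i))"
    proof (rule exchange_invariant[OF _ I, where P = ?P and u = "single i (a j)"])
      fix d p q
      assume pq: "p \<in> {1..n}" "q \<in> {1..n}"
      have meets: "?P (d + single (\<tau> p) (L (\<tau> p)) + unit_exp q) \<longleftrightarrow> ?P d \<or> p \<in> W \<or> q \<in> W"
        if "p \<in> {1..n}" for p q
      proof -
        have "lookup (d + single (\<tau> p) (L (\<tau> p)) + unit_exp q) x \<noteq> 0 \<longleftrightarrow>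
          lookup d x \<noteq> 0 \<or> x = \<tau> p \<or> x = q" for x
          using L[OF \<tau>_in[OF that]] by (auto simp: Poly_Mapping.lookup_add lookup_single when_def)
        then show ?thesis using \<tau>W[OF that] by blast
      qed
      assume "?P (d + single (\<tau> p) (L (\<tau> p)) + unit_exp q)"
      then show "?P (d + single (\<tau> q) (L (\<tau> q)) + unit_exp p)"
        unfolding meets[OF pq(1)] meets[OF pq(2)] by blast
    next
      show "?P (single i (a j))"
        using iW pos j by (intro bexI[of _ i]) (auto simp: lookup_single)
    qed (use i j \<tau>_in in \<open>auto simp: expo_single\<close>)
    then show False using jW by (auto simp: lookup_single when_def split: if_splits)
  qed
  then obtain s where "(\<tau> ^^ s) i = j" unfolding W_def by blast
  then show "\<exists>t<n. (\<tau> ^^ t) i = j" using orbit_bound[OF \<tau> i] by blast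
qed

end

section \<open>Cyclic minors force a pseudo-Frobenius number of maximal order\<close>

text \<open>Write the exponent \<open>c\<close> of a monomial of degree \<open>(n - 1) \<delta> + a i\<close> as the exponent of \<open>x i\<close> plus
  a combination of the relations \<open>\<delta> = L (\<tau> j) * a (\<tau> j) - a j\<close>, with coefficients \<open>k j\<close>. Comparison
  of degrees shows that the sum of the \<open>k j\<close> must be \<open>n - 1\<close>; the point is that they are natural
  numbers.\<close>

definition carries :: "nat \<Rightarrow> (nat \<Rightarrow> nat) \<Rightarrow> (nat \<Rightarrow> nat) \<Rightarrow> nat \<Rightarrow> (nat \<Rightarrow> nat) \<Rightarrow> (nat \<Rightarrow>\<^sub>0 nat) \<Rightarrow> bool" where
  "carries n \<tau> L i k c \<longleftrightarrow> (\<Sum>j\<in>{1..n}. k j) = n - 1 \<and>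
     (\<forall>j\<in>{1..n}. lookup c (\<tau> j) + k (\<tau> j) = (if \<tau> j = i then 1 else 0) + L (\<tau> j) * k j)"

text \<open>Since the exponents of \<open>c\<close> are nonnegative, a zero of \<open>k\<close> forces further zeros along the cycle
  until \<open>i\<close> is reached.\<close>

lemma carries_propagate:
  assumes \<tau>: "one_cycle n \<tau>" and i: "i \<in> {1..n}" and k: "carries n \<tau> L i k c"
    and st: "s \<le> t" "t < n" "k ((\<tau> ^^ s) i) = 0"
  shows "k ((\<tau> ^^ t) i) = 0"
  using st
proof (induction t)
  case (Suc t)
  show ?case
  proof (cases "s = Suc t")
    case False
    then have z: "k ((\<tau> ^^ t) i) = 0" using Suc by simp
    have "(\<tau> ^^ Suc t) i \<noteq> i"
      using inj_onD[OF one_cycle_inj[OF \<tau> i], of "Suc t" 0] Suc.prems by auto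
    then have "\<tau> ((\<tau> ^^ t) i) \<noteq> i" by simp
    then have "lookup c (\<tau> ((\<tau> ^^ t) i)) + k (\<tau> ((\<tau> ^^ t) i)) = 0 + L (\<tau> ((\<tau> ^^ t) i)) * k ((\<tau> ^^ t) i)"
      using k one_cycle_in(1)[OF \<tau> i, of t] unfolding carries_def by simp
    then show ?thesis using z by simp
  qed (use Suc in auto)
qed simp

text \<open>The coefficients sum up to \<open>n - 1\<close>. So they are not all zero, which makes \<open>k i\<close> positive, and they
  are not all positive, which makes the coefficient at the predecessor of \<open>i\<close> vanish.\<close>

lemma carries_start:
  assumes \<tau>: "one_cycle n \<tau>" and n: "2 \<le> n" and i: "i \<in> {1..n}" and k: "carries n \<tau> L i k c"
  shows "0 < k i" "lookup c i = 0"
proof -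
  have sum: "(\<Sum>j\<in>{1..n}. k j) = n - 1" using k by (simp add: carries_def)
  show pos: "0 < k i"
  proof (rule ccontr)
    assume "\<not> 0 < k i"
    then have zero: "k ((\<tau> ^^ t) i) = 0" if "t < n" for t
      using carries_propagate[OF \<tau> i k, of 0 t] that by simp
    have "k j = 0" if j: "j \<in> {1..n}" for j
    proof -
      obtain t where "t < n" "(\<tau> ^^ t) i = j" using one_cycle_reach[OF \<tau> i j] .
      then show ?thesis using zero[of t] by simp
    qed
    then have "(\<Sum>j\<in>{1..n}. k j) = 0" by simp
    then show False using sum n by simp
  qed
  define j0 where "j0 = (\<tau> ^^ (n - 1)) i"
  have j0: "j0 \<in> {1..n}" unfolding j0_def by (rule one_cycle_in(1)[OF \<tau> i])
  have "Suc (n - 1) = n" using n by simp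
  then have "\<tau> j0 = (\<tau> ^^ n) i" unfolding j0_def by (metis funpow.simps(2) o_apply)
  then have \<tau>j0: "\<tau> j0 = i" using one_cycle_full[OF \<tau> i] by simp
  have "k j0 = 0"
  proof (rule ccontr)
    assume ne: "k j0 \<noteq> 0"
    have ge: "1 \<le> k j" if j: "j \<in> {1..n}" for j
    proof (rule ccontr)
      assume "\<not> 1 \<le> k j"
      moreover obtain t where "t < n" "(\<tau> ^^ t) i = j" using one_cycle_reach[OF \<tau> i j] .
      ultimately have "k ((\<tau> ^^ (n - 1)) i) = 0"
        using n by (intro carries_propagate[OF \<tau> i k, of t "n - 1"]) auto
      then show False using ne by (simp add: j0_def)
    qed
    have "(\<Sum>j\<in>{1..n}. 1) \<le> (\<Sum>j\<in>{1..n}. k j)" by (intro sum_mono ge)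
    then show False using sum n by simp
  qed
  then have "lookup c i + k i = 1"
    using k j0 \<tau>j0 unfolding carries_def by (auto dest: bspec[of _ _ j0])
  then show "lookup c i = 0" using pos by linarith
qed

text \<open>An exchange step moves one unit of \<open>k\<close> from \<open>p\<close> to \<open>q\<close>. There is a unit to be moved, since \<open>k p = 0\<close>
  would only leave room for the factor \<open>x (\<tau> p)\<close> if \<open>\<tau> p = i\<close>, but \<open>c\<close> is free of \<open>x i\<close>.\<close>

lemma carries_exchange:
  assumes \<tau>: "one_cycle n \<tau>" and n: "2 \<le> n" and i: "i \<in> {1..n}"
    and L: "\<And>i. i \<in> {1..n} \<Longrightarrow> 0 < L i"
    and pq: "p \<in> {1..n}" "q \<in> {1..n}"
    and k: "carries n \<tau> L i k (d + single (\<tau> p) (L (\<tau> p)) + unit_exp q)"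
  shows "\<exists>k. carries n \<tau> L i k (d + single (\<tau> q) (L (\<tau> q)) + unit_exp p)"
proof (cases "p = q")
  case False
  let ?c = "d + single (\<tau> p) (L (\<tau> p)) + unit_exp q"
  let ?c' = "d + single (\<tau> q) (L (\<tau> q)) + unit_exp p"
  have inj: "inj_on \<tau> {1..n}" using \<tau> by (simp add: one_cycle_def bij_betw_def)
  have eq: "lookup ?c (\<tau> j) + k (\<tau> j) = (if \<tau> j = i then 1 else 0) + L (\<tau> j) * k j"
    if "j \<in> {1..n}" for j
    using k that unfolding carries_def by blast
  have lookup: "lookup (d + single (\<tau> p) (L (\<tau> p)) + unit_exp q) (\<tau> j) =
     lookup d (\<tau> j) + (if j = p then L (\<tau> j) else 0) + (if \<tau> j = q then 1 else 0)"
    if "j \<in> {1..n}" "p \<in> {1..n}" for j p q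
    using inj_onD[OF inj, of j p] that
    by (auto simp: Poly_Mapping.lookup_add lookup_single when_def)
  have kp: "0 < k p"
  proof (rule ccontr)
    assume "\<not> 0 < k p"
    then have "lookup ?c (\<tau> p) + k (\<tau> p) = (if \<tau> p = i then 1 else 0)"
      using eq[OF pq(1)] by simp
    moreover have "0 < lookup ?c (\<tau> p)"
      using lookup[OF pq(1,1)] L[OF one_cycle_in(2)[OF \<tau> pq(1)]] by simp
    ultimately have "\<tau> p = i" "0 < lookup ?c i" by (auto split: if_splits)
    then show False using carries_start(2)[OF \<tau> n i k] by simp
  qed
  define k' where "k' j = (if j = p then k j - 1 else if j = q then k j + 1 else k j)" for j
  have "carries n \<tau> L i k' ?c'"
    unfolding carries_def
  proof (intro conjI ballI)
    have "(\<Sum>j\<in>{1..n}. k' j + (if j = p then 1 else 0)) = (\<Sum>j\<in>{1..n}. k j + (if j = q then 1 else 0))"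
      using kp False by (intro sum.cong) (auto simp: k'_def)
    then show "(\<Sum>j\<in>{1..n}. k' j) = n - 1"
      using k pq by (simp add: sum.distrib carries_def)
  next
    fix j assume j: "j \<in> {1..n}"
    have 1: "k' x + (if x = p then 1 else 0) = k x + (if x = q then 1 else 0)" for x
      using kp False by (auto simp: k'_def)
    have 2: "L (\<tau> j) * k' j + (if j = p then L (\<tau> j) else 0) = L (\<tau> j) * k j + (if j = q then L (\<tau> j) else 0)"
      using arg_cong[OF 1[of j], of "\<lambda>x. L (\<tau> j) * x"] by (simp add: distrib_left if_distrib cong: if_cong)
    show "lookup ?c' (\<tau> j) + k' (\<tau> j) = (if \<tau> j = i then 1 else 0) + L (\<tau> j) * k' j"
      using eq[OF j] 1[of "\<tau> j"] 2 unfolding lookup[OF j pq(1)] lookup[OF j pq(2)] by linarith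
  qed
  then show ?thesis by blast
qed (use k in blast)

context minimal_generators
begin

text \<open>If \<open>(n - 1) \<delta>\<close> were the degree of a monomial \<open>b\<close>, then \<open>b * x i\<close> would have the same degree as
  the monomial obtained from \<open>x i\<close> by going once around the cycle up to the predecessor of \<open>i\<close>. But
  the latter is free of \<open>x i\<close>, and so is every monomial that exchange steps can produce from it.\<close>

lemma top_multiple_notin:
  assumes \<tau>: "one_cycle n \<tau>"
    and L: "\<And>i. i \<in> {1..n} \<Longrightarrow> 0 < L i"
    and relation: "\<And>i. i \<in> {1..n} \<Longrightarrow> \<delta> + int (a i) = int (L (\<tau> i) * a (\<tau> i))"
    and I: "defining_ideal n a \<subseteq>
      I2 n (\<lambda>i. single (single (\<tau> i) (L (\<tau> i))) (\<epsilon> :: 'k::field)) Var"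
  shows "int (n - 1) * \<delta> \<notin> H"
proof
  assume "int (n - 1) * \<delta> \<in> H"
  then obtain b where b: "b \<in> expo n" "int (n - 1) * \<delta> = int (wdeg_mon a b)" by (auto simp: H_iff)
  define i where "i = (1 :: nat)"
  have i: "i \<in> {1..n}" using n3 by (simp add: i_def)
  have n2: "2 \<le> n" using n3 by simp
  obtain j0 where j0: "j0 \<in> {1..n}" "\<tau> j0 = i" using one_cycle_pred[OF \<tau> i] .
  have ne: "j0 \<noteq> i" using one_cycle_no_fixed_point[OF \<tau> i n2] j0 by auto
  have bij: "bij_betw \<tau> {1..n} {1..n}" using \<tau> by (simp add: one_cycle_def)
  have \<tau>_in: "\<And>i. i \<in> {1..n} \<Longrightarrow> \<tau> i \<in> {1..n}" by (rule one_cycle_in(2)[OF \<tau>])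
  have \<tau>_i: "\<tau> j = i \<longleftrightarrow> j = j0" if "j \<in> {1..n}" for j
    using that j0 bij by (metis bij_betw_def inj_onD)
  \<comment> \<open>Each relation is used once, except for the one that leads back to \<open>i\<close>.\<close>
  define k where "k j = (if j = j0 then 0 else 1 :: nat)" for j
  define c where "c x = (if x = i then 0 else if x = j0 then L x else L x - 1)" for x
  obtain M where M: "M \<in> expo n" "\<And>x. x \<in> {1..n} \<Longrightarrow> lookup M x = c x"
    using exponent_vector_exists[of n c] by blast
  have carry: "lookup M (\<tau> j) + k (\<tau> j) = (if \<tau> j = i then 1 else 0) + L (\<tau> j) * k j"
    if j: "j \<in> {1..n}" for j
    using \<tau>_i[OF j] ne L[OF \<tau>_in[OF j]] by (auto simp: M(2)[OF \<tau>_in[OF j]] c_def k_def)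
  have "(\<Sum>j\<in>{1..n}. k j) = (\<Sum>j\<in>{1..n} - {j0}. 1)"
    unfolding k_def by (intro sum.mono_neutral_cong_right) auto
  then have sum_k: "(\<Sum>j\<in>{1..n}. k j) = n - 1" using j0 by simp
  have M_carries: "carries n \<tau> L i k M"
    unfolding carries_def using sum_k carry by blast
  have "int (wdeg_mon a M) + (\<Sum>x\<in>{1..n}. int (k x) * int (a x)) =
      (\<Sum>x\<in>{1..n}. (int (lookup M x) + int (k x)) * int (a x))"
    by (simp add: wdeg_mon_expo[OF M(1)] sum.distrib distrib_right)
  also have "\<dots> = (\<Sum>j\<in>{1..n}. (int (lookup M (\<tau> j)) + int (k (\<tau> j))) * int (a (\<tau> j)))"
    by (rule sum.reindex_bij_betw[OF bij, symmetric])
  also have "\<dots> = (\<Sum>j\<in>{1..n}. (if j = j0 then int (a i) else 0) + int (k j) * (\<delta> + int (a j)))"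
  proof (rule sum.cong)
    fix j assume j: "j \<in> {1..n}"
    have "int (lookup M (\<tau> j)) + int (k (\<tau> j)) = (if j = j0 then 1 else 0) + int (L (\<tau> j)) * int (k j)"
      using arg_cong[OF carry[OF j], of int] \<tau>_i[OF j] by simp
    then show "(int (lookup M (\<tau> j)) + int (k (\<tau> j))) * int (a (\<tau> j)) =
        (if j = j0 then int (a i) else 0) + int (k j) * (\<delta> + int (a j))"
      unfolding relation[OF j] using j0 by (simp add: algebra_simps)
  qed simp
  also have "\<dots> = int (a i) + int (\<Sum>j\<in>{1..n}. k j) * \<delta> + (\<Sum>x\<in>{1..n}. int (k x) * int (a x))"
    using j0 by (simp add: sum.distrib distrib_left sum_distrib_right)
  finally have deg_M: "int (wdeg_mon a M) = int (a i) + int (n - 1) * \<delta>"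
    unfolding sum_k by simp
  have "\<exists>k. carries n \<tau> L i k (b + unit_exp i)"
  proof (rule exchange_invariant[OF _ I, where P = "\<lambda>c. \<exists>k. carries n \<tau> L i k c" and u = M])
    show "wdeg_mon a M = wdeg_mon a (b + unit_exp i)"
    proof -
      have "int (wdeg_mon a M) = int (wdeg_mon a (b + unit_exp i))" using deg_M b(2) by simp
      then show ?thesis by (simp only: of_nat_eq_iff)
    qed
    show "\<exists>k. carries n \<tau> L i k M" using M_carries by blast
  next
    fix d p q
    assume "p \<in> {1..n}" "q \<in> {1..n}"
      and "\<exists>k. carries n \<tau> L i k (d + single (\<tau> p) (L (\<tau> p)) + unit_exp q)"
    then show "\<exists>k. carries n \<tau> L i k (d + single (\<tau> q) (L (\<tau> q)) + unit_exp p)"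
      by (elim exE) (rule carries_exchange[OF \<tau> n2 i L])
  qed (use M b i \<tau>_in in \<open>auto simp: expo_add expo_single\<close>)
  then have "lookup (b + unit_exp i) i = 0"
    using carries_start(2)[OF \<tau> n2 i] by blast
  then show False by (simp add: Poly_Mapping.lookup_add)
qed

section \<open>From a determinantal presentation to a pseudo-Frobenius number\<close>

text \<open>Comparing degrees and coefficients of the images of the minors in \<open>k[t]\<close> shows that \<open>f i\<close> is
  mapped to \<open>\<epsilon> t\<^bsup>\<delta> + a i\<^esup>\<close> with \<open>\<epsilon>\<close> and \<open>\<delta>\<close> independent of \<open>i\<close>; here \<open>\<epsilon> \<noteq> 0\<close>, and then \<open>\<delta> \<notin> H\<close>,
  since otherwise the first row could be replaced by a multiple of the second. Finally each \<open>f i\<close> is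
  replaced by one of its monomials.\<close>

lemma PF_of_presentation:
  fixes f :: "nat \<Rightarrow> ('k::field) mpoly"
  assumes f: "generic_presentation n a (defining_ideal n a) f"
  obtains \<delta> where "\<delta> \<in> PF n a" "int (n - 1) * \<delta> \<notin> H"
    "\<And>i. i \<in> {1..n} \<Longrightarrow> f i \<noteq> 0 \<and> (\<forall>u\<in>keys (f i). int (wdeg_mon a u) = \<delta> + int (a i))"
proof -
  have fc: "f i \<in> carrier (poly_ring n)" if "i \<in> {1..n}" for i
    by (rule subsetD[OF irrelevant_ideal_subset]) (use f that in \<open>simp add: generic_presentation_def\<close>)
  have I: "defining_ideal n a = I2 n f Var" using f by (simp add: generic_presentation_def)
  have "\<exists>d. \<forall>u\<in>keys (f i). wdeg_mon a u = d" if "i \<in> {1..n}" for i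
    using f that by (auto simp: generic_presentation_def homogeneous_def)
  then obtain d where d: "\<And>i u. i \<in> {1..n} \<Longrightarrow> u \<in> keys (f i) \<Longrightarrow> wdeg_mon a u = d i"
    by metis
  define \<epsilon> where "\<epsilon> i = (\<Sum>u\<in>keys (f i). lookup (f i) u)" for i
  have phi_f: "phi a (f i) = monom (\<epsilon> i) (d i)" if "i \<in> {1..n}" for i
  proof -
    have "phi a (f i) = (\<Sum>u\<in>keys (f i). monom (lookup (f i) u) (d i))"
      unfolding phi_eq_sum_monom using d[OF that] by (intro sum.cong) auto
    also have "\<dots> = monom (\<epsilon> i) (d i)"
      by (rule poly_eqI) (simp add: coeff_sum coeff_monom \<epsilon>_def)
    finally show ?thesis .
  qed
  have minors: "monom (\<epsilon> i) (d i + a j) = monom (\<epsilon> j) (d j + a i)" if ij: "i \<in> {1..n}" "j \<in> {1..n}" for i j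
  proof -
    have "f i * Var j - f j * Var i \<in> defining_ideal n a"
      unfolding I by (rule I2_minor[OF fc Var_in_poly_ring ij])
    then have "phi a (f i) * phi a (Var j) = phi a (f j) * phi a (Var i)"
      by (simp add: defining_ideal_def phi_minus phi_mult)
    then show ?thesis unfolding phi_f[OF ij(1)] phi_f[OF ij(2)] phi_Var by (simp add: mult_monom)
  qed
  have replace: "defining_ideal n a \<subseteq> I2 n (\<lambda>i. single (m i) c) Var"
    if "\<And>i. i \<in> {1..n} \<Longrightarrow> m i \<in> expo n"
      "\<And>i j. i \<in> {1..n} \<Longrightarrow> j \<in> {1..n} \<Longrightarrow> wdeg_mon a (m i) + a j = wdeg_mon a (m j) + a i"
      "\<And>i. i \<in> {1..n} \<Longrightarrow> monom (\<epsilon> i) (d i) = monom c (wdeg_mon a (m i))" for m c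
  proof (rule replace_first_row[OF fc])
    fix i assume i: "i \<in> {1..n}"
    show "f i - single (m i) c \<in> defining_ideal n a"
      unfolding defining_ideal_def
      using i that by (auto simp: phi_minus phi_monomial phi_f intro!: poly_ring_closed fc single_in_poly_ring)
  qed (use I that in auto)
  have nonzero: "\<epsilon> i \<noteq> 0" if i: "i \<in> {1..n}" for i
  proof
    assume "\<epsilon> i = 0"
    then have "\<epsilon> j = 0" if "j \<in> {1..n}" for j using minors[OF i that] by simp
    then have "defining_ideal n a \<subseteq> I2 n (\<lambda>i. single (0 + unit_exp i) (0 :: 'k)) Var"
      by (intro replace) (auto simp: expo_add expo_single)
    then show False using first_row_not_multiple[OF expo_zero] by blast
  qed
  have one: "1 \<in> {1..n}" using n3 by simp
  define \<delta> where "\<delta> = int (d 1) - int (a 1)"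
  have eq: "\<epsilon> i = \<epsilon> 1 \<and> int (d i) = \<delta> + int (a i)" if i: "i \<in> {1..n}" for i
  proof -
    have "\<epsilon> i = \<epsilon> 1 \<and> d i + a 1 = d 1 + a i"
      using minors[OF i one] nonzero[OF i] by (metis coeff_monom)
    then show ?thesis unfolding \<delta>_def by linarith
  qed
  have \<epsilon>_eq: "monom (\<epsilon> i) (d i) = monom (\<epsilon> 1) (wdeg_mon a u)"
    if "i \<in> {1..n}" "int (wdeg_mon a u) = \<delta> + int (a i)" for i u
  proof -
    have "d i = wdeg_mon a u" using eq[OF that(1)] that(2) by linarith
    then show ?thesis using eq[OF that(1)] by simp
  qed
  have f_nz: "f i \<noteq> 0" if "i \<in> {1..n}" for i
    using nonzero[OF that] by (auto simp: \<epsilon>_def)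
  then have "\<exists>u. u \<in> keys (f i)" if "i \<in> {1..n}" for i
    using that by (metis all_not_in_conv keys_eq_empty)
  then obtain m where mk: "\<And>i. i \<in> {1..n} \<Longrightarrow> m i \<in> keys (f i)" by metis
  have m: "m i \<in> expo n" "int (wdeg_mon a (m i)) = \<delta> + int (a i)" if "i \<in> {1..n}" for i
    using mk[OF that] fc[OF that] d[OF that] eq[OF that] by (auto simp: poly_ring_carrier)
  have \<delta>_notin: "\<delta> \<notin> H"
  proof
    assume "\<delta> \<in> H"
    then obtain g where g: "g \<in> expo n" "\<delta> = int (wdeg_mon a g)" by (auto simp: H_iff)
    have "defining_ideal n a \<subseteq> I2 n (\<lambda>i. single (g + unit_exp i) (\<epsilon> 1)) Var"
      using g by (intro replace \<epsilon>_eq) (auto simp: expo_add expo_single)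
    then show False using first_row_not_multiple[OF g(1)] by blast
  qed
  have PF: "\<delta> \<in> PF n a"
    unfolding PF_iff using \<delta>_notin m H_iff by metis
  have I_m: "defining_ideal n a \<subseteq> I2 n (\<lambda>i. single (m i) (\<epsilon> 1)) Var"
  proof (intro replace \<epsilon>_eq m)
    fix i j assume "i \<in> {1..n}" "j \<in> {1..n}"
    then show "wdeg_mon a (m i) + a j = wdeg_mon a (m j) + a i" using m[of i] m[of j] by linarith
  qed
  have m_nz: "m i \<noteq> 0" if "i \<in> {1..n}" for i
    using m(2)[OF that] PF_pos[OF PF] by force
  \<comment> \<open>Different variables have their powers at different places of the first row, so all entries are
    powers of variables.\<close>
  obtain \<pi> L where \<pi>: "\<And>j. j \<in> {1..n} \<Longrightarrow> \<pi> j \<in> {1..n} \<and> 0 < L j \<and> m (\<pi> j) = single j (L j)"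
    using pure_power_exists[OF m(1) m_nz I_m] by metis
  have inj: "inj_on \<pi> {1..n}"
  proof (rule inj_onI)
    fix x y assume xy: "x \<in> {1..n}" "y \<in> {1..n}" "\<pi> x = \<pi> y"
    then have "single x (L x) = single y (L y)" using \<pi> by metis
    then have "lookup (single x (L x)) x = lookup (single y (L y)) x"
      by simp
    moreover have "0 < L x" using \<pi>[OF xy(1)] by blast
    ultimately show "x = y" by (cases "x = y") (simp_all add: lookup_single when_def)
  qed
  then have im: "\<pi> ` {1..n} = {1..n}" using endo_inj_surj[of "{1..n}" \<pi>] \<pi> by blast
  define \<tau> where "\<tau> = inv_into {1..n} \<pi>"
  have bij: "bij_betw \<tau> {1..n} {1..n}"
    unfolding \<tau>_def using inj im bij_betw_inv_into[of \<pi> "{1..n}" "{1..n}"] by (simp add: bij_betw_def)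
  have m_\<tau>: "m i = single (\<tau> i) (L (\<tau> i))" if "i \<in> {1..n}" for i
  proof -
    have "i \<in> \<pi> ` {1..n}" using that by (simp only: im)
    then have "\<tau> i \<in> {1..n}" "\<pi> (\<tau> i) = i"
      unfolding \<tau>_def by (rule inv_into_into, rule f_inv_into_f)
    then show ?thesis using \<pi>[of "\<tau> i"] by simp
  qed
  have "I2 n (\<lambda>i. single (m i) (\<epsilon> 1)) Var =
    I2 n (\<lambda>i. single (single (\<tau> i) (L (\<tau> i))) (\<epsilon> 1)) Var"
    by (rule I2_cong) (simp_all add: m_\<tau>)
  then have I_\<tau>: "defining_ideal n a \<subseteq>
      I2 n (\<lambda>i. single (single (\<tau> i) (L (\<tau> i))) (\<epsilon> 1)) Var"
    using I_m by simp
  have L: "0 < L i" if "i \<in> {1..n}" for i using \<pi>[OF that] by simp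
  have "int (n - 1) * \<delta> \<notin> H"
  proof (rule top_multiple_notin[OF permutation_is_one_cycle[OF bij L I_\<tau>] L _ I_\<tau>])
    fix i assume i: "i \<in> {1..n}"
    show "\<delta> + int (a i) = int (L (\<tau> i) * a (\<tau> i))"
      using m(2)[OF i] by (simp add: m_\<tau>[OF i])
  qed
  then show thesis
    using that[OF PF] f_nz d eq by metis
qed

end

section \<open>Pseudo-Frobenius numbers and almost symmetry\<close>

lemma Gcd_integer_combination:
  assumes "finite A"
  shows "\<exists>c :: 'x \<Rightarrow> int. (\<Sum>i\<in>A. c i * int (a i)) = int (Gcd (a ` A))"
  using assms
proof (induction A rule: finite_induct)
  case (insert x A)
  then obtain c where c: "(\<Sum>i\<in>A. c i * int (a i)) = int (Gcd (a ` A))" by blast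
  obtain u v where uv: "u * int (a x) + v * int (Gcd (a ` A)) = gcd (int (a x)) (int (Gcd (a ` A)))"
    using bezout_int by blast
  have "(\<Sum>i\<in>insert x A. (if i = x then u else v * c i) * int (a i)) =
      u * int (a x) + (\<Sum>i\<in>A. v * c i * int (a i))"
  proof -
    have "(\<Sum>i\<in>A. (if i = x then u else v * c i) * int (a i)) = (\<Sum>i\<in>A. v * c i * int (a i))"
      using insert.hyps by (intro sum.cong refl) auto
    then show ?thesis using insert.hyps by simp
  qed
  also have "(\<Sum>i\<in>A. v * c i * int (a i)) = v * int (Gcd (a ` A))"
    by (simp add: c[symmetric] sum_distrib_left mult.assoc)
  finally have "(\<Sum>i\<in>insert x A. (if i = x then u else v * c i) * int (a i)) = int (Gcd (a ` insert x A))"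
    using uv by simp
  then show ?case by (intro exI[of _ "\<lambda>i. if i = x then u else v * c i"])
qed simp

context cyclic_relations
begin

abbreviation f_top :: int where "f_top \<equiv> int (n - 1) * \<alpha>"

lemma reduce_to_small:
  assumes "u \<in> expo n"
  obtains k s where "small s" "int (wdeg_mon a u) = int k * \<alpha> + int (wdeg_mon a s)"
proof -
  have "\<exists>k s. small s \<and> int (wdeg_mon a u) = int k * \<alpha> + int (wdeg_mon a s)"
    using assms
  proof (induction "wdeg_mon a u" arbitrary: u rule: less_induct)
    case less
    show ?case
    proof (cases "small u")
      case True
      then show ?thesis by (intro exI[of _ 0] exI[of _ u]) simp
    next
      case False
      obtain w p where w: "p \<in> {1..n}" "w \<in> expo n"
        "int (wdeg_mon a u) = \<alpha> + int (wdeg_mon a (w + unit_exp p))"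
        using not_smallE[OF less.prems False] by blast
      have "wdeg_mon a (w + unit_exp p) < wdeg_mon a u" using w(3) \<alpha>_pos by linarith
      moreover have "w + unit_exp p \<in> expo n" using w by (simp add: expo_add expo_single)
      ultimately obtain k s where ks: "small s"
        "int (wdeg_mon a (w + unit_exp p)) = int k * \<alpha> + int (wdeg_mon a s)"
        using less.hyps by blast
      then have "int (wdeg_mon a u) = int (Suc k) * \<alpha> + int (wdeg_mon a s)"
        using w(3) by (simp add: algebra_simps)
      then show ?thesis using ks(1) by blast
    qed
  qed
  then show thesis using that by blast
qed

text \<open>A representation of \<open>z\<close> as an integer combination of the generators becomes nonnegative by adding
  \<open>\<alpha> N\<close> to all coefficients, which adds a multiple of \<open>\<alpha>\<close> to \<open>z\<close>.\<close>

lemma shift_into_H: "\<exists>N :: nat. z + int N * \<alpha> \<in> H"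
proof -
  obtain c :: "nat \<Rightarrow> int" where c: "(\<Sum>i\<in>{1..n}. c i * int (a i)) = 1"
    using Gcd_integer_combination[of "{1..n}" a] gcd1 by auto
  define N where "N = (\<Sum>i\<in>{1..n}. nat \<bar>z * c i\<bar>)"
  have nonneg: "0 \<le> z * c i + \<alpha> * int N" if i: "i \<in> {1..n}" for i
  proof -
    have "nat \<bar>z * c i\<bar> \<le> N" unfolding N_def by (rule member_le_sum[OF i]) auto
    then have "\<bar>z * c i\<bar> \<le> int N" by simp
    also have "\<dots> \<le> \<alpha> * int N" using \<alpha>_pos mult_right_mono[of 1 \<alpha> "int N"] by simp
    finally show ?thesis by linarith
  qed
  have "z + int (N * (\<Sum>i\<in>{1..n}. a i)) * \<alpha> =
      (\<Sum>i\<in>{1..n}. z * (c i * int (a i)) + \<alpha> * int N * int (a i))"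
    by (simp add: sum.distrib sum_distrib_left[symmetric] c algebra_simps)
  also have "\<dots> = (\<Sum>i\<in>{1..n}. (z * c i + \<alpha> * int N) * int (a i))"
    by (simp add: algebra_simps)
  also have "\<dots> = int (\<Sum>i\<in>{1..n}. nat (z * c i + \<alpha> * int N) * a i)"
    unfolding of_nat_sum by (intro sum.cong refl) (use nonneg in simp)
  finally have "z + int (N * (\<Sum>i\<in>{1..n}. a i)) * \<alpha> \<in> H"
    unfolding sgrp_def by (intro CollectI exI conjI TrueI)
  then show ?thesis by blast
qed

text \<open>The largest small monomial, with all exponents equal to \<open>L i - 1\<close>, has degree \<open>n \<alpha>\<close>, and every
  small monomial divides it.\<close>

lemma small_complement:
  assumes "small s"
  obtains s' where "small s'" "int (wdeg_mon a s) + int (wdeg_mon a s') = int n * \<alpha>"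
proof -
  obtain s' where s': "s' \<in> expo n"
    "\<And>i. i \<in> {1..n} \<Longrightarrow> lookup s' i = L i - 1 - lookup s i"
    using exponent_vector_exists[of n "\<lambda>i. L i - 1 - lookup s i"] by blast
  have lt: "lookup s i < L i" if "i \<in> {1..n}" for i using assms that by (simp add: small_def)
  have "int (wdeg_mon a s) + int (wdeg_mon a s') =
      (\<Sum>i\<in>{1..n}. (int (lookup s i) + int (lookup s' i)) * int (a i))"
    by (simp add: wdeg_mon_expo[OF s'(1)] wdeg_mon_expo[OF smallD[OF assms]] sum.distrib distrib_right)
  also have "\<dots> = int n * \<alpha>"
    unfolding n_times_\<alpha>
  proof (intro sum.cong refl)
    fix i assume i: "i \<in> {1..n}"
    have "int (lookup s i) + int (lookup s' i) = int (L i) - 1"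
      using lt[OF i] s'(2)[OF i] by linarith
    then show "(int (lookup s i) + int (lookup s' i)) * int (a i) = (int (L i) - 1) * int (a i)"
      by simp
  qed
  finally have "int (wdeg_mon a s) + int (wdeg_mon a s') = int n * \<alpha>" .
  moreover have "small s'"
    unfolding small_def
  proof (intro conjI ballI s'(1))
    show "lookup s' i < L i" if "i \<in> {1..n}" for i
      using s'(2)[OF that] lt[OF that] by linarith
  qed
  ultimately show thesis using that by blast
qed

text \<open>Write \<open>z = k \<alpha> + s\<close> with \<open>s\<close> the degree of a small monomial other than the maximal one. If
  \<open>k \<ge> 0\<close> then \<open>z \<in> H\<close>, unless \<open>s = 0\<close> and \<open>0 < k < n\<close>. If \<open>k < 0\<close>,
  the complementary small monomial shows that \<open>(n - 1) \<alpha> - z \<in> H\<close>.\<close>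

lemma gap_dichotomy:
  assumes "z \<notin> H"
  shows "(\<exists>j\<in>{1..n - 1}. z = int j * \<alpha>) \<or> f_top - z \<in> H"
proof -
  obtain N where "z + int N * \<alpha> \<in> H" using shift_into_H by blast
  then obtain u where u: "u \<in> expo n" "z + int N * \<alpha> = int (wdeg_mon a u)" by (auto simp: H_iff)
  obtain k s where s: "small s" "int (wdeg_mon a u) = int k * \<alpha> + int (wdeg_mon a s)"
    using reduce_to_small[OF u(1)] .
  obtain s' where s': "small s'" "int (wdeg_mon a s) + int (wdeg_mon a s') = int n * \<alpha>"
    using small_complement[OF s(1)] .
  have z: "z = (int k - int N) * \<alpha> + int (wdeg_mon a s)" using u(2) s(2) by (simp add: algebra_simps)
  have "\<exists>k s s'. small s \<and> small s' \<and> wdeg_mon a s' \<noteq> 0 \<and> z = k * \<alpha> + int (wdeg_mon a s) \<and>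
      int (wdeg_mon a s) + int (wdeg_mon a s') = int n * \<alpha>"
  proof (cases "wdeg_mon a s' = 0")
    case False
    then show ?thesis using s s' z by blast
  next
    case True
    have "z = (int k - int N + int n) * \<alpha> + int (wdeg_mon a s')"
      using z s'(2) True by (simp add: algebra_simps)
    moreover have "wdeg_mon a s \<noteq> 0"
    proof
      assume "wdeg_mon a s = 0"
      then have "int n * \<alpha> = 0" using True s'(2) by simp
      then show False using \<alpha>_pos n3 by simp
    qed
    ultimately show ?thesis using s s' by (metis add.commute)
  qed
  then obtain k s s' where r: "small s" "small s'" "wdeg_mon a s' \<noteq> 0" "z = k * \<alpha> + int (wdeg_mon a s)"
    "int (wdeg_mon a s) + int (wdeg_mon a s') = int n * \<alpha>" by blast
  have sH: "int (wdeg_mon a s) \<in> H" "int (wdeg_mon a s') \<in> H"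
    using smallD r(1,2) by (auto simp: H_iff)
  show ?thesis
  proof (cases "0 \<le> k")
    case True
    have s0: "wdeg_mon a s = 0"
    proof (rule ccontr)
      assume "wdeg_mon a s \<noteq> 0"
      then have "int (nat k) * \<alpha> + int (wdeg_mon a s) \<in> H"
        using sH by (intro PF_shift_multiple[OF \<alpha>_PF]) auto
      then show False using assms r(4) True by simp
    qed
    have "k \<noteq> 0" using assms s0 r(4) by auto
    moreover have "k < int n"
    proof (rule ccontr)
      assume "\<not> k < int n"
      moreover have "int n * \<alpha> \<in> H" using s0 r(5) sH by simp
      ultimately have "int (nat k - n) * \<alpha> + int n * \<alpha> \<in> H"
        using \<alpha>_pos n3 by (intro PF_shift_multiple[OF \<alpha>_PF]) auto
      moreover have "int (nat k - n) * \<alpha> + int n * \<alpha> = z"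
        using \<open>\<not> k < int n\<close> s0 r(4) by (simp add: of_nat_diff algebra_simps)
      ultimately show False using assms by simp
    qed
    ultimately have "nat k \<in> {1..n - 1}" "z = int (nat k) * \<alpha>" using True s0 r(4) by auto
    then show ?thesis by blast
  next
    case False
    have "int (nat (- 1 - k)) * \<alpha> + int (wdeg_mon a s') \<in> H"
      using sH r(3) by (intro PF_shift_multiple[OF \<alpha>_PF]) auto
    moreover have "int (nat (- 1 - k)) * \<alpha> + int (wdeg_mon a s') = f_top - z"
      using False r(4,5) n3 by (simp add: of_nat_diff algebra_simps)
    ultimately show ?thesis by simp
  qed
qed

lemma PF_eq_multiples: "PF n a = (\<lambda>j. int j * \<alpha>) ` {1..n - 1}"
proof (intro subset_antisym subsetI)
  fix \<beta> assume \<beta>: "\<beta> \<in> PF n a"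
  show "\<beta> \<in> (\<lambda>j. int j * \<alpha>) ` {1..n - 1}"
  proof (rule ccontr)
    assume no: "\<not> ?thesis"
    then have "f_top - \<beta> \<in> H" using gap_dichotomy[of \<beta>] \<beta> by (auto simp: PF_iff)
    moreover have "f_top \<in> (\<lambda>j. int j * \<alpha>) ` {1..n - 1}" using n3 by (intro imageI) simp
    then have "f_top - \<beta> \<noteq> 0" using no by (metis eq_iff_diff_eq_0)
    ultimately have "\<beta> + (f_top - \<beta>) \<in> H" by (rule PF_shift[OF \<beta>])
    then show False using \<alpha>_notin by simp
  qed
next
  fix \<beta> assume "\<beta> \<in> (\<lambda>j. int j * \<alpha>) ` {1..n - 1}"
  then obtain j where j: "1 \<le> j" "j < n" "\<beta> = int j * \<alpha>" using n3 by auto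
  then show "\<beta> \<in> PF n a"
    unfolding PF_iff
    using PF_multiple_notin[OF \<alpha>_PF \<alpha>_notin j(1,2)] pos
    by (auto intro!: PF_shift_multiple[OF \<alpha>_PF] H_gen)
qed

lemma frobenius_eq: "frobenius H = f_top"
  unfolding frobenius_def
proof (rule Greatest_equality)
  show "f_top \<notin> H" by (rule \<alpha>_notin)
  fix z assume "z \<notin> H"
  then consider j where "j \<in> {1..n - 1}" "z = int j * \<alpha>" | "f_top - z \<in> H"
    using gap_dichotomy by blast
  then show "z \<le> f_top"
  proof cases
    case 1
    then show ?thesis using \<alpha>_pos by simp
  next
    case 2
    then show ?thesis using H_nonneg by fastforce
  qed
qed

lemma almost_symmetric_cyclic: "almost_symmetric n a"
  unfolding almost_symmetric_def frobenius_eq PF_eq_multiples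
proof (intro exI conjI ballI)
  show "1 \<le> n - 1" using n3 by simp
  show "strict_mono_on {1..n - 1} (\<lambda>j. int j * \<alpha>)"
    using \<alpha>_pos by (auto simp: strict_mono_on_def)
  fix i assume "i \<in> {1..n - 1 - 1}"
  then show "int i * \<alpha> + int (n - 1 - i) * \<alpha> = f_top"
    by (auto simp: of_nat_diff algebra_simps)
qed simp_all

end

section \<open>Graded modules described by coefficients\<close>

text \<open>When elements are determined by finitely many coefficients \<open>co x i\<close>, indexed by degrees, then
  homogeneous components are obtained by restriction to one degree.\<close>

lemma graded_module_by_coefficients:
  fixes M :: "('a, 'b, 'm) module_scheme" and co :: "'b \<Rightarrow> int \<Rightarrow> 'k::field"
  assumes M: "module R M"
    and add: "\<And>x y i. x \<in> carrier M \<Longrightarrow> y \<in> carrier M \<Longrightarrow> co (x \<oplus>\<^bsub>M\<^esub> y) i = co x i + co y i"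
    and inj: "\<And>x y. x \<in> carrier M \<Longrightarrow> y \<in> carrier M \<Longrightarrow> co x = co y \<Longrightarrow> x = y"
    and fin: "\<And>x. x \<in> carrier M \<Longrightarrow> finite {i. co x i \<noteq> 0}"
    and comp: "\<And>x d. x \<in> carrier M \<Longrightarrow> \<exists>y\<in>carrier M. co y = (\<lambda>i. if i = d then co x d else 0)"
    and Mg: "\<And>d. Mg d = {x \<in> carrier M. \<forall>i. co x i \<noteq> 0 \<longrightarrow> i = d}"
    and smult: "\<And>d e r x. r \<in> Rg d \<Longrightarrow> x \<in> Mg e \<Longrightarrow> r \<odot>\<^bsub>M\<^esub> x \<in> Mg (d + e)"
  shows "graded_module R Rg M Mg"
proof -
  interpret M: module R M by (rule M)
  have zero: "co \<zero>\<^bsub>M\<^esub> i = 0" for i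
  proof -
    have "co \<zero>\<^bsub>M\<^esub> i = co \<zero>\<^bsub>M\<^esub> i + co \<zero>\<^bsub>M\<^esub> i"
      using add[of "\<zero>\<^bsub>M\<^esub>" "\<zero>\<^bsub>M\<^esub>" i] M.M.zero_closed M.M.r_zero[OF M.M.zero_closed] by metis
    then show ?thesis by (simp only: add_cancel_right_right)
  qed
  have neg: "co (\<ominus>\<^bsub>M\<^esub> x) i = - co x i" if "x \<in> carrier M" for x i
    using add[of x "\<ominus>\<^bsub>M\<^esub> x" i] that zero[of i] M.M.r_neg[OF that]
    by (simp add: eq_neg_iff_add_eq_0 add.commute)
  have zero_iff: "x = \<zero>\<^bsub>M\<^esub> \<longleftrightarrow> (\<forall>i. co x i = 0)" if "x \<in> carrier M" for x
    using inj[OF that M.M.zero_closed] zero by (metis ext)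
  have finsum: "co (\<Oplus>\<^bsub>M\<^esub>d\<in>A. c d) i = (\<Sum>d\<in>A. co (c d) i)"
    if "finite A" "\<And>d. c d \<in> carrier M" for A c i
    using that(1)
  proof (induction A rule: finite_induct)
    case (insert x A)
    then show ?case using that(2) by (simp add: add M.M.finsum_insert)
  qed (simp add: zero)
  have sub: "additive_subgroup (Mg d) M" for d
  proof (rule additive_subgroupI, rule M.M.add.subgroupI)
    show "Mg d \<subseteq> carrier M" by (auto simp: Mg)
    show "Mg d \<noteq> {}" using zero by (auto simp: Mg)
    show "\<ominus>\<^bsub>M\<^esub> x \<in> Mg d" if "x \<in> Mg d" for x using that by (auto simp: Mg neg)
    show "x \<oplus>\<^bsub>M\<^esub> y \<in> Mg d" if "x \<in> Mg d" "y \<in> Mg d" for x y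
      using that by (auto simp: Mg add) (metis add.right_neutral)
  qed
  have decomposition: "\<exists>!c. (\<forall>d. c d \<in> Mg d) \<and> finite {d. c d \<noteq> \<zero>\<^bsub>M\<^esub>} \<and>
      x = (\<Oplus>\<^bsub>M\<^esub>d\<in>{d. c d \<noteq> \<zero>\<^bsub>M\<^esub>}. c d)" if x: "x \<in> carrier M" for x
  proof -
    obtain c where c: "\<And>d. c d \<in> carrier M" "\<And>d. co (c d) = (\<lambda>i. if i = d then co x d else 0)"
      using comp[OF x] by metis
    have c_Mg: "c d \<in> Mg d" for d using c by (auto simp: Mg)
    have supp: "{d. c d \<noteq> \<zero>\<^bsub>M\<^esub>} = {d. co x d \<noteq> 0}"
      using zero_iff[OF c(1)] by (auto simp: c(2))
    have "x = (\<Oplus>\<^bsub>M\<^esub>d\<in>{d. c d \<noteq> \<zero>\<^bsub>M\<^esub>}. c d)"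
    proof (rule inj[OF x])
      show "(\<Oplus>\<^bsub>M\<^esub>d\<in>{d. c d \<noteq> \<zero>\<^bsub>M\<^esub>}. c d) \<in> carrier M" using c(1) by (intro M.M.finsum_closed) auto
      show "co x = co (\<Oplus>\<^bsub>M\<^esub>d\<in>{d. c d \<noteq> \<zero>\<^bsub>M\<^esub>}. c d)"
        using fin[OF x] by (auto simp: supp finsum c)
    qed
    moreover have "c' = c" if c': "\<forall>d. c' d \<in> Mg d" "finite {d. c' d \<noteq> \<zero>\<^bsub>M\<^esub>}"
      "x = (\<Oplus>\<^bsub>M\<^esub>d\<in>{d. c' d \<noteq> \<zero>\<^bsub>M\<^esub>}. c' d)" for c'
    proof
      fix d
      have carr: "c' e \<in> carrier M" for e using c'(1) by (auto simp: Mg)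
      have other: "co (c' e) i = 0" if "i \<noteq> e" for e i using c'(1) that by (auto simp: Mg)
      have "co x i = (\<Sum>e\<in>{e. c' e \<noteq> \<zero>\<^bsub>M\<^esub>}. co (c' e) i)" for i
        using c'(3) finsum[of "{e. c' e \<noteq> \<zero>\<^bsub>M\<^esub>}" c' i] c'(2) carr by simp
      moreover have "(\<Sum>e\<in>{e. c' e \<noteq> \<zero>\<^bsub>M\<^esub>}. co (c' e) i) =
          (\<Sum>e\<in>{e. c' e \<noteq> \<zero>\<^bsub>M\<^esub>}. if e = i then co (c' i) i else 0)" for i
        using other by (intro sum.cong) auto
      ultimately have "co x i = co (c' i) i" for i
        using c'(2) zero by (cases "c' i = \<zero>\<^bsub>M\<^esub>") auto
      then have "co (c' d) = co (c d)" using other by (auto simp: c(2))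
      then show "c' d = c d" by (rule inj[OF carr c(1)])
    qed
    ultimately show ?thesis using c_Mg fin[OF x] by (intro ex1I[of _ c]) (auto simp: supp)
  qed
  show ?thesis
    unfolding graded_module_def using M sub smult decomposition by blast
qed

section \<open>Laurent series with support in a given set of degrees\<close>

definition finsupp :: "int set \<Rightarrow> ('k::field) fls set" where
  "finsupp X = {x. finite {i. fls_nth x i \<noteq> 0} \<and> {i. fls_nth x i \<noteq> 0} \<subseteq> X}"

lemma finsupp_zero: "0 \<in> finsupp X"
  by (simp add: finsupp_def)

lemma finsupp_add: "x \<in> finsupp X \<Longrightarrow> y \<in> finsupp X \<Longrightarrow> x + y \<in> finsupp X"
proof -
  assume xy: "x \<in> finsupp X" "y \<in> finsupp X"
  have "{i. fls_nth (x + y) i \<noteq> 0} \<subseteq> {i. fls_nth x i \<noteq> 0} \<union> {i. fls_nth y i \<noteq> 0}" by auto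
  then show "x + y \<in> finsupp X"
    using xy unfolding finsupp_def by (auto intro: finite_subset simp del: fls_plus_nth)
qed

lemma finsupp_uminus: "x \<in> finsupp X \<Longrightarrow> - x \<in> finsupp X"
  by (simp add: finsupp_def)

lemma fls_monomial_nth:
  "fls_nth (fls_const c * fls_X_intpow e) i = (if i = e then c else (0 :: 'k::field))"
  unfolding fls_X_intpow_times_conv_shift(2) by auto

lemma finsupp_monomial: "((c :: 'k::field) \<noteq> 0 \<Longrightarrow> e \<in> X) \<Longrightarrow> fls_const c * fls_X_intpow e \<in> finsupp X"
  unfolding finsupp_def by (auto simp: fls_monomial_nth split: if_splits)

lemma finsupp_expansion:
  fixes x :: "('k::field) fls"
  assumes "finite S" "{i. fls_nth x i \<noteq> 0} \<subseteq> S"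
  shows "x = (\<Sum>i\<in>S. fls_const (fls_nth x i) * fls_X_intpow i)"
proof (rule fls_eqI)
  fix j
  show "fls_nth x j = fls_nth (\<Sum>i\<in>S. fls_const (fls_nth x i) * fls_X_intpow i) j"
    using assms unfolding fls_nth_sum fls_monomial_nth by auto
qed

lemma poly_to_fls_nth: "fls_nth (poly_to_fls p) i = (if i < 0 then 0 else coeff p (nat i))"
  by simp

lemma poly_to_fls_monom: "poly_to_fls (monom (c :: 'k::field) m) = fls_const c * fls_X_intpow (int m)"
  by (rule fls_eqI) (auto simp: fls_monomial_nth)

lemma poly_to_fls_mult_nth:
  "fls_nth (poly_to_fls p * x) d = (\<Sum>i\<le>degree p. coeff p i * fls_nth x (d - int i))"
proof -
  have "poly_to_fls p = poly_to_fls (\<Sum>i\<le>degree p. monom (coeff p i) i)"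
    by (simp add: poly_as_sum_of_monoms)
  also have "\<dots> = (\<Sum>i\<le>degree p. poly_to_fls (monom (coeff p i) i))"
  proof -
    have "poly_to_fls (\<Sum>i\<in>A. q i) = (\<Sum>i\<in>A. poly_to_fls (q i))" if "finite A" for A and q :: "nat \<Rightarrow> 'a poly"
      using that by (induction A rule: finite_induct) (simp_all add: fps_of_poly_add)
    then show ?thesis by simp
  qed
  finally have "poly_to_fls p * x = (\<Sum>i\<le>degree p. fls_const (coeff p i) * (fls_X_intpow (int i) * x))"
    by (simp add: poly_to_fls_monom sum_distrib_right mult.assoc)
  then show ?thesis
    by (simp add: fls_nth_sum fls_X_intpow_times_conv_shift)
qed

section \<open>The semigroup ring and its canonical module\<close>

context minimal_generators
begin

lemma semigroup_ring_simps:
  "p \<oplus>\<^bsub>semigroup_ring n a\<^esub> q = p + q" "p \<otimes>\<^bsub>semigroup_ring n a\<^esub> q = p * q"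
  "\<zero>\<^bsub>semigroup_ring n a\<^esub> = 0" "\<one>\<^bsub>semigroup_ring n a\<^esub> = 1"
  by (simp_all add: semigroup_ring_def)

lemma semigroup_ring_closed:
  fixes p q :: "('k::field) poly"
  shows semigroup_ring_zero: "0 \<in> carrier (semigroup_ring n a :: 'k poly ring)"
    and semigroup_ring_one: "1 \<in> carrier (semigroup_ring n a :: 'k poly ring)"
    and semigroup_ring_add: "p \<in> carrier (semigroup_ring n a) \<Longrightarrow> q \<in> carrier (semigroup_ring n a) \<Longrightarrow>
      p + q \<in> carrier (semigroup_ring n a)"
    and semigroup_ring_mult: "p \<in> carrier (semigroup_ring n a) \<Longrightarrow> q \<in> carrier (semigroup_ring n a) \<Longrightarrow>
      p * q \<in> carrier (semigroup_ring n a)"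
    and semigroup_ring_uminus: "p \<in> carrier (semigroup_ring n a) \<Longrightarrow> - p \<in> carrier (semigroup_ring n a)"
proof -
  have "phi a (0 :: 'k mpoly) = 0" "phi a (single 0 1 :: 'k mpoly) = 1"
    by (simp only: phi_zero, simp only: phi_const pCons_one)
  moreover have "0 \<in> carrier (poly_ring n :: 'k mpoly ring)"
    "single 0 1 \<in> carrier (poly_ring n :: 'k mpoly ring)"
    by (auto simp: poly_ring_carrier)
  ultimately show "0 \<in> carrier (semigroup_ring n a :: 'k poly ring)"
    "1 \<in> carrier (semigroup_ring n a :: 'k poly ring)"
    by (auto simp: semigroup_ring_def intro: image_eqI[rotated])
  show "p \<in> carrier (semigroup_ring n a) \<Longrightarrow> q \<in> carrier (semigroup_ring n a) \<Longrightarrow>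
      p + q \<in> carrier (semigroup_ring n a)"
    by (auto simp: semigroup_ring_def phi_add[symmetric] intro: poly_ring_closed)
  show "p \<in> carrier (semigroup_ring n a) \<Longrightarrow> q \<in> carrier (semigroup_ring n a) \<Longrightarrow>
      p * q \<in> carrier (semigroup_ring n a)"
    by (auto simp: semigroup_ring_def phi_mult[symmetric] intro: poly_ring_closed)
  show "p \<in> carrier (semigroup_ring n a) \<Longrightarrow> - p \<in> carrier (semigroup_ring n a)"
    by (auto simp: semigroup_ring_def phi_uminus[symmetric] intro: poly_ring_closed(3))
qed

lemma semigroup_ring_carrier:
  "p \<in> carrier (semigroup_ring n a :: ('k::field) poly ring) \<longleftrightarrow> (\<forall>i. coeff p i \<noteq> 0 \<longrightarrow> int i \<in> H)"
proof
  assume "p \<in> carrier (semigroup_ring n a :: 'k poly ring)"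
  then obtain q :: "'k mpoly" where q: "q \<in> carrier (poly_ring n)" "p = phi a q"
    by (auto simp: semigroup_ring_def)
  show "\<forall>i. coeff p i \<noteq> 0 \<longrightarrow> int i \<in> H"
  proof (intro allI impI)
    fix i assume "coeff p i \<noteq> 0"
    then have "(\<Sum>u\<in>keys q. if wdeg_mon a u = i then lookup q u else 0) \<noteq> 0"
      by (simp add: q(2) coeff_phi)
    then obtain u where "u \<in> keys q" "(if wdeg_mon a u = i then lookup q u else 0) \<noteq> 0"
      by (rule sum.not_neutral_contains_not_neutral)
    then show "int i \<in> H" using q(1) by (auto simp: H_iff poly_ring_carrier split: if_splits)
  qed
next
  assume *: "\<forall>i. coeff p i \<noteq> 0 \<longrightarrow> int i \<in> H"
  have monomial: "monom (coeff p i) i \<in> carrier (semigroup_ring n a :: 'k poly ring)" for i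
  proof (cases "coeff p i = 0")
    case False
    then obtain u where u: "u \<in> expo n" "i = wdeg_mon a u" using * by (auto simp: H_iff)
    then have "monom (coeff p i) i = phi a (single u (coeff p i))" by (simp add: phi_monomial)
    then show ?thesis
      unfolding semigroup_ring_def by (auto intro: single_in_poly_ring u)
  qed (simp add: semigroup_ring_zero)
  have "(\<Sum>i\<in>A. monom (coeff p i) i) \<in> carrier (semigroup_ring n a :: 'k poly ring)" if "finite A" for A
    using that by (induction A rule: finite_induct) (auto intro: semigroup_ring_zero semigroup_ring_add monomial)
  from this[of "{..degree p}"] show "p \<in> carrier (semigroup_ring n a :: 'k poly ring)"
    by (simp add: poly_as_sum_of_monoms)
qed

lemma cring_semigroup_ring: "cring (semigroup_ring n a :: ('k::field) poly ring)"
proof (rule cringI)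
  show "abelian_group (semigroup_ring n a :: 'k poly ring)"
  proof (rule abelian_groupI)
    show "\<exists>y\<in>carrier (semigroup_ring n a). y \<oplus>\<^bsub>semigroup_ring n a\<^esub> x = \<zero>\<^bsub>semigroup_ring n a\<^esub>"
      if "x \<in> carrier (semigroup_ring n a)" for x :: "'k poly"
      using semigroup_ring_uminus[OF that] by (intro bexI[of _ "- x"]) (simp_all add: semigroup_ring_simps)
  qed (simp_all add: semigroup_ring_simps semigroup_ring_closed add.assoc add.commute)
  show "comm_monoid (semigroup_ring n a :: 'k poly ring)"
    by (rule comm_monoidI) (simp_all add: semigroup_ring_simps semigroup_ring_closed mult.assoc mult.commute)
qed (simp add: semigroup_ring_simps distrib_right)

lemma max_ideal_constant_term:
  assumes "r \<in> max_ideal n a"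
  shows "coeff (r :: ('k::field) poly) 0 = 0"
proof -
  interpret R: cring "semigroup_ring n a :: 'k poly ring" by (rule cring_semigroup_ring)
  define X :: "'k poly set" where "X = {p \<in> carrier (semigroup_ring n a). coeff p 0 = 0}"
  have "ideal X (semigroup_ring n a)"
  proof (rule idealI)
    show "ring (semigroup_ring n a :: 'k poly ring)" by (rule R.ring_axioms)
    show "subgroup X (add_monoid (semigroup_ring n a))"
    proof (rule R.add.subgroupI)
      show "X \<subseteq> carrier (semigroup_ring n a)" by (auto simp: X_def)
      show "X \<noteq> {}" using semigroup_ring_zero by (auto simp: X_def)
      fix x assume x: "x \<in> X"
      then have "\<ominus>\<^bsub>semigroup_ring n a\<^esub> x = - x"
        by (intro R.minus_equality) (auto simp: X_def semigroup_ring_simps intro: semigroup_ring_uminus)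
      then show "\<ominus>\<^bsub>semigroup_ring n a\<^esub> x \<in> X" using x by (auto simp: X_def intro: semigroup_ring_uminus)
    next
      fix x y assume "x \<in> X" "y \<in> X"
      then show "x \<oplus>\<^bsub>semigroup_ring n a\<^esub> y \<in> X"
        by (auto simp: X_def semigroup_ring_simps intro: semigroup_ring_add)
    qed
  next
    fix x r :: "'k poly" assume "x \<in> X" "r \<in> carrier (semigroup_ring n a)"
    then show "r \<otimes>\<^bsub>semigroup_ring n a\<^esub> x \<in> X" "x \<otimes>\<^bsub>semigroup_ring n a\<^esub> r \<in> X"
      by (auto simp: X_def semigroup_ring_simps coeff_mult_0 intro: semigroup_ring_mult)
  qed
  moreover have "(\<lambda>i. monom 1 (a i)) ` {1..n} \<subseteq> X"
  proof (intro image_subsetI)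
    fix i assume i: "i \<in> {1..n}"
    then have "0 < a i" using pos by blast
    then show "monom 1 (a i) \<in> X"
      using H_gen[OF i] by (auto simp: X_def semigroup_ring_carrier coeff_monom)
  qed
  ultimately have "max_ideal n a \<subseteq> X" unfolding max_ideal_def by (rule R.genideal_minimal)
  then show ?thesis using assms by (auto simp: X_def)
qed

lemma finsupp_poly_mult:
  fixes x :: "('k::field) fls"
  assumes r: "r \<in> carrier (semigroup_ring n a)" and x: "x \<in> finsupp X"
    and X: "\<And>h e. h \<in> H \<Longrightarrow> e \<in> X \<Longrightarrow> h + e \<in> X"
  shows "poly_to_fls r * x \<in> finsupp X"
proof -
  have nz: "\<exists>i\<le>degree r. coeff r i \<noteq> 0 \<and> fls_nth x (d - int i) \<noteq> 0" if "fls_nth (poly_to_fls r * x) d \<noteq> 0" for d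
    using that unfolding poly_to_fls_mult_nth
    by (metis (no_types, lifting) atMost_iff mult_eq_0_iff sum.neutral)
  have "{d. fls_nth (poly_to_fls r * x) d \<noteq> 0} \<subseteq>
      (\<lambda>(i, e). int i + e) ` ({..degree r} \<times> {e. fls_nth x e \<noteq> 0})"
  proof
    fix d assume "d \<in> {d. fls_nth (poly_to_fls r * x) d \<noteq> 0}"
    then obtain i where "i \<le> degree r" "fls_nth x (d - int i) \<noteq> 0" using nz by blast
    then show "d \<in> (\<lambda>(i, e). int i + e) ` ({..degree r} \<times> {e. fls_nth x e \<noteq> 0})"
      by (intro image_eqI[of _ _ "(i, d - int i)"]) auto
  qed
  moreover have "finite ((\<lambda>(i, e). int i + e) ` ({..degree r} \<times> {e. fls_nth x e \<noteq> 0}))"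
    using x by (intro finite_imageI finite_cartesian_product) (auto simp: finsupp_def)
  ultimately have "finite {d. fls_nth (poly_to_fls r * x) d \<noteq> 0}" by (rule finite_subset)
  moreover have "d \<in> X" if d: "fls_nth (poly_to_fls r * x) d \<noteq> 0" for d
  proof -
    obtain i where i: "coeff r i \<noteq> 0" "fls_nth x (d - int i) \<noteq> 0" using nz[OF d] by blast
    then have "int i \<in> H" "d - int i \<in> X" using r x by (auto simp: semigroup_ring_carrier finsupp_def)
    then show ?thesis using X[of "int i" "d - int i"] by simp
  qed
  ultimately show ?thesis by (auto simp: finsupp_def)
qed

definition canonical_degrees :: "int set" where
  "canonical_degrees = {h - \<beta> | h \<beta>. h \<in> H \<and> \<beta> \<in> PF n a}"

lemma canonical_degrees_shift: "h \<in> H \<Longrightarrow> e \<in> canonical_degrees \<Longrightarrow> h + e \<in> canonical_degrees"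
  unfolding canonical_degrees_def by (auto simp: add_diff_eq) (metis H_add)

lemma canonical_module_carrier:
  assumes PF: "finite (PF n a)"
  shows "carrier (canonical_module n a) = (finsupp canonical_degrees :: ('k::field) fls set)"
proof (intro subset_antisym subsetI)
  fix x :: "'k fls" assume "x \<in> carrier (canonical_module n a)"
  then obtain r where r: "\<forall>\<beta>\<in>PF n a. r \<beta> \<in> carrier (semigroup_ring n a)"
    "x = (\<Sum>\<beta>\<in>PF n a. poly_to_fls (r \<beta>) * fls_X_intpow (- \<beta>))"
    by (auto simp: canonical_module_def)
  have summand: "poly_to_fls (r \<beta>) * fls_X_intpow (- \<beta>) \<in> finsupp canonical_degrees" if "\<beta> \<in> PF n a" for \<beta>
  proof (rule finsupp_poly_mult)
    show "r \<beta> \<in> carrier (semigroup_ring n a)" using r(1) that by blast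
    have "- \<beta> \<in> canonical_degrees" unfolding canonical_degrees_def using that H_zero by force
    then show "fls_X_intpow (- \<beta>) \<in> finsupp canonical_degrees"
      using finsupp_monomial[of 1 "- \<beta>"] by simp
  qed (rule canonical_degrees_shift)
  have "(\<Sum>\<beta>\<in>A. poly_to_fls (r \<beta>) * fls_X_intpow (- \<beta>)) \<in> finsupp canonical_degrees"
    if "finite A" "A \<subseteq> PF n a" for A
    using that
  proof (induction A rule: finite_induct)
    case (insert \<beta> A)
    then show ?case by (simp only: sum.insert[OF insert.hyps]) (intro finsupp_add summand, auto)
  qed (simp add: finsupp_zero)
  then show "x \<in> finsupp canonical_degrees" using PF r(2) by blast
next
  fix x :: "'k fls" assume x: "x \<in> finsupp canonical_degrees"
  let ?K = "carrier (canonical_module n a) :: 'k fls set"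
  have zero: "0 \<in> ?K"
    unfolding canonical_module_def by (auto intro!: exI[of _ "\<lambda>_. 0"] simp: semigroup_ring_zero)
  have add: "y + z \<in> ?K" if yz: "y \<in> ?K" "z \<in> ?K" for y z
  proof -
    obtain r s where "\<forall>\<beta>\<in>PF n a. r \<beta> \<in> carrier (semigroup_ring n a)"
      "y = (\<Sum>\<beta>\<in>PF n a. poly_to_fls (r \<beta>) * fls_X_intpow (- \<beta>))"
      "\<forall>\<beta>\<in>PF n a. s \<beta> \<in> carrier (semigroup_ring n a)"
      "z = (\<Sum>\<beta>\<in>PF n a. poly_to_fls (s \<beta>) * fls_X_intpow (- \<beta>))"
      using yz by (auto simp: canonical_module_def)
    then show ?thesis
      unfolding canonical_module_def
      by (auto intro!: exI[of _ "\<lambda>\<beta>. r \<beta> + s \<beta>"] semigroup_ring_add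
          simp: fps_of_poly_add distrib_right sum.distrib)
  qed
  have monomial: "fls_const c * fls_X_intpow e \<in> ?K" if e: "e \<in> canonical_degrees" for c e
  proof -
    obtain h \<beta> where h: "h \<in> H" "\<beta> \<in> PF n a" "e = h - \<beta>"
      using e by (auto simp: canonical_degrees_def)
    define r where "r \<gamma> = (if \<gamma> = \<beta> then monom c (nat h) else 0)" for \<gamma> :: int
    have "monom c (nat h) \<in> carrier (semigroup_ring n a)"
      using h(1) H_nonneg[OF h(1)] by (auto simp: semigroup_ring_carrier coeff_monom split: if_splits)
    then have r: "\<forall>\<gamma>\<in>PF n a. r \<gamma> \<in> carrier (semigroup_ring n a)"
      by (auto simp: r_def semigroup_ring_zero)
    have "(\<Sum>\<gamma>\<in>PF n a. poly_to_fls (r \<gamma>) * fls_X_intpow (- \<gamma>)) =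
        (\<Sum>\<gamma>\<in>PF n a. if \<gamma> = \<beta> then poly_to_fls (monom c (nat h)) * fls_X_intpow (- \<beta>) else 0)"
      by (intro sum.cong) (auto simp: r_def)
    also have "\<dots> = poly_to_fls (monom c (nat h)) * fls_X_intpow (- \<beta>)"
      using PF h(2) by simp
    also have "\<dots> = fls_const c * fls_X_intpow e"
      unfolding poly_to_fls_monom using H_nonneg[OF h(1)]
      by (simp only: mult.assoc fls_X_intpow_times_fls_X_intpow h(3)) simp
    finally show ?thesis
      using r unfolding canonical_module_def by (auto intro!: exI[of _ r])
  qed
  let ?S = "{i. fls_nth x i \<noteq> 0}"
  have S: "finite ?S" "?S \<subseteq> canonical_degrees" using x by (auto simp: finsupp_def)
  have "(\<Sum>i\<in>A. fls_const (fls_nth x i) * fls_X_intpow i) \<in> ?K" if "finite A" "A \<subseteq> canonical_degrees" for A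
    using that by (induction A rule: finite_induct) (simp_all add: zero add monomial)
  then have "(\<Sum>i\<in>?S. fls_const (fls_nth x i) * fls_X_intpow i) \<in> ?K" using S by blast
  then show "x \<in> ?K" using finsupp_expansion[OF S(1) order_refl] by simp
qed

lemma finsupp_component:
  assumes "x \<in> finsupp X"
  shows "\<exists>y\<in>finsupp X. \<forall>i. fls_nth y i = (if i = d then fls_nth (x :: ('k::field) fls) d else 0)"
  using assms
  by (intro bexI[of _ "fls_const (fls_nth x d) * fls_X_intpow d"] finsupp_monomial)
    (auto simp: fls_monomial_nth finsupp_def)

lemma semigroup_ring_graded_smult:
  fixes r :: "('k::field) poly" and x :: "'k fls"
  assumes r: "r \<in> semigroup_ring_grading n a d" and x: "\<forall>i. fls_nth x i \<noteq> 0 \<longrightarrow> i = e"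
    and nz: "fls_nth (poly_to_fls r * x) i \<noteq> 0"
  shows "i = d + e"
proof -
  obtain j where "coeff r j * fls_nth x (i - int j) \<noteq> 0"
    using nz unfolding poly_to_fls_mult_nth by (rule sum.not_neutral_contains_not_neutral)
  then have "int j = d" "i - int j = e" using r x by (auto simp: semigroup_ring_grading_def)
  then show ?thesis by simp
qed

end

section \<open>The almost Gorenstein property\<close>

context cyclic_relations
begin

text \<open>The degrees \<open>-j \<alpha>\<close> of the canonical module that are not of the form \<open>h - (n - 1) \<alpha>\<close> with
  \<open>h \<in> H\<close>.\<close>

definition cokernel_degrees :: "int set" where
  "cokernel_degrees = (\<lambda>j. - (int j * \<alpha>)) ` {1..n - 2}"

lemma canonical_degreesE:
  assumes "e \<in> canonical_degrees"
  obtains h j where "h \<in> H" "1 \<le> j" "j \<le> n - 1" "e = h - int j * \<alpha>"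
    "e + f_top = int (n - 1 - j) * \<alpha> + h"
proof -
  obtain h j where hj: "h \<in> H" "j \<in> {1..n - 1}" "e = h - int j * \<alpha>"
    using assms unfolding canonical_degrees_def PF_eq_multiples by blast
  have "int (n - 1 - j) = int (n - 1) - int j" using hj(2) by auto
  then have "int (n - 1 - j) * \<alpha> = f_top - int j * \<alpha>" by (simp only: left_diff_distrib)
  then have "e + f_top = int (n - 1 - j) * \<alpha> + h" using hj(3) by linarith
  moreover have "1 \<le> j" "j \<le> n - 1" using hj(2) by simp_all
  ultimately show thesis using that[of h j] hj(1,3) by blast
qed

lemma cokernel_degrees_iff:
  assumes "e \<in> canonical_degrees"
  shows "e \<in> cokernel_degrees \<longleftrightarrow> e + f_top \<notin> H"
proof
  assume "e \<in> cokernel_degrees"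
  then obtain j where j: "j \<in> {1..n - 2}" "e = - (int j * \<alpha>)" by (auto simp: cokernel_degrees_def)
  then have "int (n - 1 - j) * \<alpha> \<notin> H"
    by (intro PF_multiple_notin[OF \<alpha>_PF \<alpha>_notin]) auto
  moreover have "int (n - 1 - j) * \<alpha> = e + f_top"
    using j by (auto simp: of_nat_diff algebra_simps)
  ultimately show "e + f_top \<notin> H" by simp
next
  assume notin: "e + f_top \<notin> H"
  obtain h j where hj: "h \<in> H" "1 \<le> j" "j \<le> n - 1" "e = h - int j * \<alpha>"
    "e + f_top = int (n - 1 - j) * \<alpha> + h"
    using canonical_degreesE[OF assms] .
  have h0: "h = 0"
  proof (rule ccontr)
    assume "h \<noteq> 0"
    then show False using PF_shift_multiple[OF \<alpha>_PF hj(1), of "n - 1 - j"] hj(5) notin by simp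
  qed
  have "j \<noteq> n - 1"
  proof
    assume "j = n - 1"
    then have "e + f_top = 0" using hj(4) h0 by simp
    then show False using notin by simp
  qed
  then have "j \<in> {1..n - 2}" using hj by simp
  then show "e \<in> cokernel_degrees" using hj(4) h0 by (auto simp: cokernel_degrees_def)
qed

lemma canonical_degrees_shift_nonzero:
  assumes "h \<in> H" "h \<noteq> 0" "e \<in> canonical_degrees"
  shows "h + e \<notin> cokernel_degrees"
proof -
  obtain h' j where hj: "h' \<in> H" "1 \<le> j" "j \<le> n - 1" "e = h' - int j * \<alpha>"
    "e + f_top = int (n - 1 - j) * \<alpha> + h'"
    using canonical_degreesE[OF assms(3)] .
  have "h + h' \<in> H" "h + h' \<noteq> 0" using H_add[OF assms(1) hj(1)] H_nonneg[OF assms(1)] H_nonneg[OF hj(1)] assms(2) by auto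
  from PF_shift_multiple[OF \<alpha>_PF this, of "n - 1 - j"] have "(h + e) + f_top \<in> H"
    using hj(5) by (metis add.assoc add.left_commute)
  then show ?thesis using cokernel_degrees_iff[OF canonical_degrees_shift[OF assms(1,3)]] by blast
qed

lemma f_top_PF: "f_top \<in> PF n a"
  unfolding PF_eq_multiples using n3 by (intro imageI) simp

lemma canonical_degreesI: "e + f_top \<in> H \<Longrightarrow> e \<in> canonical_degrees"
  unfolding canonical_degrees_def using f_top_PF by (intro CollectI exI[of _ "e + f_top"] exI[of _ f_top]) simp

lemma cokernel_degrees_subset: "cokernel_degrees \<subseteq> canonical_degrees"
proof
  fix e assume "e \<in> cokernel_degrees"
  then obtain j where j: "j \<in> {1..n - 2}" "e = - (int j * \<alpha>)" by (auto simp: cokernel_degrees_def)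
  have "int j * \<alpha> \<in> PF n a" unfolding PF_eq_multiples using j(1) by (intro imageI) auto
  then show "e \<in> canonical_degrees"
    unfolding canonical_degrees_def using j(2) by (intro CollectI exI[of _ 0] exI[of _ "int j * \<alpha>"]) simp
qed

lemma PF_finite: "finite (PF n a)"
  by (simp add: PF_eq_multiples)

definition cokernel_part :: "('k::field) fls \<Rightarrow> 'k fls" where
  "cokernel_part x = (\<Sum>i\<in>cokernel_degrees. fls_const (fls_nth x i) * fls_X_intpow i)"

lemma cokernel_degrees_finite: "finite cokernel_degrees"
  by (simp add: cokernel_degrees_def)

lemma cokernel_part_nth: "fls_nth (cokernel_part x) i = (if i \<in> cokernel_degrees then fls_nth x i else 0)"
  unfolding cokernel_part_def fls_nth_sum fls_monomial_nth using cokernel_degrees_finite by simp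

lemma cokernel_part_in: "cokernel_part x \<in> finsupp cokernel_degrees"
proof -
  have "{i. fls_nth (cokernel_part x) i \<noteq> 0} \<subseteq> cokernel_degrees"
    by (auto simp: cokernel_part_nth split: if_splits)
  then show ?thesis using finite_subset[OF _ cokernel_degrees_finite] by (auto simp: finsupp_def)
qed

lemma cokernel_part_idem: "x \<in> finsupp cokernel_degrees \<Longrightarrow> cokernel_part x = x"
  by (rule fls_eqI) (auto simp: cokernel_part_nth finsupp_def)

lemma cokernel_part_add: "cokernel_part (x + y) = cokernel_part x + cokernel_part y"
  by (rule fls_eqI) (simp add: cokernel_part_nth)

text \<open>No degree of the canonical module is moved into \<open>cokernel_degrees\<close> by adding a nonzero element
  of \<open>H\<close>, so that only the constant term of \<open>r\<close> matters.\<close>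

lemma cokernel_part_mult:
  fixes r :: "'k::field poly"
  assumes r: "r \<in> carrier (semigroup_ring n a)" and x: "x \<in> finsupp canonical_degrees"
  shows "cokernel_part (poly_to_fls r * x) = fls_const (coeff r 0) * cokernel_part x"
proof (rule fls_eqI)
  fix d
  show "fls_nth (cokernel_part (poly_to_fls r * x)) d = fls_nth (fls_const (coeff r 0) * cokernel_part x) d"
  proof (cases "d \<in> cokernel_degrees")
    case True
    have "coeff r i * fls_nth x (d - int i) = (if i = 0 then coeff r 0 * fls_nth x d else 0)" for i
    proof (cases "i = 0 \<or> coeff r i * fls_nth x (d - int i) = 0")
      case False
      then have "int i \<in> H" "int i \<noteq> 0" "d - int i \<in> canonical_degrees"
        using r x by (auto simp: semigroup_ring_carrier finsupp_def)
      from canonical_degrees_shift_nonzero[OF this] True show ?thesis by simp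
    qed auto
    then have "fls_nth (poly_to_fls r * x) d = coeff r 0 * fls_nth x d"
      unfolding poly_to_fls_mult_nth by simp
    then show ?thesis using True by (simp add: cokernel_part_nth)
  qed (simp add: cokernel_part_nth)
qed

text \<open>The cokernel of \<open>R \<rightarrow> K(-a)\<close> is the vector space with basis \<open>t\<^bsup>-j \<alpha>\<^esup>\<close>, \<open>1 \<le> j \<le> n - 2\<close>, on
  which \<open>R\<close> acts through its constant terms; singletons stand for the elements.\<close>

definition cokernel :: "('k::field poly, 'k fls set) module" where
  "cokernel = \<lparr>carrier = (\<lambda>x. {x}) ` finsupp cokernel_degrees, mult = (\<lambda>A B. A), one = {0}, zero = {0},
     add = (\<lambda>A B. {the_elem A + the_elem B}),
     smult = (\<lambda>p A. {fls_const (coeff p 0) * the_elem A})\<rparr>"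

lemma finsupp_const_mult: "x \<in> finsupp X \<Longrightarrow> fls_const c * x \<in> finsupp X"
  unfolding finsupp_def by (auto intro: finite_subset[of _ "{i. fls_nth x i \<noteq> 0}"])

lemma graded_module_ring:
  "graded_module (semigroup_ring n a) (semigroup_ring_grading n a)
     (ring_as_module n a :: ('k::field poly, 'k poly) module) (semigroup_ring_grading n a)"
proof (rule graded_module_by_coefficients[where co = "\<lambda>p i. fls_nth (poly_to_fls p) i"])
  let ?R = "semigroup_ring n a :: 'k poly ring" and ?M = "ring_as_module n a :: ('k poly, 'k poly) module"
  have simps: "carrier ?M = carrier ?R" "x \<oplus>\<^bsub>?M\<^esub> y = x + y" "\<zero>\<^bsub>?M\<^esub> = 0" "x \<odot>\<^bsub>?M\<^esub> y = x * y" for x y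
    by (simp_all add: ring_as_module_def)
  show "module ?R ?M"
  proof (rule moduleI)
    show "abelian_group ?M"
    proof (rule abelian_groupI)
      show "\<exists>y\<in>carrier ?M. y \<oplus>\<^bsub>?M\<^esub> x = \<zero>\<^bsub>?M\<^esub>" if "x \<in> carrier ?M" for x
        using that by (intro bexI[of _ "- x"]) (simp_all add: simps semigroup_ring_uminus)
    qed (simp_all add: simps semigroup_ring_closed add.assoc add.commute)
  qed (simp_all add: simps semigroup_ring_simps semigroup_ring_closed cring_semigroup_ring
      distrib_right distrib_left mult.assoc)
  show "fls_nth (poly_to_fls (x \<oplus>\<^bsub>?M\<^esub> y)) i = fls_nth (poly_to_fls x) i + fls_nth (poly_to_fls y) i" for x y i
    by (simp add: simps)
  show "x = y" if "(\<lambda>i. fls_nth (poly_to_fls x) i) = (\<lambda>i. fls_nth (poly_to_fls y) i)" for x y :: "'k poly"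
  proof (rule poly_eqI)
    fix m show "coeff x m = coeff y m" using fun_cong[OF that, of "int m"] by simp
  qed
  show "finite {i. fls_nth (poly_to_fls x) i \<noteq> 0}" for x :: "'k poly"
  proof (rule finite_subset)
    show "{i. fls_nth (poly_to_fls x) i \<noteq> 0} \<subseteq> {0..int (degree x)}"
      by (auto split: if_splits) (metis le_degree nat_le_iff)
  qed simp
  show "\<exists>y\<in>carrier ?M. (\<lambda>i. fls_nth (poly_to_fls y) i) = (\<lambda>i. if i = d then fls_nth (poly_to_fls x) d else 0)"
    if "x \<in> carrier ?M" for x d
  proof (rule bexI)
    let ?y = "if d < 0 then 0 else monom (coeff x (nat d)) (nat d)"
    show "(\<lambda>i. fls_nth (poly_to_fls ?y) i) = (\<lambda>i. if i = d then fls_nth (poly_to_fls x) d else 0)"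
      unfolding poly_to_fls_nth by (rule ext) (auto simp: coeff_monom)
    show "?y \<in> carrier ?M"
      using that by (auto simp: simps semigroup_ring_carrier coeff_monom split: if_splits)
  qed
  show "semigroup_ring_grading n a d = {x \<in> carrier ?M. \<forall>i. fls_nth (poly_to_fls x) i \<noteq> 0 \<longrightarrow> i = d}" for d
    by (auto simp: semigroup_ring_grading_def simps split: if_splits)
  fix d e and r x :: "'k poly"
  assume r: "r \<in> semigroup_ring_grading n a d" and x: "x \<in> semigroup_ring_grading n a e"
  have "int i = d + e" if "coeff (r * x) i \<noteq> 0" for i
  proof (rule semigroup_ring_graded_smult[OF r, where x = "poly_to_fls x"])
    show "\<forall>i. fls_nth (poly_to_fls x) i \<noteq> 0 \<longrightarrow> i = e"
      using x by (auto simp: semigroup_ring_grading_def split: if_splits)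
    show "fls_nth (poly_to_fls r * poly_to_fls x) (int i) \<noteq> 0"
      using that by (simp add: fps_of_poly_mult[symmetric] fls_times_fps_to_fls[symmetric])
  qed
  then show "r \<odot>\<^bsub>?M\<^esub> x \<in> semigroup_ring_grading n a (d + e)"
    using r x by (auto simp: semigroup_ring_grading_def simps semigroup_ring_mult)
qed

lemma graded_module_canonical:
  "graded_module (semigroup_ring n a) (semigroup_ring_grading n a)
     (canonical_module n a :: ('k::field poly, 'k fls) module) (\<lambda>m. canonical_grading n a (m - c))"
proof (rule graded_module_by_coefficients[where co = "\<lambda>x i. fls_nth x (i - c)"])
  let ?R = "semigroup_ring n a :: 'k poly ring" and ?M = "canonical_module n a :: ('k poly, 'k fls) module"
  have carr: "carrier ?M = finsupp canonical_degrees" by (rule canonical_module_carrier[OF PF_finite])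
  have simps: "x \<oplus>\<^bsub>?M\<^esub> y = x + y" "\<zero>\<^bsub>?M\<^esub> = 0" "p \<odot>\<^bsub>?M\<^esub> y = poly_to_fls p * y" for x y p
    by (simp_all add: canonical_module_def)
  have smult: "poly_to_fls p * x \<in> finsupp canonical_degrees"
    if "p \<in> carrier ?R" "x \<in> finsupp canonical_degrees" for p x
    by (rule finsupp_poly_mult[OF that canonical_degrees_shift])
  show "module ?R ?M"
  proof (rule moduleI)
    show "abelian_group ?M"
    proof (rule abelian_groupI)
      show "\<exists>y\<in>carrier ?M. y \<oplus>\<^bsub>?M\<^esub> x = \<zero>\<^bsub>?M\<^esub>" if "x \<in> carrier ?M" for x
        using that by (intro bexI[of _ "- x"]) (simp_all add: carr simps finsupp_uminus)
    qed (simp_all add: carr simps finsupp_add finsupp_zero add.assoc add.commute)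
  qed (simp_all add: carr simps semigroup_ring_simps smult cring_semigroup_ring
      distrib_right distrib_left mult.assoc fps_of_poly_add fps_of_poly_mult fls_times_fps_to_fls)
  show "fls_nth (x \<oplus>\<^bsub>?M\<^esub> y) (i - c) = fls_nth x (i - c) + fls_nth y (i - c)" for x y i
    by (simp add: simps)
  show "x = y" if "(\<lambda>i. fls_nth x (i - c)) = (\<lambda>i. fls_nth y (i - c))" for x y :: "'k fls"
  proof (rule fls_eqI)
    fix m show "fls_nth x m = fls_nth y m" using fun_cong[OF that, of "m + c"] by simp
  qed
  show "finite {i. fls_nth x (i - c) \<noteq> 0}" if "x \<in> carrier ?M" for x
  proof (rule finite_subset)
    show "{i. fls_nth x (i - c) \<noteq> 0} \<subseteq> (\<lambda>i. i + c) ` {i. fls_nth x i \<noteq> 0}"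
    proof
      fix i assume "i \<in> {i. fls_nth x (i - c) \<noteq> 0}"
      then show "i \<in> (\<lambda>i. i + c) ` {i. fls_nth x i \<noteq> 0}" by (intro image_eqI[of _ _ "i - c"]) auto
    qed
    show "finite ((\<lambda>i. i + c) ` {i. fls_nth x i \<noteq> 0})" using that by (simp add: carr finsupp_def)
  qed
  show "\<exists>y\<in>carrier ?M. (\<lambda>i. fls_nth y (i - c)) = (\<lambda>i. if i = d then fls_nth x (d - c) else 0)"
    if x: "x \<in> carrier ?M" for x d
  proof -
    obtain y where "y \<in> finsupp canonical_degrees" "\<And>i. fls_nth y i = (if i = d - c then fls_nth x (d - c) else 0)"
      using finsupp_component[OF x[unfolded carr], of "d - c"] by blast
    then show ?thesis by (intro bexI[of _ y]) (auto simp: carr)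
  qed
  show "canonical_grading n a (d - c) = {x \<in> carrier ?M. \<forall>i. fls_nth x (i - c) \<noteq> 0 \<longrightarrow> i = d}" for d
    unfolding canonical_grading_def by (auto, metis add_diff_cancel diff_add_cancel)
  fix d e and r :: "'k poly" and x :: "'k fls"
  assume r: "r \<in> semigroup_ring_grading n a d" and x: "x \<in> canonical_grading n a (e - c)"
  have supp: "i = d + (e - c)" if "fls_nth (poly_to_fls r * x) i \<noteq> 0" for i
    by (rule semigroup_ring_graded_smult[OF r _ that]) (use x in \<open>auto simp: canonical_grading_def\<close>)
  then show "r \<odot>\<^bsub>?M\<^esub> x \<in> canonical_grading n a (d + e - c)"
    using r x
    by (auto simp: canonical_grading_def simps carr semigroup_ring_grading_def intro: smult dest: supp)
qed

lemma cokernel_simps: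
  "carrier (cokernel :: ('k::field poly, 'k fls set) module) = (\<lambda>x. {x}) ` finsupp cokernel_degrees"
  "{x} \<oplus>\<^bsub>cokernel\<^esub> {y} = {x + y}" "\<zero>\<^bsub>cokernel\<^esub> = {0}"
  "p \<odot>\<^bsub>cokernel\<^esub> {y} = {fls_const (coeff p 0) * y}"
  by (simp_all add: cokernel_def)

definition cokernel_grading :: "int \<Rightarrow> ('k::field) fls set set" where
  "cokernel_grading d = {A \<in> carrier cokernel. \<forall>i. fls_nth (the_elem A) (i - f_top) \<noteq> 0 \<longrightarrow> i = d}"

lemma graded_module_cokernel:
  "graded_module (semigroup_ring n a) (semigroup_ring_grading n a)
     (cokernel :: ('k::field poly, 'k fls set) module) cokernel_grading"
proof (rule graded_module_by_coefficients[where co = "\<lambda>A i. fls_nth (the_elem A) (i - f_top)"])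
  let ?R = "semigroup_ring n a :: 'k poly ring" and ?M = "cokernel :: ('k poly, 'k fls set) module"
  show "module ?R ?M"
  proof (rule moduleI)
    show "abelian_group ?M"
    proof (rule abelian_groupI)
      show "\<exists>y\<in>carrier ?M. y \<oplus>\<^bsub>?M\<^esub> A = \<zero>\<^bsub>?M\<^esub>" if A: "A \<in> carrier ?M" for A
      proof -
        obtain x where "x \<in> finsupp cokernel_degrees" "A = {x}" using A by (auto simp: cokernel_simps)
        then show ?thesis by (intro bexI[of _ "{- x}"]) (auto simp: cokernel_simps finsupp_uminus)
      qed
    qed (auto simp: cokernel_simps finsupp_add finsupp_zero add.assoc add.commute)
  qed (auto simp: cokernel_simps semigroup_ring_simps finsupp_const_mult cring_semigroup_ring
      distrib_right distrib_left mult.assoc coeff_mult_0 simp flip: fls_plus_const fls_const_mult_const)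
  show "fls_nth (the_elem (A \<oplus>\<^bsub>?M\<^esub> B)) (i - f_top) =
      fls_nth (the_elem A) (i - f_top) + fls_nth (the_elem B) (i - f_top)" for A B i
    by (simp add: cokernel_def)
  show "A = B" if AB: "A \<in> carrier ?M" "B \<in> carrier ?M"
    "(\<lambda>i. fls_nth (the_elem A) (i - f_top)) = (\<lambda>i. fls_nth (the_elem B) (i - f_top))" for A B
  proof -
    obtain x y where xy: "A = {x}" "B = {y}" using AB(1,2) by (auto simp: cokernel_simps)
    have "x = y"
    proof (rule fls_eqI)
      fix m show "fls_nth x m = fls_nth y m" using fun_cong[OF AB(3), of "m + f_top"] xy by simp
    qed
    then show ?thesis by (simp add: xy)
  qed
  show "finite {i. fls_nth (the_elem A) (i - f_top) \<noteq> 0}" if A: "A \<in> carrier ?M" for A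
  proof (rule finite_subset)
    obtain x where x: "x \<in> finsupp cokernel_degrees" "A = {x}" using A by (auto simp: cokernel_simps)
    show "{i. fls_nth (the_elem A) (i - f_top) \<noteq> 0} \<subseteq> (\<lambda>i. i + f_top) ` cokernel_degrees"
    proof
      fix i assume "i \<in> {i. fls_nth (the_elem A) (i - f_top) \<noteq> 0}"
      then show "i \<in> (\<lambda>i. i + f_top) ` cokernel_degrees"
        using x by (intro image_eqI[of _ _ "i - f_top"]) (auto simp: finsupp_def)
    qed
  qed (simp add: cokernel_degrees_finite)
  show "\<exists>B\<in>carrier ?M. (\<lambda>i. fls_nth (the_elem B) (i - f_top)) =
      (\<lambda>i. if i = d then fls_nth (the_elem A) (d - f_top) else 0)" if A: "A \<in> carrier ?M" for A d
  proof -
    obtain x where x: "x \<in> finsupp cokernel_degrees" "A = {x}" using A by (auto simp: cokernel_simps)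
    obtain y where "y \<in> finsupp cokernel_degrees"
      "\<And>i. fls_nth y i = (if i = d - f_top then fls_nth x (d - f_top) else 0)"
      using finsupp_component[OF x(1), of "d - f_top"] by blast
    then show ?thesis by (intro bexI[of _ "{y}"]) (auto simp: cokernel_simps x(2))
  qed
  show "cokernel_grading d = {A \<in> carrier ?M. \<forall>i. fls_nth (the_elem A) (i - f_top) \<noteq> 0 \<longrightarrow> i = d}" for d
    by (rule cokernel_grading_def)
  fix d e and r :: "'k poly" and A :: "'k fls set"
  assume r: "r \<in> semigroup_ring_grading n a d" and A: "A \<in> cokernel_grading e"
  obtain x where x: "x \<in> finsupp cokernel_degrees" "A = {x}"
    using A by (auto simp: cokernel_grading_def cokernel_simps)
  have "i = d + e" if "coeff r 0 * fls_nth x (i - f_top) \<noteq> 0" for i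
  proof -
    have "d = 0" using r that by (auto simp: semigroup_ring_grading_def)
    moreover have "i = e" using A that by (auto simp: cokernel_grading_def x(2))
    ultimately show ?thesis by simp
  qed
  then show "r \<odot>\<^bsub>?M\<^esub> A \<in> cokernel_grading (d + e)"
    using x by (auto simp: cokernel_grading_def cokernel_simps finsupp_const_mult)
qed

text \<open>The exact sequence maps \<open>r\<close> to \<open>r t\<^bsup>-f\<^esup>\<close> with \<open>f = (n - 1) \<alpha>\<close>. Degrees \<open>h - j \<alpha>\<close> of the
  canonical module lie in \<open>H - f\<close> unless \<open>h = 0\<close> and \<open>j < n - 1\<close>.\<close>

lemma almost_Gorenstein_cyclic: "almost_Gorenstein_graded TYPE('k::field) n a"
proof -
  let ?R = "semigroup_ring n a :: 'k poly ring" and ?K = "canonical_module n a :: ('k poly, 'k fls) module"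
  let ?C = "cokernel :: ('k poly, 'k fls set) module"
  let ?M = "ring_as_module n a :: ('k poly, 'k poly) module"
  let ?Kg = "\<lambda>m. canonical_grading n a (m - a_invariant n a)"
  define g where "g r = poly_to_fls r * fls_X_intpow (- f_top)" for r :: "'k poly"
  define h where "h x = {cokernel_part x}" for x :: "'k fls"
  have a_inv: "a_invariant n a = f_top" by (simp add: a_invariant_def frobenius_eq)
  have K: "carrier ?K = finsupp canonical_degrees" by (rule canonical_module_carrier[OF PF_finite])
  have K_simps: "x \<oplus>\<^bsub>?K\<^esub> y = x + y" "p \<odot>\<^bsub>?K\<^esub> y = poly_to_fls p * y" for x y p
    by (simp_all add: canonical_module_def)
  have M_simps: "carrier ?M = carrier ?R" "x \<oplus>\<^bsub>?M\<^esub> y = x + y" "x \<odot>\<^bsub>?M\<^esub> y = x * y" for x y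
    by (simp_all add: ring_as_module_def)
  have g_nth: "fls_nth (g r) i = fls_nth (poly_to_fls r) (i + f_top)" for r i
    unfolding g_def fls_X_intpow_times_conv_shift(2) by simp
  have g_in: "g r \<in> finsupp canonical_degrees" if r: "r \<in> carrier ?R" for r
    unfolding g_def
  proof (rule finsupp_poly_mult[OF r _ canonical_degrees_shift])
    have "- f_top \<in> canonical_degrees" by (rule canonical_degreesI) simp
    then show "fls_X_intpow (- f_top) \<in> finsupp canonical_degrees"
      using finsupp_monomial[of 1 "- f_top"] by simp
  qed
  have g_hom: "graded_hom ?R ?M (semigroup_ring_grading n a) ?K ?Kg g"
    unfolding graded_hom_def
  proof (intro conjI ballI allI)
    show "g x \<in> carrier ?K" if "x \<in> carrier ?M" for x using that g_in by (simp add: K M_simps)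
    show "g (x \<oplus>\<^bsub>?M\<^esub> y) = g x \<oplus>\<^bsub>?K\<^esub> g y" for x y
      by (simp add: K_simps M_simps g_def fps_of_poly_add distrib_right)
    show "g (r \<odot>\<^bsub>?M\<^esub> x) = r \<odot>\<^bsub>?K\<^esub> g x" for r x
      by (simp only: K_simps M_simps g_def fps_of_poly_mult fls_times_fps_to_fls mult.assoc)
    show "g x \<in> ?Kg d" if "x \<in> semigroup_ring_grading n a d" for x d
    proof -
      have x: "x \<in> carrier ?R" "\<And>i. coeff x i \<noteq> 0 \<Longrightarrow> int i = d"
        using that by (auto simp: semigroup_ring_grading_def)
      have "i = d - f_top" if "fls_nth (g x) i \<noteq> 0" for i
      proof -
        have "i + f_top \<ge> 0" "coeff x (nat (i + f_top)) \<noteq> 0"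
          using that unfolding g_nth poly_to_fls_nth by (auto split: if_splits)
        then show ?thesis using x(2)[of "nat (i + f_top)"] by simp
      qed
      then show ?thesis using g_in[OF x(1)] by (simp add: canonical_grading_def K a_inv)
    qed
  qed
  have h_hom: "graded_hom ?R ?K ?Kg ?C cokernel_grading h"
    unfolding graded_hom_def
  proof (intro conjI ballI allI)
    show in_C: "h x \<in> carrier ?C" for x
      unfolding h_def cokernel_simps by (rule imageI[OF cokernel_part_in])
    show "h (x \<oplus>\<^bsub>?K\<^esub> y) = h x \<oplus>\<^bsub>?C\<^esub> h y" for x y
      by (simp add: K_simps cokernel_simps h_def cokernel_part_add)
    show "h (r \<odot>\<^bsub>?K\<^esub> x) = r \<odot>\<^bsub>?C\<^esub> h x" if "r \<in> carrier ?R" "x \<in> carrier ?K" for r x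
      using that by (simp add: K K_simps cokernel_simps h_def cokernel_part_mult)
    show "h x \<in> cokernel_grading d" if "x \<in> ?Kg d" for x d
      unfolding cokernel_grading_def using in_C that
      by (auto simp: h_def cokernel_part_nth canonical_grading_def a_inv split: if_splits)
  qed
  have g_inj: "inj_on g (carrier ?M)"
  proof (rule inj_onI, rule poly_eqI)
    fix x y m assume "g x = g y"
    then have "fls_nth (g x) (int m - f_top) = fls_nth (g y) (int m - f_top)" by simp
    then show "coeff x m = coeff y m" unfolding g_nth poly_to_fls_nth by simp
  qed
  have exact: "g ` carrier ?M = {y \<in> carrier ?K. h y = \<zero>\<^bsub>?C\<^esub>}"
  proof (intro subset_antisym subsetI)
    fix y assume "y \<in> g ` carrier ?M"
    then obtain r where r: "r \<in> carrier ?R" "y = g r" by (auto simp: M_simps)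
    have "cokernel_part y = 0"
    proof (rule fls_eqI)
      fix i
      have "fls_nth (g r) i = 0" if i: "i \<in> cokernel_degrees"
      proof (rule ccontr)
        assume "fls_nth (g r) i \<noteq> 0"
        then have "0 \<le> i + f_top" "int (nat (i + f_top)) \<in> H"
          using r(1) unfolding g_nth poly_to_fls_nth by (auto simp: semigroup_ring_carrier split: if_splits)
        then show False using cokernel_degrees_iff[of i] i cokernel_degrees_subset by auto
      qed
      then show "fls_nth (cokernel_part y) i = fls_nth 0 i" by (simp add: cokernel_part_nth r(2))
    qed
    then show "y \<in> {y \<in> carrier ?K. h y = \<zero>\<^bsub>?C\<^esub>}"
      using g_in[OF r(1)] by (simp add: K r(2) h_def cokernel_simps)
  next
    fix y assume y: "y \<in> {y \<in> carrier ?K. h y = \<zero>\<^bsub>?C\<^esub>}"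
    then have fin: "finite {i. fls_nth y i \<noteq> 0}" and supp: "\<And>i. fls_nth y i \<noteq> 0 \<Longrightarrow> i \<in> canonical_degrees"
      and trunc: "cokernel_part y = 0" by (auto simp: K finsupp_def h_def cokernel_simps)
    have inH: "i + f_top \<in> H" if i: "fls_nth y i \<noteq> 0" for i
    proof -
      have "fls_nth (cokernel_part y) i = 0" by (simp add: trunc)
      then have "i \<notin> cokernel_degrees" using i by (auto simp: cokernel_part_nth)
      then show ?thesis using cokernel_degrees_iff[OF supp[OF i]] by blast
    qed
    define r where "r = (\<Sum>i\<in>{i. fls_nth y i \<noteq> 0}. monom (fls_nth y i) (nat (i + f_top)))"
    have r_coeff: "coeff r m = fls_nth y (int m - f_top)" for m
    proof -
      have "coeff r m = (\<Sum>i\<in>{i. fls_nth y i \<noteq> 0}. if i = int m - f_top then fls_nth y (int m - f_top) else 0)"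
        unfolding r_def coeff_sum coeff_monom
      proof (intro sum.cong refl)
        fix i assume "i \<in> {i. fls_nth y i \<noteq> 0}"
        then have "0 \<le> i + f_top" using inH H_nonneg by blast
        then have "nat (i + f_top) = m \<longleftrightarrow> i = int m - f_top" by linarith
        then show "(if nat (i + f_top) = m then fls_nth y i else 0) =
            (if i = int m - f_top then fls_nth y (int m - f_top) else 0)" by auto
      qed
      then show ?thesis using fin by simp
    qed
    have "r \<in> carrier ?R"
      unfolding semigroup_ring_carrier r_coeff using inH by (metis diff_add_cancel)
    moreover have "g r = y"
    proof (rule fls_eqI)
      fix i
      show "fls_nth (g r) i = fls_nth y i"
      proof (cases "i + f_top < 0")
        case True
        then have "fls_nth y i = 0" using inH[of i] H_nonneg[of "i + f_top"] by fastforce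
        then show ?thesis unfolding g_nth poly_to_fls_nth using True by simp
      next
        case False
        then show ?thesis unfolding g_nth poly_to_fls_nth r_coeff by simp
      qed
    qed
    ultimately show "y \<in> g ` carrier ?M" by (auto simp: M_simps)
  qed
  have onto: "h ` carrier ?K = carrier ?C"
  proof (intro subset_antisym subsetI)
    fix A assume "A \<in> carrier ?C"
    then obtain x where x: "x \<in> finsupp cokernel_degrees" "A = {x}" by (auto simp: cokernel_simps)
    then have "x \<in> carrier ?K" using cokernel_degrees_subset by (auto simp: K finsupp_def)
    moreover have "h x = A" by (simp add: h_def cokernel_part_idem[OF x(1)] x(2))
    ultimately show "A \<in> h ` carrier ?K" by blast
  qed (auto simp: h_def cokernel_simps cokernel_part_in)
  have "graded_short_exact ?R (semigroup_ring_grading n a) ?M (semigroup_ring_grading n a) ?K ?Kg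
      ?C cokernel_grading g h"
    unfolding graded_short_exact_def
    by (intro conjI graded_module_ring graded_module_canonical graded_module_cokernel
        g_hom h_hom g_inj exact onto)
  moreover have "\<forall>r\<in>max_ideal n a. \<forall>c\<in>carrier ?C. r \<odot>\<^bsub>?C\<^esub> c = \<zero>\<^bsub>?C\<^esub>"
  proof (intro ballI)
    fix r :: "'k poly" and c assume r: "r \<in> max_ideal n a" and "c \<in> carrier ?C"
    then obtain x where "c = {x}" by (auto simp: cokernel_simps)
    then show "r \<odot>\<^bsub>?C\<^esub> c = \<zero>\<^bsub>?C\<^esub>" by (simp add: cokernel_simps max_ideal_constant_term[OF r])
  qed
  ultimately show ?thesis unfolding almost_Gorenstein_graded_def by blast
qed

end

section \<open>Cyclic presentations\<close>

definition cyclic_succ :: "nat \<Rightarrow> (nat \<Rightarrow> nat) \<Rightarrow> nat \<Rightarrow> nat" where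
  "cyclic_succ n \<sigma> i = \<sigma> (cyclic_next n (inv_into UNIV \<sigma> i))"

lemma cyclic_presentation_imp_generic:
  fixes I :: "('k::field) mpoly set"
  assumes "cyclic_presentation n I \<sigma> l"
  defines "f \<equiv> \<lambda>i. Var (cyclic_succ n \<sigma> i) ^ l (cyclic_next n (inv_into UNIV \<sigma> i))"
  shows "generic_presentation n a I f"
proof -
  have \<sigma>: "\<sigma> permutes {1..n}" and l: "\<forall>i\<in>{1..n}. 0 < l i"
    and I: "I = I2 n (\<lambda>j. Var (\<sigma> (cyclic_next n j)) ^ l (cyclic_next n j)) (\<lambda>j. Var (\<sigma> j))"
    using assms by (auto simp: cyclic_presentation_def)
  have next_in: "cyclic_next n (inv_into UNIV \<sigma> i) \<in> {1..n}" if "i \<in> {1..n}" for i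
    using permutes_in_image[OF permutes_inv[OF \<sigma>]] that by (intro cyclic_next_in) blast
  have f_irr: "f i \<in> irrelevant_ideal n" if "i \<in> {1..n}" for i
    unfolding f_def cyclic_succ_def using next_in[OF that] l permutes_in_image[OF \<sigma>]
    by (intro Var_power_irrelevant) blast+
  have "homogeneous a (f i)" for i
    unfolding f_def Var_power homogeneous_def by auto
  moreover have "I = I2 n f Var"
  proof -
    have "I = I2 n (\<lambda>j. f (\<sigma> j)) (\<lambda>j. Var (\<sigma> j))"
      unfolding I by (simp add: f_def cyclic_succ_def permutes_inverses[OF \<sigma>])
    also have "\<dots> = I2 n f Var"
      by (rule I2_permute[OF \<sigma>]) (use f_irr irrelevant_ideal_subset in \<open>blast intro: Var_in_poly_ring\<close>)+
    finally show ?thesis .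
  qed
  ultimately show ?thesis using f_irr by (simp add: generic_presentation_def)
qed

context minimal_generators
begin

lemma PF_imp_cyclic_presentation:
  assumes "\<alpha> \<in> PF n a" "int (n - 1) * \<alpha> \<notin> H"
  shows "\<exists>\<sigma> l. cyclic_presentation n (defining_ideal n a :: ('k::field) mpoly set) \<sigma> l"
proof -
  obtain \<tau> L where "cyclic_relations n a \<alpha> \<tau> L" using cyclic_relations_exist[OF assms] .
  then interpret C: cyclic_relations n a \<alpha> \<tau> L .
  have n1: "1 \<le> n" using n3 by simp
  obtain \<sigma> where \<sigma>: "\<sigma> permutes {1..n}" "\<And>j. j \<in> {1..n} \<Longrightarrow> \<tau> (\<sigma> j) = \<sigma> (cyclic_next n j)"
    using one_cycle_enumeration[OF C.cycle n1] by blast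
  have im: "\<sigma> i \<in> {1..n}" if "i \<in> {1..n}" for i
    using permutes_in_image[OF \<sigma>(1)] that by blast
  let ?u = "\<lambda>i. single (single (\<tau> i) (L (\<tau> i))) 1 :: 'k mpoly"
  have "defining_ideal n a = I2 n ?u Var" by (rule C.defining_ideal_eq_cyclic_minors)
  also have "\<dots> = I2 n (\<lambda>j. ?u (\<sigma> j)) (\<lambda>j. Var (\<sigma> j))"
    by (rule I2_permute[OF \<sigma>(1), symmetric])
      (rule single_in_poly_ring[OF C.cyclic_exp_expo] Var_in_poly_ring; assumption)+
  also have "\<dots> = I2 n (\<lambda>j. Var (\<sigma> (cyclic_next n j)) ^ (L \<circ> \<sigma>) (cyclic_next n j)) (\<lambda>j. Var (\<sigma> j))"
    by (rule I2_cong) (simp_all add: Var_power \<sigma>(2))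
  finally have "cyclic_presentation n (defining_ideal n a :: 'k mpoly set) \<sigma> (L \<circ> \<sigma>)"
    using \<sigma>(1) C.L_pos[OF im] by (simp add: cyclic_presentation_def)
  then show ?thesis by blast
qed

lemma cyclic_presentation_exponents:
  assumes "cyclic_presentation n (defining_ideal n a :: ('k::field) mpoly set) \<sigma> l" and i: "i \<in> {1..n}"
  shows "int (l i) = int (LEAST m. 0 < m \<and> int (m * a (\<sigma> i)) \<in> sgrp ({1..n} - {i}) (a \<circ> \<sigma>)) - 1"
proof -
  have \<sigma>: "\<sigma> permutes {1..n}" and l: "\<forall>i\<in>{1..n}. 0 < l i"
    using assms by (auto simp: cyclic_presentation_def)
  let ?f = "\<lambda>i. Var (cyclic_succ n \<sigma> i) ^ l (cyclic_next n (inv_into UNIV \<sigma> i)) :: 'k mpoly"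
  obtain \<delta> where \<delta>: "\<delta> \<in> PF n a" "int (n - 1) * \<delta> \<notin> H"
    "\<And>i. i \<in> {1..n} \<Longrightarrow> ?f i \<noteq> 0 \<and> (\<forall>u\<in>keys (?f i). int (wdeg_mon a u) = \<delta> + int (a i))"
    using PF_of_presentation[OF cyclic_presentation_imp_generic[OF assms(1)]] by blast
  define L where "L i = l (inv_into UNIV \<sigma> i)" for i
  interpret C: cyclic_relations n a \<delta> "cyclic_succ n \<sigma>" L
  proof unfold_locales
    show "\<delta> \<in> PF n a" "int (n - 1) * \<delta> \<notin> H" by (fact \<delta>)+
    show "one_cycle n (cyclic_succ n \<sigma>)"
      using one_cycle_conjugate[OF \<sigma>] n3 by (simp add: cyclic_succ_def[abs_def])
    show "0 < L i" if "i \<in> {1..n}" for i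
      using l permutes_in_image[OF permutes_inv[OF \<sigma>]] that unfolding L_def by blast
    show "\<delta> + int (a i) = int (L (cyclic_succ n \<sigma> i) * a (cyclic_succ n \<sigma> i))" if "i \<in> {1..n}" for i
      using \<delta>(3)[OF that] by (simp add: Var_power L_def cyclic_succ_def permutes_inverses[OF \<sigma>])
  qed
  have \<sigma>i: "\<sigma> i \<in> {1..n}" using permutes_in_image[OF \<sigma>] i by blast
  have "bij_betw \<sigma> ({1..n} - {i}) ({1..n} - {\<sigma> i})"
  proof -
    have inj: "inj \<sigma>" by (rule permutes_inj[OF \<sigma>])
    have "\<sigma> ` ({1..n} - {i}) = {1..n} - {\<sigma> i}"
      by (simp add: image_set_diff[OF inj] permutes_image[OF \<sigma>])
    then show ?thesis unfolding bij_betw_def using inj_on_subset[OF inj subset_UNIV] by simp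
  qed
  then have "(LEAST m. 0 < m \<and> int (m * a (\<sigma> i)) \<in> sgrp ({1..n} - {i}) (a \<circ> \<sigma>)) = L (\<sigma> i) + 1"
    using C.least_multiple[OF \<sigma>i] by (simp only: sgrp_reindex)
  moreover have "L (\<sigma> i) = l i" by (simp add: L_def permutes_inverses[OF \<sigma>])
  ultimately show ?thesis by simp
qed

end

theorem theorem1p2:
  fixes n :: nat and a :: "nat \<Rightarrow> nat"
    and I :: "('k::field) mpoly set" and H :: "int set"
  assumes n: "n \<ge> 3"
    and pos: "\<forall>i\<in>{1..n}. 0 < a i"
    and gcd: "Gcd (a ` {1..n}) = 1"
    and min_gen: "minimally_generates n a"
    and H: "H = sgrp {1..n} a"
    and I: "I = defining_ideal n a"
  shows
    "((\<exists>f. generic_presentation n a I f) \<longleftrightarrow> (\<exists>\<sigma> l. cyclic_presentation n I \<sigma> l)) \<and>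
     ((\<exists>\<sigma> l. cyclic_presentation n I \<sigma> l) \<longleftrightarrow> (\<exists>\<alpha>\<in>PF n a. int (n - 1) * \<alpha> \<notin> H)) \<and>
     ((\<exists>f. generic_presentation n a I f) \<longrightarrow>
        (\<forall>\<sigma> l. cyclic_presentation n I \<sigma> l \<longrightarrow>
           (\<forall>i\<in>{1..n}. int (l i) =
              int (LEAST m. 0 < m \<and> int (m * a (\<sigma> i)) \<in> sgrp ({1..n} - {i}) (a \<circ> \<sigma>)) - 1)) \<and>
        (\<forall>f. \<forall>\<alpha>\<in>PF n a. generic_presentation n a I f \<longrightarrow> int (n - 1) * \<alpha> \<notin> H \<longrightarrow>
           (\<forall>i\<in>{1..n}. \<alpha> = int (wdegree a (f i)) - int (a i))) \<and>
        (\<forall>\<alpha>\<in>PF n a. int (n - 1) * \<alpha> \<notin> H \<longrightarrow>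
           PF n a = (\<lambda>j. int j * \<alpha>) ` {1..n - 1}) \<and>
        almost_Gorenstein_graded TYPE('k) n a \<and>
        almost_symmetric n a)"
proof -
  interpret minimal_generators n a
    by unfold_locales (fact n pos gcd min_gen)+
  have PF_multiples: "PF n a = (\<lambda>j. int j * \<alpha>) ` {1..n - 1}"
    if \<alpha>: "\<alpha> \<in> PF n a" "int (n - 1) * \<alpha> \<notin> sgrp {1..n} a" for \<alpha>
  proof -
    obtain \<tau> L where "cyclic_relations n a \<alpha> \<tau> L" using cyclic_relations_exist[OF \<alpha>] .
    then show ?thesis by (rule cyclic_relations.PF_eq_multiples)
  qed
  have imp12: "\<exists>f. generic_presentation n a I f" if "cyclic_presentation n I \<sigma> l" for \<sigma> l
    using cyclic_presentation_imp_generic[OF that] by blast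
  have imp13: "\<exists>\<alpha>\<in>PF n a. int (n - 1) * \<alpha> \<notin> H" if "generic_presentation n a I f" for f
    using PF_of_presentation[OF that[unfolded I]] H by metis
  have imp32: "\<exists>\<sigma> l. cyclic_presentation n I \<sigma> l" if "\<alpha> \<in> PF n a" "int (n - 1) * \<alpha> \<notin> H" for \<alpha>
    using PF_imp_cyclic_presentation that unfolding H I by blast
  have degrees: "\<alpha> = int (wdegree a (f i)) - int (a i)"
    if f: "generic_presentation n a I f" and \<alpha>: "\<alpha> \<in> PF n a" "int (n - 1) * \<alpha> \<notin> H" and i: "i \<in> {1..n}" for f \<alpha> i
  proof -
    obtain \<delta> where \<delta>: "\<delta> \<in> PF n a" "int (n - 1) * \<delta> \<notin> sgrp {1..n} a"
      "\<And>i. i \<in> {1..n} \<Longrightarrow> f i \<noteq> 0 \<and> (\<forall>u\<in>keys (f i). int (wdeg_mon a u) = \<delta> + int (a i))"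
      using PF_of_presentation[OF f[unfolded I]] by blast
    have "\<delta> \<le> \<alpha>" "\<alpha> \<le> \<delta>"
    proof -
      obtain j where "1 \<le> j" "\<alpha> = int j * \<delta>" using PF_multiples[OF \<delta>(1,2)] \<alpha>(1) by auto
      then show "\<delta> \<le> \<alpha>" using PF_pos[OF \<delta>(1)] mult_right_mono[of 1 "int j" \<delta>] by simp
      obtain j where "1 \<le> j" "\<delta> = int j * \<alpha>" using PF_multiples[OF \<alpha>(1) \<alpha>(2)[unfolded H]] \<delta>(1) by auto
      then show "\<alpha> \<le> \<delta>" using PF_pos[OF \<alpha>(1)] mult_right_mono[of 1 "int j" \<alpha>] by simp
    qed
    then have "\<alpha> = \<delta>" by simp
    obtain u where u: "u \<in> keys (f i)" using \<delta>(3)[OF i] by (metis all_not_in_conv keys_eq_empty)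
    have "wdeg_mon a ` keys (f i) = {wdeg_mon a u}"
    proof -
      have "wdeg_mon a v = wdeg_mon a u" if "v \<in> keys (f i)" for v
      proof -
        have "int (wdeg_mon a v) = int (wdeg_mon a u)" using \<delta>(3)[OF i] u that by simp
        then show ?thesis by (simp only: of_nat_eq_iff)
      qed
      then show ?thesis using u by blast
    qed
    then have "int (wdegree a (f i)) = \<delta> + int (a i)"
      using \<delta>(3)[OF i] u by (simp add: wdegree_def)
    then show ?thesis using \<open>\<alpha> = \<delta>\<close> by simp
  qed
  have gorenstein: "almost_Gorenstein_graded TYPE('k) n a \<and> almost_symmetric n a"
    if f: "generic_presentation n a I f" for f
  proof -
    obtain \<alpha> where "\<alpha> \<in> PF n a" "int (n - 1) * \<alpha> \<notin> sgrp {1..n} a" using imp13[OF f] H by blast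
    then obtain \<tau> L where "cyclic_relations n a \<alpha> \<tau> L" using cyclic_relations_exist by blast
    then show ?thesis
      using cyclic_relations.almost_Gorenstein_cyclic cyclic_relations.almost_symmetric_cyclic by blast
  qed
  show ?thesis
  proof (intro conjI impI)
    show "(\<exists>f. generic_presentation n a I f) \<longleftrightarrow> (\<exists>\<sigma> l. cyclic_presentation n I \<sigma> l)"
      using imp12 imp13 imp32 by blast
    show "(\<exists>\<sigma> l. cyclic_presentation n I \<sigma> l) \<longleftrightarrow> (\<exists>\<alpha>\<in>PF n a. int (n - 1) * \<alpha> \<notin> H)"
      using imp12 imp13 imp32 by blast
    show "\<forall>\<sigma> l. cyclic_presentation n I \<sigma> l \<longrightarrow> (\<forall>i\<in>{1..n}. int (l i) =
        int (LEAST m. 0 < m \<and> int (m * a (\<sigma> i)) \<in> sgrp ({1..n} - {i}) (a \<circ> \<sigma>)) - 1)"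
      unfolding I by (intro allI impI ballI cyclic_presentation_exponents)
    show "\<forall>f. \<forall>\<alpha>\<in>PF n a. generic_presentation n a I f \<longrightarrow> int (n - 1) * \<alpha> \<notin> H \<longrightarrow>
        (\<forall>i\<in>{1..n}. \<alpha> = int (wdegree a (f i)) - int (a i))"
      using degrees by blast
    show "\<forall>\<alpha>\<in>PF n a. int (n - 1) * \<alpha> \<notin> H \<longrightarrow> PF n a = (\<lambda>j. int j * \<alpha>) ` {1..n - 1}"
      using PF_multiples unfolding H by blast
  qed (use gorenstein in blast)+
qed

end
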